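(* For every $\alpha>0$ there is a countably connected domain $\Omega_\alpha\subset\mathbb{S}^2$ with $\sum_{p\in\mathcal{C}(\Omega_\alpha)}\operatorname{diam}(p)^\alpha<\infty$ such that $\{0\}\in\mathcal{C}_P(\Omega_\alpha)$ but $\hat f(\{0\})\in\mathcal{C}_N(D)$ for every conformal homeomorphism $f:\Omega_\alpha\to D$ onto a circle domain $D\subset\mathbb{S}^2$.
   Context: $\mathbb{S}^2$ is the Riemann sphere $\mathbb{C}\cup\{\infty\}$ with the spherical metric. For a domain $\Omega\subset\mathbb{S}^2$, $\mathcal{C}(\Omega)$ is the set of connected components of $\mathbb{S}^2\setminus\Omega$; $\mathcal{C}_N(\Omega)$ is the set of those with positive diameter and $\mathcal{C}_P(\Omega)$ the set of those with zero diameter. $\Omega$ is countably connected if $\mathcal{C}(\Omega)$ is countable. $\hat\Omega$ is the quotient space of $\mathbb{S}^2$ obtained by collapsing each $p\in\mathcal{C}(\Omega)$ to a point; $p$ is identified with its image in $\hat\Omega$. Every homeomorphism $f:\Omega\to D$ between domains in $\mathbb{S}^2$ extends to a homeomorphism $\hat f:\hat\Omega\to\hat D$. A domain $D\subset\mathbb{S}^2$ is a circle domain if each $p\in\mathcal{C}_N(D)$ is a (closed, round) disk. *)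

theory Defs
  imports "HOL-Analysis.Analysis"
begin

section \<open>The Riemann sphere with the spherical metric\<close>

datatype riemann_sphere = Fin complex | Infty

text \<open>Inverse stereographic projection onto the unit sphere of \<open>\<complex> \<times> \<real>\<close>, with
  \<open>\<infinity>\<close> sent to the north pole.\<close>

fun stereo :: "riemann_sphere \<Rightarrow> complex \<times> real" where
  "stereo (Fin z) = ((2 / (1 + (cmod z)\<^sup>2)) *\<^sub>R z, ((cmod z)\<^sup>2 - 1) / (1 + (cmod z)\<^sup>2))"
| "stereo Infty = (0, 1)"

lemma inner_stereo_self [simp]: "stereo p \<bullet> stereo p = 1"
proof (cases p)
  case (Fin z)
  define r where "r = (cmod z)\<^sup>2"
  have r: "1 + r > 0" "r \<ge> 0" unfolding r_def by (simp_all add: add_pos_nonneg)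
  have "stereo p \<bullet> stereo p = (2 / (1 + r))\<^sup>2 * r + ((r - 1) / (1 + r))\<^sup>2"
    unfolding Fin stereo.simps inner_Pair r_def
    by (simp add: dot_square_norm power2_eq_square mult.assoc)
  also have "\<dots> = 1"
    using r by (simp add: power_divide divide_simps) (simp add: power2_eq_square algebra_simps)
  finally show ?thesis .
qed simp

lemma norm_stereo [simp]: "norm (stereo p) = 1"
  by (simp add: norm_eq_sqrt_inner)

lemma inj_stereo: "inj stereo"
proof (rule injI)
  have height: "((cmod z)\<^sup>2 - 1) / (1 + (cmod z)\<^sup>2) = 1 - 2 / (1 + (cmod z)\<^sup>2)" for z
  proof -
    have "1 + (cmod z)\<^sup>2 > 0" by (simp add: add_pos_nonneg)
    then show ?thesis by (simp add: field_simps)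
  qed
  have pos: "2 / (1 + (cmod z)\<^sup>2) > 0" for z
    by (simp add: add_pos_nonneg)
  fix p q assume eq: "stereo p = stereo q"
  show "p = q"
  proof (cases p; cases q)
    fix z w assume p: "p = Fin z" and q: "q = Fin w"
    have "2 / (1 + (cmod z)\<^sup>2) = 2 / (1 + (cmod w)\<^sup>2)"
      using eq unfolding p q stereo.simps height by simp
    moreover have "(2 / (1 + (cmod z)\<^sup>2)) *\<^sub>R z = (2 / (1 + (cmod w)\<^sup>2)) *\<^sub>R w"
      using eq unfolding p q by simp
    ultimately have "z = w" using pos[of w] by (metis scaleR_cancel_left less_irrefl)
    then show ?thesis using p q by simp
  next
    fix z assume p: "p = Fin z" and q: "q = Infty"
    show ?thesis using eq pos[of z] unfolding p q stereo.simps height by simp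
  next
    fix w assume p: "p = Infty" and q: "q = Fin w"
    show ?thesis using eq pos[of w] unfolding p q stereo.simps height by simp
  qed simp
qed

lemma abs_inner_stereo: "\<bar>stereo p \<bullet> stereo q\<bar> \<le> 1"
  using Cauchy_Schwarz_ineq2[of "stereo p" "stereo q"] by simp

lemma arccos_inner_triangle:
  fixes u v w :: "'a :: real_inner"
  assumes n: "norm u = 1" "norm v = 1" "norm w = 1"
  shows "arccos (u \<bullet> w) \<le> arccos (u \<bullet> v) + arccos (v \<bullet> w)"
proof (cases "arccos (u \<bullet> v) + arccos (v \<bullet> w) \<le> pi")
  case True
  have nn: "u \<bullet> u = 1" "v \<bullet> v = 1" "w \<bullet> w = 1"
    using n by (simp_all add: dot_square_norm)
  have b: "\<bar>u \<bullet> v\<bar> \<le> 1" "\<bar>v \<bullet> w\<bar> \<le> 1" "\<bar>u \<bullet> w\<bar> \<le> 1"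
    using Cauchy_Schwarz_ineq2[of u v] Cauchy_Schwarz_ineq2[of v w]
      Cauchy_Schwarz_ineq2[of u w] n by simp_all
  define a where "a = u - (u \<bullet> v) *\<^sub>R v"
  define c where "c = w - (v \<bullet> w) *\<^sub>R v"
  have na: "norm a = sqrt (1 - (u \<bullet> v)\<^sup>2)"
    unfolding a_def norm_eq_sqrt_inner using nn
    by (simp add: inner_diff_left inner_diff_right inner_commute power2_eq_square)
  have nc: "norm c = sqrt (1 - (v \<bullet> w)\<^sup>2)"
    unfolding c_def norm_eq_sqrt_inner using nn
    by (simp add: inner_diff_left inner_diff_right inner_commute power2_eq_square)
  have ac: "a \<bullet> c = u \<bullet> w - (u \<bullet> v) * (v \<bullet> w)"
    unfolding a_def c_def using nn
    by (simp add: inner_diff_left inner_diff_right inner_commute)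
  have "cos (arccos (u \<bullet> v) + arccos (v \<bullet> w)) = (u \<bullet> v) * (v \<bullet> w) - norm a * norm c"
    using b by (simp add: cos_add sin_arccos_abs na nc cos_arccos_abs)
  also have "\<dots> \<le> u \<bullet> w"
    using Cauchy_Schwarz_ineq2[of a c] ac by linarith
  finally have "arccos (u \<bullet> w) \<le> arccos (cos (arccos (u \<bullet> v) + arccos (v \<bullet> w)))"
    using b by (intro arccos_le_arccos) (auto simp: abs_le_iff)
  also have "\<dots> = arccos (u \<bullet> v) + arccos (v \<bullet> w)"
    using True b by (intro arccos_cos add_nonneg_nonneg arccos_lbound) (auto simp: abs_le_iff)
  finally show ?thesis .
next
  case False
  have "\<bar>u \<bullet> w\<bar> \<le> 1" using Cauchy_Schwarz_ineq2[of u w] n by simp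
  then have "arccos (u \<bullet> w) \<le> pi" by (intro arccos_ubound) (auto simp: abs_le_iff)
  with False show ?thesis by linarith
qed

text \<open>The distance is the great-circle distance on the unit sphere, i.e. the length metric
  of the density \<open>2 |dz| / (1 + |z|\<^sup>2)\<close>.\<close>

instantiation riemann_sphere :: metric_space
begin

definition dist_riemann_sphere :: "riemann_sphere \<Rightarrow> riemann_sphere \<Rightarrow> real" where
  "dist_riemann_sphere p q = arccos (stereo p \<bullet> stereo q)"

definition uniformity_riemann_sphere :: "(riemann_sphere \<times> riemann_sphere) filter" where
  "uniformity_riemann_sphere = (INF e\<in>{0<..}. principal {(x, y). dist x y < e})"

definition open_riemann_sphere :: "riemann_sphere set \<Rightarrow> bool" where
  "open_riemann_sphere U \<longleftrightarrow>
     (\<forall>x\<in>U. \<forall>\<^sub>F (x', y) in uniformity. x' = x \<longrightarrow> y \<in> U)"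

instance
proof
  fix x y z :: riemann_sphere
  show "dist x y = 0 \<longleftrightarrow> x = y"
  proof
    assume "dist x y = 0"
    then have "stereo x \<bullet> stereo y = 1"
      unfolding dist_riemann_sphere_def
      using cos_arccos_abs[OF abs_inner_stereo[of x y]] by simp
    then have "(norm (stereo x - stereo y))\<^sup>2 = 0"
      unfolding power2_norm_eq_inner
      by (simp add: inner_diff_left inner_diff_right inner_commute)
    then show "x = y" using inj_stereo by (simp add: inj_eq)
  qed (simp add: dist_riemann_sphere_def)
  show "dist x y \<le> dist x z + dist y z"
    unfolding dist_riemann_sphere_def
    using arccos_inner_triangle[of "stereo x" "stereo z" "stereo y"]
    by (simp add: inner_commute)
qed (simp_all add: uniformity_riemann_sphere_def open_riemann_sphere_def)

end


section \<open>Domains, complementary components, circle domains\<close>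

definition sphere_domain :: "riemann_sphere set \<Rightarrow> bool" where
  "sphere_domain \<Omega> \<longleftrightarrow> open \<Omega> \<and> connected \<Omega> \<and> \<Omega> \<noteq> {}"

definition comps :: "riemann_sphere set \<Rightarrow> riemann_sphere set set" where
  "comps \<Omega> = components (- \<Omega>)"

definition comps_N :: "riemann_sphere set \<Rightarrow> riemann_sphere set set" where
  "comps_N \<Omega> = {p \<in> comps \<Omega>. diameter p > 0}"

definition comps_P :: "riemann_sphere set \<Rightarrow> riemann_sphere set set" where
  "comps_P \<Omega> = {p \<in> comps \<Omega>. diameter p = 0}"

definition countably_connected :: "riemann_sphere set \<Rightarrow> bool" where
  "countably_connected \<Omega> \<longleftrightarrow> countable (comps \<Omega>)"

text \<open>Closed round disks of the sphere are the closed balls of the spherical metric;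
  in planar terms: closed disks, closed half-planes with \<open>\<infinity>\<close>, and complements of open disks.\<close>

definition closed_disk :: "riemann_sphere set \<Rightarrow> bool" where
  "closed_disk p \<longleftrightarrow> (\<exists>c r. 0 < r \<and> r < pi \<and> p = cball c r)"

definition circle_domain :: "riemann_sphere set \<Rightarrow> bool" where
  "circle_domain D \<longleftrightarrow> sphere_domain D \<and> (\<forall>p\<in>comps_N D. closed_disk p)"


section \<open>Conformal homeomorphisms\<close>

text \<open>The inverses of the two standard charts \<open>z\<close> and \<open>1/z\<close> of the sphere.\<close>

definition at_infty :: "complex \<Rightarrow> riemann_sphere" where
  "at_infty w = (if w = 0 then Infty else Fin (inverse w))"

definition sphere_holomorphic_on ::
    "(riemann_sphere \<Rightarrow> riemann_sphere) \<Rightarrow> riemann_sphere set \<Rightarrow> bool" where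
  "sphere_holomorphic_on f \<Omega> \<longleftrightarrow> continuous_on \<Omega> f \<and>
     (\<forall>\<phi>\<in>{Fin, at_infty}. \<forall>\<psi>\<in>{Fin, at_infty}.
        (inv \<psi> \<circ> f \<circ> \<phi>) holomorphic_on {z. \<phi> z \<in> \<Omega> \<and> f (\<phi> z) \<in> range \<psi>})"

definition conformal_homeomorphism ::
    "riemann_sphere set \<Rightarrow> riemann_sphere set \<Rightarrow> (riemann_sphere \<Rightarrow> riemann_sphere) \<Rightarrow> bool" where
  "conformal_homeomorphism \<Omega> D f \<longleftrightarrow>
     (\<exists>g. homeomorphism \<Omega> D f g \<and> sphere_holomorphic_on f \<Omega> \<and> sphere_holomorphic_on g D)"


section \<open>The quotient collapsing complementary components\<close>

text \<open>Points of the quotient are the fibres of the projection: the singletons \<open>{x}\<close> with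
  \<open>x \<in> \<Omega>\<close> and the members of \<open>comps \<Omega>\<close>.\<close>

definition collapse :: "riemann_sphere set \<Rightarrow> riemann_sphere \<Rightarrow> riemann_sphere set" where
  "collapse \<Omega> x = (if x \<in> \<Omega> then {x} else connected_component_set (- \<Omega>) x)"

definition hat_space :: "riemann_sphere set \<Rightarrow> riemann_sphere set topology" where
  "hat_space \<Omega> = topology (\<lambda>U. U \<subseteq> range (collapse \<Omega>) \<and> open (collapse \<Omega> -` U))"

lemma openin_hat_space:
  "openin (hat_space \<Omega>) U \<longleftrightarrow> U \<subseteq> range (collapse \<Omega>) \<and> open (collapse \<Omega> -` U)"
proof -
  have "istopology (\<lambda>U. U \<subseteq> range (collapse \<Omega>) \<and> open (collapse \<Omega> -` U))"
    unfolding istopology_def by (auto simp: vimage_Union)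
  then show ?thesis by (simp add: hat_space_def)
qed

lemma range_collapse: "range (collapse \<Omega>) = (\<lambda>x. {x}) ` \<Omega> \<union> comps \<Omega>"
  by (auto simp: collapse_def comps_def components_def)

lemma topspace_hat_space: "topspace (hat_space \<Omega>) = (\<lambda>x. {x}) ` \<Omega> \<union> comps \<Omega>"
proof -
  have "openin (hat_space \<Omega>) (range (collapse \<Omega>))"
    unfolding openin_hat_space by (simp add: vimage_def)
  then have "topspace (hat_space \<Omega>) = range (collapse \<Omega>)"
    by (meson openin_hat_space openin_subset openin_topspace subset_antisym)
  then show ?thesis by (simp add: range_collapse)
qed

lemma quotient_map_collapse: "quotient_map euclidean (hat_space \<Omega>) (collapse \<Omega>)"
  unfolding quotient_map_def topspace_hat_space
  by (auto simp: openin_hat_space range_collapse vimage_def simp flip: range_collapse)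

definition hat_extension ::
    "riemann_sphere set \<Rightarrow> riemann_sphere set \<Rightarrow> (riemann_sphere \<Rightarrow> riemann_sphere) \<Rightarrow>
     (riemann_sphere set \<Rightarrow> riemann_sphere set) \<Rightarrow> bool" where
  "hat_extension \<Omega> D f F \<longleftrightarrow>
     homeomorphic_map (hat_space \<Omega>) (hat_space D) F \<and> (\<forall>x\<in>\<Omega>. F {x} = {f x})"

text \<open>For a homeomorphism \<open>f\<close> between domains the extension exists, and it is unique on the
  quotient space since the image of \<open>\<Omega>\<close> is dense there and the target is Hausdorff.\<close>

definition hat_map ::
    "riemann_sphere set \<Rightarrow> riemann_sphere set \<Rightarrow> (riemann_sphere \<Rightarrow> riemann_sphere) \<Rightarrow>
     riemann_sphere set \<Rightarrow> riemann_sphere set" where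
  "hat_map \<Omega> D f = (SOME F. hat_extension \<Omega> D f F)"

end

theory Submission
  imports Defs "HOL-Complex_Analysis.Complex_Analysis"
begin

text \<open>
  The complement of the domain is a point together with a binary tree of plates that accumulate
  only at that point. In the coordinate \<open>1/z\<close> the point is infinity and the \<open>2^n\<close> plates of
  level \<open>n\<close> are parallel rectangles in a half-strip, moving off to infinity. Each plate faces two
  plates of the next level across open rectangles whose shape does not depend on the level, the
  bridges. Only the horizontal positions control the diameters of the plates in the original
  coordinate, so these diameters can be made to decay as fast as one likes.

  Suppose that a conformal map onto a circle domain sends the point component to a point \<open>q\<close>, and
  normalise \<open>q = 0\<close>. Every plate becomes a disk (or a point) and every bridge a conformal
  rectangle, all disjoint. Fix a level \<open>N\<close> and a scale \<open>s\<close> so small that no disk of level \<open>N\<close> meets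
  the disk of radius \<open>s\<close> about \<open>0\<close>. The function \<open>u(z) = max 0 (1 - |z| / s)\<close> vanishes on level \<open>N\<close>,
  while deep in the tree it is close to \<open>1\<close>, because the disks converge to \<open>0\<close>. Hence the average of
  \<open>u\<close> over a level grows by almost \<open>1\<close> on the way down. A disk and a rectangle of bounded shape are
  both fat: the oscillation of \<open>u\<close> on a disk, and the rise of \<open>u\<close> along a suitable segment of a
  bridge, are at most a constant times \<open>sqrt a / s\<close>, where \<open>a\<close> is the area that the set occupies in
  the disk of radius \<open>2 s\<close>. A set of level \<open>n\<close> has weight \<open>2^-n\<close> in the average, so by the inequality
  of Cauchy and Schwarz the total growth is at most a constant times the square root of
  \<open>(\<Sum>n>N. 2^n * 4^-n) * (4 pi s^2 / s^2)\<close>. This is small for large \<open>N\<close>, independently of \<open>s\<close>, a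
  contradiction (\<open>no_tree_collapse\<close>). In other words, the transboundary modulus of the curves that
  descend the tree is positive, whereas the curves ending at a point component of a circle domain
  have modulus zero.

  Two further ingredients link this planar estimate to the statement. The area formula for
  injective holomorphic maps gives the estimate on bridges (\<open>length_area_rectangle\<close>). And a
  homeomorphism between domains of the sphere extends to the collapsed spheres
  (\<open>hat_extension_exists\<close>): every complementary component has small neighbourhoods that meet the
  domain in a connected set, which is Janiszewski's theorem, so the images of these neighbourhoods
  cluster at a single complementary component of the target.
\<close>

section \<open>Area of conformal images\<close>

lemma lborel_distr_basis_isomorphism:
  fixes T :: "'a::euclidean_space \<Rightarrow> 'b::euclidean_space"
  assumes lin: "linear T" and bij: "bij_betw T Basis Basis"
  shows "distr lborel borel T = lborel"
proof (rule lborel_eqI[symmetric])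
  have meas [measurable]: "T \<in> borel_measurable borel"
    by (intro borel_measurable_continuous_onI linear_continuous_on) (use lin linear_conv_bounded_linear in blast)
  show "sets (distr lborel borel T) = sets borel" by simp
  fix l u :: 'b
  assume lu: "\<And>b. b \<in> Basis \<Longrightarrow> l \<bullet> b \<le> u \<bullet> b"
  have TB: "T b \<in> Basis" if "b \<in> Basis" for b using bij that by (auto simp: bij_betw_def)
  have TBi: "T b = T c \<longleftrightarrow> b = c" if "b \<in> Basis" "c \<in> Basis" for b c
    using bij that by (auto simp: bij_betw_def inj_on_def)
  have inn: "T x \<bullet> T b = x \<bullet> b" if b: "b \<in> Basis" for x b
  proof -
    have "T x = T (\<Sum>c\<in>Basis. (x \<bullet> c) *\<^sub>R c)" by (simp add: euclidean_representation)
    also have "\<dots> = (\<Sum>c\<in>Basis. (x \<bullet> c) *\<^sub>R T c)" using lin by (simp add: linear_sum linear_cmul)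
    finally have "T x \<bullet> T b = (\<Sum>c\<in>Basis. (x \<bullet> c) * (T c \<bullet> T b))" by (simp add: inner_sum_left)
    also have "\<dots> = (\<Sum>c\<in>Basis. if c = b then x \<bullet> c else 0)"
      by (intro sum.cong refl) (use b TB TBi in \<open>auto simp: inner_Basis\<close>)
    finally show ?thesis using b by simp
  qed
  define l' u' where "l' = (\<Sum>b\<in>Basis. (l \<bullet> T b) *\<^sub>R b)" and "u' = (\<Sum>b\<in>Basis. (u \<bullet> T b) *\<^sub>R b)"
  have "T -` box l u = box l' u'"
  proof -
    have "T x \<in> box l u \<longleftrightarrow> x \<in> box l' u'" for x
    proof -
      have "T x \<in> box l u \<longleftrightarrow> (\<forall>b\<in>T ` Basis. l \<bullet> b < T x \<bullet> b \<and> T x \<bullet> b < u \<bullet> b)"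
        using bij by (simp add: mem_box bij_betw_def)
      also have "\<dots> \<longleftrightarrow> x \<in> box l' u'" by (simp add: mem_box inn l'_def u'_def)
      finally show ?thesis .
    qed
    then show ?thesis by auto
  qed
  then have "emeasure (distr lborel borel T) (box l u) = emeasure lborel (box l' u')"
    by (simp add: emeasure_distr)
  also have "\<dots> = (\<Prod>b\<in>Basis. (u' - l') \<bullet> b)"
    using lu TB by (subst emeasure_lborel_box) (auto simp: l'_def u'_def)
  also have "(\<Prod>b\<in>Basis. (u' - l') \<bullet> b) = (\<Prod>b\<in>Basis. (u - l) \<bullet> T b)"
    by (intro prod.cong) (auto simp: l'_def u'_def inner_diff_left)
  also have "\<dots> = (\<Prod>b\<in>Basis. (u - l) \<bullet> b)"
    using prod.reindex_bij_betw[OF bij, of "\<lambda>b. (u - l) \<bullet> b"] by simp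
  finally show "emeasure (distr lborel borel T) (box l u) = (\<Prod>b\<in>Basis. (u - l) \<bullet> b)" .
qed

text \<open>The change of variables formula lives on \<open>real^'n\<close>; this isometry moves it to the complex
  plane.\<close>

definition vec2_complex :: "real^2 \<Rightarrow> complex" where "vec2_complex v = Complex (v $ 1) (v $ 2)"
definition complex_vec2 :: "complex \<Rightarrow> real^2" where "complex_vec2 z = vector [Re z, Im z]"

lemma vec2_complex_inverse [simp]: "complex_vec2 (vec2_complex v) = v"
  by (simp add: vec2_complex_def complex_vec2_def vec_eq_iff forall_2)
lemma complex_vec2_inverse [simp]: "vec2_complex (complex_vec2 z) = z"
  by (simp add: vec2_complex_def complex_vec2_def)
lemma linear_vec2_complex: "linear vec2_complex"
  by (rule linearI) (auto simp: vec2_complex_def complex_eq_iff)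
lemma linear_complex_vec2: "linear complex_vec2"
  by (rule linearI) (auto simp: complex_vec2_def vec_eq_iff forall_2)

lemma Basis_vec2: "(Basis :: (real^2) set) = {axis 1 1, axis 2 1}"
  by (auto simp: Basis_vec_def UNIV_2)

lemma lborel_vec2_complex: "distr lborel borel vec2_complex = lborel"
proof (rule lborel_distr_basis_isomorphism[OF linear_vec2_complex])
  have "vec2_complex (axis 1 1) = 1" "vec2_complex (axis 2 1) = \<i>"
    by (auto simp: vec2_complex_def axis_def complex_eq_iff)
  then show "bij_betw vec2_complex Basis Basis"
    by (auto simp: bij_betw_def Basis_vec2 Basis_complex_def inj_on_def complex_eq_iff)
qed

lemma lborel_Complex: "distr (lborel \<Otimes>\<^sub>M lborel) borel (\<lambda>(x,y). Complex x y) = lborel"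
proof -
  have "distr lborel borel (\<lambda>(x,y). Complex x y) = lborel"
  proof (rule lborel_distr_basis_isomorphism)
    show "linear (\<lambda>(x,y). Complex x y)" by (rule linearI) (auto simp: complex_eq_iff)
    show "bij_betw (\<lambda>(x,y). Complex x y) Basis Basis"
      by (auto simp: bij_betw_def Basis_prod_def Basis_complex_def inj_on_def complex_eq_iff image_Un)
  qed
  then show ?thesis by (simp add: lborel_prod)
qed

lemma borel_measurable_ennreal_indicator:
  fixes f :: "complex \<Rightarrow> real"
  assumes "open G" "continuous_on G f"
  shows "(\<lambda>z. ennreal (f z) * indicator G z) \<in> borel_measurable borel"
proof -
  have "(\<lambda>z. indicator G z *\<^sub>R f z) \<in> borel_measurable borel"
    using assms by (intro borel_measurable_continuous_on_indicator) auto
  then have "(\<lambda>z. ennreal (indicator G z *\<^sub>R f z)) \<in> borel_measurable borel" by measurable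
  also have "(\<lambda>z. ennreal (indicator G z *\<^sub>R f z)) = (\<lambda>z. ennreal (f z) * indicator G z)"
    by (auto simp: indicator_def)
  finally show ?thesis .
qed

text \<open>By the Cauchy--Riemann equations the Jacobian determinant of \<open>f\<close> is \<open>|f'|\<^sup>2\<close>.\<close>

lemma area_formula:
  fixes f :: "complex \<Rightarrow> complex"
  assumes G: "open G" and hol: "f holomorphic_on G" and inj: "inj_on f G" and bd: "bounded (f ` G)"
  shows "(\<integral>\<^sup>+z. ennreal ((cmod (deriv f z))\<^sup>2) * indicator G z \<partial>lborel) = emeasure lborel (f ` G)"
proof -
  define S where "S = vec2_complex -` G"
  define g where "g = complex_vec2 \<circ> f \<circ> vec2_complex"
  define g' where "g' = (\<lambda>x h. complex_vec2 (deriv f (vec2_complex x) * vec2_complex h))"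
  have cont: "continuous_on A vec2_complex" "continuous_on B complex_vec2" for A B
    using linear_vec2_complex linear_complex_vec2 linear_continuous_on linear_conv_bounded_linear by blast+
  have opS: "open S" unfolding S_def using G cont(1)[of UNIV] by (simp add: open_vimage)
  have fG: "open (f ` G)" using open_mapping_thm3[OF hol G inj] .
  have gS: "g ` S = vec2_complex -` (f ` G)"
  proof -
    have "vec2_complex ` S = G" unfolding S_def by (metis complex_vec2_inverse surjI surj_image_vimage_eq)
    then have "g ` S = complex_vec2 ` f ` G" by (metis g_def image_comp)
    also have "\<dots> = vec2_complex -` (f ` G)"
      by (auto simp: image_iff) (metis vec2_complex_inverse)
    finally show ?thesis .
  qed
  have opgS: "open (g ` S)" unfolding gS using fG cont(1)[of UNIV] by (simp add: open_vimage)
  have bdgS: "bounded (g ` S)"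
  proof -
    have "g ` S = complex_vec2 ` f ` G" unfolding gS by (auto simp: image_iff) (metis vec2_complex_inverse)
    then show ?thesis using bounded_linear_image[OF bd] linear_complex_vec2 linear_conv_bounded_linear by metis
  qed
  have der: "(g has_derivative g' x) (at x within S)" if "x \<in> S" for x
  proof -
    have 1: "(f has_derivative (*) (deriv f (vec2_complex x))) (at (vec2_complex x))"
      using that holomorphic_derivI[OF hol G, of "vec2_complex x"] by (simp add: S_def has_field_derivative_def)
    have "(vec2_complex has_derivative vec2_complex) (at x)" 
      by (simp add: linear_imp_has_derivative linear_vec2_complex)
    from diff_chain_at[OF this 1] have 2: "(f \<circ> vec2_complex has_derivative (*) (deriv f (vec2_complex x)) \<circ> vec2_complex) (at x)" .
    have "(complex_vec2 has_derivative complex_vec2) (at (f (vec2_complex x)))"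
      by (simp add: linear_imp_has_derivative linear_complex_vec2)
    with diff_chain_at[OF 2, of complex_vec2 complex_vec2]
    have "(g has_derivative g' x) (at x)"
      by (simp add: g_def g'_def o_def)
    then show ?thesis by (rule has_derivative_at_withinI)
  qed
  have det: "\<bar>det (matrix (g' x))\<bar> = (cmod (deriv f (vec2_complex x)))\<^sup>2" for x
  proof -
    define d where "d = deriv f (vec2_complex x)"
    have "det (matrix (g' x)) = Re d * Re d + Im d * Im d"
      unfolding det_2 matrix_def g'_def d_def[symmetric]
      by (simp add: complex_vec2_def vec2_complex_def axis_def)
    also have "\<dots> = (cmod d)\<^sup>2" using cmod_power2[of d] by (simp add: power2_eq_square)
    finally show ?thesis by (simp add: d_def)
  qed
  have injg: "inj_on g S"
    using inj unfolding g_def S_def inj_on_def by (auto) (metis complex_vec2_inverse vec2_complex_inverse)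
  have lm: "g ` S \<in> lmeasurable" using opgS bdgS by (rule lmeasurable_open[rotated])
  have SL: "S \<in> sets lebesgue" using opS by simp
  note E = measurable_differentiable_image_eq[OF SL der injg] measure_differentiable_image_eq[OF SL der injg]
  have int: "(\<lambda>x. \<bar>det (matrix (g' x))\<bar>) integrable_on S" using E(1) lm by blast
  have hi: "((\<lambda>x. (cmod (deriv f (vec2_complex x)))\<^sup>2) has_integral measure lebesgue (g ` S)) S"
    using integrable_integral[OF int] E(2)[OF _ int] by (simp add: det)
  have "(\<integral>\<^sup>+x. ennreal (indicator S x * (cmod (deriv f (vec2_complex x)))\<^sup>2) \<partial>lborel) = ennreal (measure lebesgue (g ` S))"
    by (rule nn_integral_has_integral_lebesgue[OF _ hi]) simp
  also have "measure lebesgue (g ` S) = measure lborel (g ` S)" using opgS by simp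
  also have "ennreal (measure lborel (g ` S)) = emeasure lborel (g ` S)"
    using bdgS emeasure_bounded_finite[of "g ` S"] by (simp add: emeasure_eq_ennreal_measure less_top)
  also have "\<dots> = emeasure (distr lborel borel vec2_complex) (f ` G)"
    unfolding gS using fG cont(1)[of UNIV]
    by (subst emeasure_distr) (auto intro!: borel_measurable_continuous_onI)
  also have "\<dots> = emeasure lborel (f ` G)" by (simp only: lborel_vec2_complex)
  finally have fin: "(\<integral>\<^sup>+x. ennreal (indicator S x * (cmod (deriv f (vec2_complex x)))\<^sup>2) \<partial>lborel) = emeasure lborel (f ` G)" .
  have "deriv f holomorphic_on G" by (rule holomorphic_deriv[OF hol G])
  then have "continuous_on G (\<lambda>z. (cmod (deriv f z))\<^sup>2)"
    by (intro continuous_intros holomorphic_on_imp_continuous_on)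
  then have meas: "(\<lambda>z. ennreal ((cmod (deriv f z))\<^sup>2) * indicator G z) \<in> borel_measurable borel"
    by (rule borel_measurable_ennreal_indicator[OF G])
  have "(\<integral>\<^sup>+z. ennreal ((cmod (deriv f z))\<^sup>2) * indicator G z \<partial>lborel)
     = (\<integral>\<^sup>+z. ennreal ((cmod (deriv f z))\<^sup>2) * indicator G z \<partial>(distr lborel borel vec2_complex))"
    by (simp only: lborel_vec2_complex)
  also have "\<dots> = (\<integral>\<^sup>+x. ennreal ((cmod (deriv f (vec2_complex x)))\<^sup>2) * indicator G (vec2_complex x) \<partial>lborel)"
    using meas cont(1)[of UNIV] by (subst nn_integral_distr) (auto intro!: borel_measurable_continuous_onI)
  also have "\<dots> = emeasure lborel (f ` G)"
    unfolding fin[symmetric] S_def by (intro nn_integral_cong) (auto simp: indicator_def)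
  finally show ?thesis .
qed

section \<open>The length-area inequality on rectangles\<close>

text \<open>The test function that measures progress towards \<open>0\<close>: it is Lipschitz with constant \<open>1/s\<close>, and
  constant outside the disk of radius \<open>s\<close>, so that only area inside that disk is charged.\<close>

definition tent :: "real \<Rightarrow> complex \<Rightarrow> real" where
  "tent s z = max 0 (1 - cmod z / s)"

lemma tent_nonneg: "0 \<le> tent s z"
  unfolding tent_def by (rule max.cobounded1)

lemma tent_le_1: "s > 0 \<Longrightarrow> tent s z \<le> 1"
  unfolding tent_def by (intro max.boundedI) auto

lemma tent_diff_le:
  assumes "s > 0" shows "tent s a - tent s b \<le> dist a b / s"
proof -
  have "cmod b \<le> cmod a + dist a b"
    using norm_triangle_ineq2[of b a] by (simp add: dist_norm norm_minus_commute)
  then have "cmod b / s \<le> (cmod a + dist a b) / s"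
    using assms by (intro divide_right_mono) auto
  then have "cmod b / s \<le> cmod a / s + dist a b / s" by (simp only: add_divide_distrib)
  moreover have "0 \<le> dist a b / s" using assms by simp
  ultimately show ?thesis unfolding tent_def by linarith
qed

lemma tent_pos_iff: "s > 0 \<Longrightarrow> 0 < tent s z \<longleftrightarrow> cmod z < s"
  by (simp add: tent_def less_max_iff_disj)

lemma tent_eq_0: "s > 0 \<Longrightarrow> s \<le> cmod z \<Longrightarrow> tent s z = 0"
  using tent_pos_iff[of s z] tent_nonneg[of s z] by linarith

lemma fmeasurable_lborel_bounded:
  assumes "A \<in> sets borel" "bounded (A :: 'a::euclidean_space set)"
  shows "A \<in> fmeasurable lborel"
  using assms emeasure_bounded_finite[of A] by (intro fmeasurableI) auto

lemma measure_cball_complex: "0 \<le> r \<Longrightarrow> measure lborel (cball (c::complex) r) = pi * r\<^sup>2"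
  using content_cball[of r c] by (simp add: unit_ball_vol_2)

text \<open>Disks are fat. If \<open>u\<close> oscillates by \<open>t > 0\<close> on the disk, then the disk has radius at least \<open>t s / 2\<close>
  and reaches into the disk of radius \<open>s\<close>; a subdisk of radius \<open>t s / 2 \<le> s / 2\<close> around such a point
  stays within radius \<open>2 s\<close>.\<close>

lemma tent_osc_cball_aux:
  assumes s: "s > 0" and ab: "a \<in> cball c r" "b \<in> cball c r" and le: "tent s a \<le> tent s b"
  shows "pi * ((tent s b - tent s a) * s)\<^sup>2 / 4 \<le> measure lborel (cball c r \<inter> ball 0 (2 * s))"
proof -
  define t where "t = tent s b - tent s a"
  define \<rho> where "\<rho> = t * s / 2"
  have "pi * (t * s)\<^sup>2 / 4 \<le> measure lborel (cball c r \<inter> ball 0 (2 * s))"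
  proof (cases "t = 0")
    case False
    with le have t: "t > 0" by (simp add: t_def)
    then have "tent s b > 0" using tent_nonneg[of s a] by (simp add: t_def)
    then have b: "cmod b < s" using tent_pos_iff[OF s] by blast
    have "t \<le> 1" using tent_nonneg[of s a] tent_le_1[OF s, of b] by (simp add: t_def)
    then have \<rho>1: "0 < \<rho>" "\<rho> \<le> s / 2" using s t by (simp_all add: \<rho>_def)
    have "t \<le> dist b a / s" unfolding t_def by (rule tent_diff_le[OF s])
    moreover have "dist b a \<le> 2 * r" using ab dist_triangle[of b a c] by (simp add: dist_commute)
    ultimately have "t * s \<le> 2 * r" using s by (simp add: field_simps)
    then have \<rho>2: "\<rho> \<le> r" "r > 0" using \<rho>1 by (simp_all add: \<rho>_def)
    define d where "d = b + (\<rho> / r) *\<^sub>R (c - b)"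
    have bc: "cmod (c - b) \<le> r" using ab by (simp add: dist_norm)
    have "d - b = (\<rho> / r) *\<^sub>R (c - b)" by (simp add: d_def)
    then have "cmod (d - b) = \<rho> / r * cmod (c - b)" using \<rho>1 \<rho>2 by simp
    also have "\<dots> \<le> \<rho> / r * r" using \<rho>1 \<rho>2 bc by (intro mult_left_mono) auto
    finally have db: "cmod (d - b) \<le> \<rho>" using \<rho>2 by simp
    have "c - d = (1 - \<rho> / r) *\<^sub>R (c - b)" by (simp add: d_def algebra_simps)
    then have "cmod (c - d) = (1 - \<rho> / r) * cmod (c - b)" using \<rho>1 \<rho>2 by simp
    also have "\<dots> \<le> (1 - \<rho> / r) * r" using \<rho>1 \<rho>2 bc by (intro mult_left_mono) auto
    also have "(1 - \<rho> / r) * r = r - \<rho>" using \<rho>2 by (simp add: algebra_simps)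
    finally have cd: "cmod (c - d) \<le> r - \<rho>" .
    have "cball d \<rho> \<subseteq> cball c r \<inter> ball 0 (2 * s)"
    proof
      fix z assume "z \<in> cball d \<rho>"
      then have z: "cmod (d - z) \<le> \<rho>" by (simp add: dist_norm)
      have "cmod (c - z) \<le> r" using cd z norm_triangle_ineq[of "c - d" "d - z"] by simp
      moreover have "cmod z < 2 * s"
        using z db b \<rho>1 norm_triangle_ineq[of "z - d" d] norm_triangle_ineq[of "d - b" b]
        by (simp add: norm_minus_commute)
      ultimately show "z \<in> cball c r \<inter> ball 0 (2 * s)" by (simp add: dist_norm)
    qed
    then have "measure lborel (cball d \<rho>) \<le> measure lborel (cball c r \<inter> ball 0 (2 * s))"
      by (intro measure_mono_fmeasurable fmeasurable_lborel_bounded) (auto intro: bounded_Int)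
    then show ?thesis using \<rho>1 by (simp add: measure_cball_complex \<rho>_def power_divide)
  qed simp
  then show ?thesis by (simp add: t_def)
qed

lemma tent_osc_cball:
  assumes s: "s > 0" and ab: "a \<in> cball c r" "b \<in> cball c r"
  shows "pi * ((tent s a - tent s b) * s)\<^sup>2 / 4 \<le> measure lborel (cball c r \<inter> ball 0 (2 * s))"
proof (cases "tent s a \<le> tent s b")
  case True
  have "((tent s a - tent s b) * s)\<^sup>2 = ((tent s b - tent s a) * s)\<^sup>2"
    by (simp add: power_mult_distrib power2_commute)
  then show ?thesis using tent_osc_cball_aux[OF s ab True] by simp
next
  case False
  then show ?thesis using tent_osc_cball_aux[OF s ab(2) ab(1)] by simp
qed

text \<open>Only the part of the curve inside the disk of radius \<open>s\<close> is charged: follow the curve from the last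
  time at which it is outside, where the function vanishes.\<close>

lemma tent_along_path:
  fixes \<gamma> \<gamma>' :: "real \<Rightarrow> complex"
  assumes s: "s > 0" and ab: "a \<le> b"
    and der: "\<And>x. x \<in> {a..b} \<Longrightarrow> (\<gamma> has_vector_derivative \<gamma>' x) (at x within {a..b})"
    and cont: "continuous_on {a..b} \<gamma>'"
  shows "ennreal (tent s (\<gamma> b) - tent s (\<gamma> a))
    \<le> (\<integral>\<^sup>+x. ennreal (cmod (\<gamma>' x) / s) * indicator {x \<in> {a..b}. cmod (\<gamma> x) < s} x \<partial>lborel)"
proof (cases "cmod (\<gamma> b) < s")
  case False
  then have "tent s (\<gamma> b) = 0" using tent_eq_0[OF s] by simp
  then have "tent s (\<gamma> b) - tent s (\<gamma> a) \<le> 0" using tent_nonneg[of s "\<gamma> a"] by simp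
  then show ?thesis by (simp add: ennreal_neg)
next
  case True
  have cg: "continuous_on {a..b} \<gamma>"
    using der by (meson continuous_on_eq_continuous_within has_vector_derivative_continuous)
  define T where "T = {x \<in> {a..b}. s \<le> cmod (\<gamma> x)}"
  have clT: "closed T" unfolding T_def
  proof -
    have "closed {z. s \<le> cmod z}" by (intro closed_Collect_le continuous_intros)
    then have "closed ({a..b} \<inter> \<gamma> -` {z. s \<le> cmod z})"
      by (intro continuous_closed_preimage[OF cg]) auto
    moreover have "{x \<in> {a..b}. s \<le> cmod (\<gamma> x)} = {a..b} \<inter> \<gamma> -` {z. s \<le> cmod z}" by auto
    ultimately show "closed {x \<in> {a..b}. s \<le> cmod (\<gamma> x)}" by simp
  qed
  have "\<exists>t. a \<le> t \<and> t \<le> b \<and> (\<forall>x. t < x \<and> x \<le> b \<longrightarrow> cmod (\<gamma> x) < s) \<and> tent s (\<gamma> t) \<le> tent s (\<gamma> a)"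
  proof (cases "T = {}")
    case True
    then have "cmod (\<gamma> x) < s" if "a < x" "x \<le> b" for x 
    proof -
      have "x \<in> {a..b}" using that by simp
      moreover have "x \<notin> T" using \<open>T = {}\<close> by simp
      ultimately show ?thesis by (simp add: T_def)
    qed
    then show ?thesis using ab by (intro exI[of _ a]) auto
  next
    case False
    have "T \<subseteq> {a..b}" by (auto simp: T_def)
    then have "compact T" using clT by (meson bounded_closed_interval bounded_subset compact_eq_bounded_closed)
    then obtain t where t: "t \<in> T" "\<And>x. x \<in> T \<Longrightarrow> x \<le> t" using compact_attains_sup[OF _ False] by auto
    then have "tent s (\<gamma> t) = 0" using tent_eq_0[OF s] by (simp add: T_def)
    then have "tent s (\<gamma> t) \<le> tent s (\<gamma> a)" using tent_nonneg[of s "\<gamma> a"] by simp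
    moreover have "cmod (\<gamma> x) < s" if "t < x" "x \<le> b" for x
    proof (rule ccontr)
      assume "\<not> cmod (\<gamma> x) < s"
      then have "x \<in> T" using that t(1) by (auto simp: T_def)
      with t(2) that show False by fastforce
    qed
    ultimately show ?thesis using t(1) by (auto simp: T_def)
  qed
  then obtain t where t: "a \<le> t" "t \<le> b" "\<And>x. t < x \<Longrightarrow> x \<le> b \<Longrightarrow> cmod (\<gamma> x) < s"
    "tent s (\<gamma> t) \<le> tent s (\<gamma> a)" by blast
  have sub: "{t..b} \<subseteq> {a..b}" using t by auto
  have FTC: "(\<gamma>' has_integral (\<gamma> b - \<gamma> t)) {t..b}"
    using sub t by (intro fundamental_theorem_of_calculus) (auto intro: has_vector_derivative_within_subset[OF der])
  have c2: "continuous_on {t..b} (\<lambda>x. cmod (\<gamma>' x))"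
    by (intro continuous_intros continuous_on_subset[OF cont sub])
  then have I: "((\<lambda>x. cmod (\<gamma>' x)) has_integral (integral {t..b} (\<lambda>x. cmod (\<gamma>' x)))) {t..b}"
    by (simp add: integrable_continuous_real integrable_integral)
  have "cmod (integral {t..b} \<gamma>') \<le> integral {t..b} (\<lambda>x. cmod (\<gamma>' x))"
    by (intro integral_norm_bound_integral integrable_continuous_real c2 continuous_on_subset[OF cont sub]) auto
  moreover have "integral {t..b} \<gamma>' = \<gamma> b - \<gamma> t" using FTC by (rule integral_unique)
  ultimately have "cmod (\<gamma> b - \<gamma> t) \<le> integral {t..b} (\<lambda>x. cmod (\<gamma>' x))" by simp
  then have "cmod (\<gamma> b - \<gamma> t) / s \<le> integral {t..b} (\<lambda>x. cmod (\<gamma>' x)) / s"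
    using s by (intro divide_right_mono) auto
  then have le: "tent s (\<gamma> b) - tent s (\<gamma> a) \<le> integral {t..b} (\<lambda>x. cmod (\<gamma>' x)) / s"
    using tent_diff_le[OF s, of "\<gamma> b" "\<gamma> t"] t(4) unfolding dist_norm by linarith
  have "((\<lambda>x. cmod (\<gamma>' x) / s) has_integral (integral {t..b} (\<lambda>x. cmod (\<gamma>' x)) / s)) {t<..<b}"
    using has_integral_divide[OF I, of s] has_integral_open_interval[of "\<lambda>x. cmod (\<gamma>' x) / s" _ t b]
    by (simp add: box_real)
  then have I2: "(\<integral>\<^sup>+x. ennreal (cmod (\<gamma>' x) / s) * indicator {t<..<b} x \<partial>lborel) = ennreal (integral {t..b} (\<lambda>x. cmod (\<gamma>' x)) / s)"
    using s by (intro nn_integral_has_integral_lebesgue') auto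
  have "ennreal (tent s (\<gamma> b) - tent s (\<gamma> a)) \<le> (\<integral>\<^sup>+x. ennreal (cmod (\<gamma>' x) / s) * indicator {t<..<b} x \<partial>lborel)"
    unfolding I2 by (rule ennreal_leI[OF le])
  also have "\<dots> \<le> (\<integral>\<^sup>+x. ennreal (cmod (\<gamma>' x) / s) * indicator {x \<in> {a..b}. cmod (\<gamma> x) < s} x \<partial>lborel)"
    using t by (intro nn_integral_mono mult_left_mono) (auto simp: indicator_def)
  finally show ?thesis .
qed

lemma rect_area:
  assumes "x0 \<le> x1" "y0 \<le> y1"
  shows "emeasure lborel {z::complex. x0 < Re z \<and> Re z < x1 \<and> y0 < Im z \<and> Im z < y1} = ennreal ((x1 - x0) * (y1 - y0))"
proof -
  have "{z::complex. x0 < Re z \<and> Re z < x1 \<and> y0 < Im z \<and> Im z < y1} = box (Complex x0 y0) (Complex x1 y1)"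
    by (auto simp: in_box_complex_iff)
  moreover have "emeasure lborel (box (Complex x0 y0) (Complex x1 y1)) = ennreal (\<Prod>b\<in>Basis. (Complex x1 y1 - Complex x0 y0) \<bullet> b)"
    using assms by (intro emeasure_lborel_box) (auto simp: Basis_complex_def)
  ultimately show ?thesis by (simp add: Basis_complex_def)
qed

text \<open>If \<open>u\<close> rises by \<open>\<delta>\<close> along the image of every horizontal segment, integrate the length estimate over
  all segments and compare length with area. The parameter \<open>\<mu>\<close> stems from the inequality
  \<open>2 d \<le> \<mu> + d\<^sup>2 / \<mu>\<close>, applied pointwise in place of the Cauchy--Schwarz inequality; it keeps the
  bound linear in the area, ready to be summed over disjoint images. The ends of the rectangle are
  treated as limits since \<open>G\<close> is not defined on the boundary.\<close>

lemma length_area_rectangle: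
  fixes G :: "complex \<Rightarrow> complex"
  defines "Q \<equiv> \<lambda>x0 x1 y0 y1. {z::complex. x0 < Re z \<and> Re z < x1 \<and> y0 < Im z \<and> Im z < y1}"
  assumes s: "s > 0" and \<mu>: "\<mu> > 0" and x: "x0 < x1" and y: "y0 < y1"
    and hol: "G holomorphic_on Q x0 x1 y0 y1" and inj: "inj_on G (Q x0 x1 y0 y1)"
    and ends: "\<And>y e. y0 < y \<Longrightarrow> y < y1 \<Longrightarrow> e > 0 \<Longrightarrow> \<exists>a b. x0 < a \<and> a \<le> b \<and> b < x1 \<and>
       \<delta> - e \<le> tent s (G (Complex b y)) - tent s (G (Complex a y))"
  shows "(y1 - y0) * \<delta> \<le> (\<mu> * ((x1 - x0) * (y1 - y0)) + measure lborel (G ` Q x0 x1 y0 y1 \<inter> ball 0 s) / \<mu>) / (2 * s)"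
proof -
  define R where "R = Q x0 x1 y0 y1"
  define R' where "R' = {z \<in> R. cmod (G z) < s}"
  have opR: "open R" unfolding R_def Q_def
    by (intro open_Collect_conj open_Collect_less continuous_intros)
  have hol: "G holomorphic_on R" and inj: "inj_on G R" using hol inj by (simp_all add: R_def)
  have contG: "continuous_on R G" using hol by (rule holomorphic_on_imp_continuous_on)
  have opR': "open R'"
  proof -
    have "R' = G -` ball 0 s \<inter> R" by (auto simp: R'_def)
    then show ?thesis using contG opR by (simp add: continuous_on_open_vimage)
  qed
  have R'R: "R' \<subseteq> R" by (auto simp: R'_def)
  have GR': "G ` R' = G ` R \<inter> ball 0 s" by (auto simp: R'_def)
  have bd: "bounded (G ` R')" unfolding GR' using bounded_ball bounded_subset by blast
  have contd: "continuous_on R (deriv G)"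
    using holomorphic_deriv[OF hol opR] by (rule holomorphic_on_imp_continuous_on)
  define h where "h z = ennreal (cmod (deriv G z) / s) * indicator R' z" for z
  have hm [measurable]: "h \<in> borel_measurable borel"
    using s unfolding h_def[abs_def]
    by (intro borel_measurable_ennreal_indicator[OF opR'] continuous_intros continuous_on_subset[OF contd R'R]) auto
  have hm2 [measurable]: "(\<lambda>z. ennreal ((cmod (deriv G z))\<^sup>2) * indicator R' z) \<in> borel_measurable borel"
    by (intro borel_measurable_ennreal_indicator[OF opR'] continuous_intros continuous_on_subset[OF contd R'R])
  have line: "ennreal \<delta> \<le> (\<integral>\<^sup>+x. h (Complex x y) \<partial>lborel)" if yy: "y0 < y" "y < y1" for y
  proof (rule ennreal_le_epsilon)
    fix e :: real assume e: "e > 0"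
    obtain a b where ab: "x0 < a" "a \<le> b" "b < x1" and
      d: "\<delta> - e \<le> tent s (G (Complex b y)) - tent s (G (Complex a y))" using ends[OF yy e] by blast
    define D where "D = tent s (G (Complex b y)) - tent s (G (Complex a y))"
    have inR: "Complex x y \<in> R" if "x \<in> {a..b}" for x using that ab yy by (auto simp: R_def Q_def)
    have der: "((\<lambda>x. G (Complex x y)) has_vector_derivative deriv G (Complex x y)) (at x within {a..b})"
      if "x \<in> {a..b}" for x
    proof -
      have 1: "((\<lambda>x. Complex x y) has_vector_derivative 1) (at x within {a..b})"
        by (simp add: has_vector_derivative_complex_iff)
      have 2: "(G has_field_derivative deriv G (Complex x y)) (at (Complex x y) within (\<lambda>x. Complex x y) ` {a..b})"
        using holomorphic_derivI[OF hol opR inR[OF that]] by (rule has_field_derivative_at_within)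
      show ?thesis using field_vector_diff_chain_within[OF 1 2] by (simp add: o_def)
    qed
    have cd: "continuous_on {a..b} (\<lambda>x. deriv G (Complex x y))"
      by (rule continuous_on_compose2[OF contd]) (use inR in \<open>auto intro!: continuous_intros\<close>)
    have "ennreal D \<le> (\<integral>\<^sup>+x. ennreal (cmod (deriv G (Complex x y)) / s) * indicator {x \<in> {a..b}. cmod (G (Complex x y)) < s} x \<partial>lborel)"
      unfolding D_def by (rule tent_along_path[OF s ab(2) der cd])
    also have "\<dots> \<le> (\<integral>\<^sup>+x. h (Complex x y) \<partial>lborel)"
      unfolding h_def R'_def using inR by (intro nn_integral_mono mult_left_mono) (auto simp: indicator_def)
    finally have "ennreal D \<le> (\<integral>\<^sup>+x. h (Complex x y) \<partial>lborel)" .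
    moreover have "ennreal \<delta> \<le> ennreal D + ennreal e"
    proof (cases "D \<ge> 0")
      case True
      then show ?thesis using d e by (simp add: D_def flip: ennreal_plus)
    next
      case False
      then show ?thesis using d e by (simp add: D_def ennreal_neg ennreal_leI)
    qed
    ultimately show "ennreal \<delta> \<le> (\<integral>\<^sup>+x. h (Complex x y) \<partial>lborel) + ennreal e"
      by (meson add_right_mono order_trans)
  qed
  have "ennreal \<delta> * ennreal (y1 - y0) = (\<integral>\<^sup>+y. ennreal \<delta> * indicator {y0<..<y1} y \<partial>lborel)"
    using y by (simp add: nn_integral_cmult)
  also have "\<dots> \<le> (\<integral>\<^sup>+y. (\<integral>\<^sup>+x. h (Complex x y) \<partial>lborel) \<partial>lborel)"
    by (intro nn_integral_mono) (auto simp: indicator_def intro: line)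
  also have "\<dots> = (\<integral>\<^sup>+p. h (case p of (x,y) \<Rightarrow> Complex x y) \<partial>(lborel \<Otimes>\<^sub>M lborel))"
  proof -
    have [measurable]: "(\<lambda>(x,y). Complex x y) \<in> borel_measurable (borel \<Otimes>\<^sub>M borel)"
      unfolding borel_prod case_prod_beta by (intro borel_measurable_continuous_onI continuous_intros)
    have "(\<lambda>p. h (case p of (x,y) \<Rightarrow> Complex x y)) \<in> borel_measurable (lborel \<Otimes>\<^sub>M lborel)"
      by measurable
    then show ?thesis by (subst lborel_pair.nn_integral_snd[symmetric]) auto
  qed
  also have "\<dots> = (\<integral>\<^sup>+z. h z \<partial>(distr (lborel \<Otimes>\<^sub>M lborel) borel (\<lambda>(x,y). Complex x y)))"
  proof -
    have "(\<lambda>(x,y). Complex x y) \<in> borel_measurable (borel \<Otimes>\<^sub>M borel)"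
      unfolding borel_prod case_prod_beta by (intro borel_measurable_continuous_onI continuous_intros)
    then show ?thesis by (subst nn_integral_distr) auto
  qed
  also have "\<dots> = (\<integral>\<^sup>+z. h z \<partial>lborel)" by (simp only: lborel_Complex)
  also have "\<dots> \<le> (\<integral>\<^sup>+z. ennreal (\<mu> / (2 * s)) * indicator R z +
      ennreal (1 / (2 * s * \<mu>)) * (ennreal ((cmod (deriv G z))\<^sup>2) * indicator R' z) \<partial>lborel)"
  proof (rule nn_integral_mono)
    fix z
    show "h z \<le> ennreal (\<mu> / (2 * s)) * indicator R z +
      ennreal (1 / (2 * s * \<mu>)) * (ennreal ((cmod (deriv G z))\<^sup>2) * indicator R' z)"
    proof (cases "z \<in> R'")
      case True
      define d where "d = cmod (deriv G z)"
      have "0 \<le> (\<mu> - d)\<^sup>2" by simp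
      then have "2 * \<mu> * d \<le> \<mu>\<^sup>2 + d\<^sup>2" by (simp add: power2_diff)
      then have "d / s \<le> \<mu> / (2 * s) + 1 / (2 * s * \<mu>) * d\<^sup>2"
        using s \<mu> by (simp add: field_simps power2_eq_square)
      then show ?thesis using True R'R s \<mu>
        by (simp add: h_def d_def ennreal_leI subset_iff flip: ennreal_mult' ennreal_plus)
    qed (simp add: h_def)
  qed
  also have "\<dots> = ennreal (\<mu> / (2 * s)) * emeasure lborel R + ennreal (1 / (2 * s * \<mu>)) * emeasure lborel (G ` R')"
    using opR area_formula[OF opR' holomorphic_on_subset[OF hol R'R] inj_on_subset[OF inj R'R] bd]
    by (subst nn_integral_add) (auto simp: nn_integral_cmult)
  also have "emeasure lborel (G ` R') = ennreal (measure lborel (G ` R \<inter> ball 0 s))"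
    using bd emeasure_bounded_finite[of "G ` R'"] unfolding GR' by (simp add: emeasure_eq_ennreal_measure less_top)
  also have "emeasure lborel R = ennreal ((x1 - x0) * (y1 - y0))"
    using x y unfolding R_def Q_def by (intro rect_area) auto
  also have "ennreal (\<mu> / (2 * s)) * ennreal ((x1 - x0) * (y1 - y0)) + ennreal (1 / (2 * s * \<mu>)) * ennreal (measure lborel (G ` R \<inter> ball 0 s))
     = ennreal (\<mu> / (2 * s) * ((x1 - x0) * (y1 - y0)) + 1 / (2 * s * \<mu>) * measure lborel (G ` R \<inter> ball 0 s))"
    using s \<mu> x y by (simp flip: ennreal_mult' ennreal_plus)
  finally have fin: "ennreal \<delta> * ennreal (y1 - y0) \<le> ennreal (\<mu> / (2 * s) * ((x1 - x0) * (y1 - y0)) + 1 / (2 * s * \<mu>) * measure lborel (G ` R \<inter> ball 0 s))" .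
  have nn: "0 \<le> \<mu> / (2 * s) * ((x1 - x0) * (y1 - y0)) + 1 / (2 * s * \<mu>) * measure lborel (G ` R \<inter> ball 0 s)"
    using s \<mu> x y by simp
  have "\<delta> * (y1 - y0) \<le> \<mu> / (2 * s) * ((x1 - x0) * (y1 - y0)) + 1 / (2 * s * \<mu>) * measure lborel (G ` R \<inter> ball 0 s)"
  proof (cases "\<delta> \<ge> 0")
    case True
    then show ?thesis using fin nn y by (simp add: ennreal_mult'[symmetric] del: ennreal_le_iff) (simp add: ennreal_le_iff)
  next
    case False
    then have "\<delta> * (y1 - y0) \<le> 0" using y by (simp add: mult_nonpos_nonneg)
    then show ?thesis using nn by linarith
  qed
  also have "\<dots> = (\<mu> * ((x1 - x0) * (y1 - y0)) + measure lborel (G ` R \<inter> ball 0 s) / \<mu>) / (2 * s)"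
    using s \<mu> by (simp add: field_simps)
  finally show ?thesis unfolding R_def by (simp add: mult.commute)
qed

section \<open>A binary tree of continua does not shrink to a point\<close>

text \<open>Level \<open>n\<close> lives in the strip between the abscissae \<open>X n\<close> and \<open>X (Suc n)\<close>, up to a gap of width
  \<open>2^-(n+1)\<close> before the next level. The unit interval of ordinates is divided into \<open>2^n\<close> bands, and
  plate \<open>k\<close> fills the middle three quarters of band \<open>k\<close>; the children of plate \<open>k\<close> are the plates
  \<open>2 k\<close> and \<open>2 k + 1\<close> of the next level.\<close>

definition plate :: "(nat \<Rightarrow> real) \<Rightarrow> nat \<Rightarrow> nat \<Rightarrow> complex set" where
  "plate X n k = {z. X n \<le> Re z \<and> Re z \<le> X (Suc n) - (1/2)^Suc n \<and>
     (real k + 1/8) * (1/2)^n \<le> Im z \<and> Im z \<le> (real k + 7/8) * (1/2)^n}"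

text \<open>The rectangle in the gap before level \<open>n\<close> that joins plate \<open>j\<close> of level \<open>n\<close> to its parent. The middle
  half of the band of the child is contained in the vertical extent of the child and also, for both
  children, in that of the parent. The rectangle is twice as wide as high, at every level.\<close>

definition bridge :: "(nat \<Rightarrow> real) \<Rightarrow> nat \<Rightarrow> nat \<Rightarrow> complex set" where
  "bridge X n j = {z. X n - (1/2)^n < Re z \<and> Re z < X n \<and>
     (real j + 1/4) * (1/2)^n < Im z \<and> Im z < (real j + 3/4) * (1/2)^n}"

lemma levels_ordered:
  assumes "\<And>n. X n \<le> X (Suc n) - (1/2)^Suc n" "m < n"
  shows "X m \<le> X n - (1/2::real)^n"
  using assms(2)
proof (induction n)
  case (Suc n)
  show ?case
  proof (cases "m = n")
    case False
    then have "X m \<le> X n - (1/2)^n" using Suc by simp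
    moreover have "(0::real) \<le> (1/2)^n" by simp
    ultimately show ?thesis using assms(1)[of n] by linarith
  qed (use assms(1)[of n] in simp)
qed simp

lemma band_index_unique:
  fixes y v :: real
  assumes v: "v > 0" and "real j * v \<le> y" "y < (real j + 1) * v" "real k * v \<le> y" "y < (real k + 1) * v"
  shows "j = k"
proof -
  have "real j * v < (real k + 1) * v" "real k * v < (real j + 1) * v" using assms by linarith+
  then have "real j < real k + 1" "real k < real j + 1" using v by simp_all
  then show ?thesis by linarith
qed

lemma bridges_disjoint:
  assumes X: "\<And>n. X n \<le> X (Suc n) - (1/2)^Suc n"
    and z: "z \<in> bridge X n j" "z \<in> bridge X m k"
  shows "n = m \<and> j = k"
proof -
  have "n = m"
  proof (rule ccontr)
    assume "n \<noteq> m"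
    then consider "n < m" | "m < n" by linarith
    then show False
      using levels_ordered[OF X, of n m] levels_ordered[OF X, of m n] z
      by cases (auto simp: bridge_def)
  qed
  moreover have "j = k"
  proof (rule band_index_unique[of "(1/2)^n" _ "Im z"])
    have p: "(0::real) < (1/2)^n" by simp
    show "0 < (1/2::real)^n" by (rule p)
    show "real j * (1/2)^n \<le> Im z" "Im z < (real j + 1) * (1/2)^n"
      using z(1) p by (auto simp: bridge_def algebra_simps)
    show "real k * (1/2)^n \<le> Im z" "Im z < (real k + 1) * (1/2)^n"
      using z(2) p unfolding \<open>n = m\<close> by (auto simp: bridge_def algebra_simps)
  qed
  ultimately show ?thesis by simp
qed

lemma bridge_right_end:
  assumes X: "X n \<le> X (Suc n) - (1/2)^Suc n"
    and y: "(real j + 1/4) * (1/2)^n < y" "y < (real j + 3/4) * (1/2)^n"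
  shows "Complex (X n) y \<in> plate X n j"
proof -
  have "(0::real) < (1/2)^n" by simp
  then show ?thesis using assms by (auto simp: plate_def algebra_simps)
qed

lemma bridge_left_end:
  assumes X: "X n \<le> X (Suc n) - (1/2)^Suc n"
    and y: "(real j + 1/4) * (1/2)^Suc n < y" "y < (real j + 3/4) * (1/2)^Suc n"
  shows "Complex (X (Suc n) - (1/2)^Suc n) y \<in> plate X n (j div 2)"
proof -
  define v :: real where "v = (1/2)^n"
  have v: "v > 0" by (simp add: v_def)
  define k where "k = j div 2"
  have "j = 2 * k \<or> j = 2 * k + 1" unfolding k_def by linarith
  then have kj: "2 * real k \<le> real j" "real j \<le> 2 * real k + 1" by auto
  have kv: "2 * real k * v \<le> real j * v" "real j * v \<le> (2 * real k + 1) * v"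
    using kj v by (intro mult_right_mono; simp)+
  then have "(real k + 1/8) * v \<le> y" "y \<le> (real k + 7/8) * v"
  proof -
    have "real k * v \<le> real j * v / 2" "real j * v / 2 \<le> real k * v + v / 2"
      using kv by (auto simp: algebra_simps)
    moreover have "real j * v / 2 + v / 8 \<le> y" "y \<le> real j * v / 2 + 3 * v / 8"
      using y by (auto simp: v_def algebra_simps)
    ultimately show "(real k + 1/8) * v \<le> y" "y \<le> (real k + 7/8) * v"
      unfolding distrib_right by linarith+
  qed
  then show ?thesis using X unfolding plate_def k_def[symmetric] v_def by simp
qed

lemma sum_over_children:
  fixes g :: "nat \<Rightarrow> real"
  shows "(\<Sum>j<2 * m. g (j div 2)) = 2 * (\<Sum>k<m. g k)"
  by (induction m) auto

text \<open>Averages of \<open>h\<close> over the levels of a binary tree. A vertex of level \<open>n\<close> carries the weight \<open>2^-n\<close>, and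
  the \<open>2^n\<close> squared weights of level \<open>n\<close> add up to \<open>2^-n\<close>, a convergent series: the uniform flow down
  the tree has finite energy. In the total area bound every disk is counted three times, twice as a
  parent and once as a child, and every bridge once; hence the factor \<open>4\<close>.\<close>

lemma tree_energy_bound:
  fixes h aE aQ :: "nat \<Rightarrow> nat \<Rightarrow> real" and A B l :: real
  assumes B: "B > 0"
    and nonneg: "\<And>n k. aE n k \<ge> 0" "\<And>n k. aQ n k \<ge> 0"
    and totE: "\<And>m. (\<Sum>n\<le>m. \<Sum>k<2^n. aE n k) \<le> A"
    and totQ: "\<And>m. (\<Sum>n\<in>{1..m}. \<Sum>k<2^n. aQ n k) \<le> A"
    and step: "\<And>n j. j < 2^Suc n \<Longrightarrow>
      (1/2)^Suc n * (h (Suc n) j - h n (j div 2)) \<le> 3/2 * l * ((1/2)^Suc n)\<^sup>2 +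
         (aQ (Suc n) j + aE (Suc n) j + aE n (j div 2)) / (l * B)"
    and l: "l > 0"
    and N0: "\<And>k. k < 2^N \<Longrightarrow> h N k \<le> 0"
    and "N \<le> m"
  shows "(1/2)^m * (\<Sum>k<2^m. h m k) \<le> 3/2 * l * (1/2)^N + 4 * A / (l * B)"
proof -
  define H where "H n = (1/2)^n * (\<Sum>k<2^n. h n k)" for n
  define SE SQ where "SE n = (\<Sum>k<2^n. aE n k)" and "SQ n = (\<Sum>k<2^n. aQ n k)" for n
  have inc: "H (Suc n) - H n \<le> 3/2 * l * (1/2)^Suc n + (SQ (Suc n) + SE (Suc n) + 2 * SE n) / (l * B)" for n
  proof -
    have ch: "(\<Sum>j<2^Suc n. g (j div 2)) = 2 * (\<Sum>k<2^n. g k)" for g :: "nat \<Rightarrow> real"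
      using sum_over_children[of g "2^n"] by simp
    have "H (Suc n) - H n = (\<Sum>j<2^Suc n. (1/2)^Suc n * (h (Suc n) j - h n (j div 2)))"
      unfolding sum_distrib_left[symmetric] sum_subtractf ch H_def by (simp add: algebra_simps)
    also have "\<dots> \<le> (\<Sum>j<2^Suc n. 3/2 * l * ((1/2)^Suc n)\<^sup>2 +
         (aQ (Suc n) j + aE (Suc n) j + aE n (j div 2)) / (l * B))"
      by (intro sum_mono step) simp
    also have "\<dots> = 2^Suc n * (3/2 * l * ((1/2)^Suc n)\<^sup>2) + (SQ (Suc n) + SE (Suc n) + 2 * SE n) / (l * B)"
      by (simp only: sum.distrib sum_divide_distrib[symmetric] ch[of "aE n"] SE_def SQ_def) simp
    also have "2^Suc n * (3/2 * l * ((1/2)^Suc n)\<^sup>2) = 3/2 * l * (1/2)^Suc n"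
      by (simp add: power2_eq_square power_one_over)
    finally show ?thesis .
  qed
  have tele: "H m - H N \<le> 3/2 * l * ((1/2)^N - (1/2)^m) +
      ((\<Sum>n\<in>{Suc N..m}. SQ n) + (\<Sum>n\<in>{Suc N..m}. SE n) + 2 * (\<Sum>n\<in>{N..<m}. SE n)) / (l * B)"
    using \<open>N \<le> m\<close>
  proof (induction m rule: dec_induct)
    case (step m)
    have "H (Suc m) - H N = (H m - H N) + (H (Suc m) - H m)" by simp
    also have "\<dots> \<le> 3/2 * l * ((1/2)^N - (1/2)^m) +
      ((\<Sum>n\<in>{Suc N..m}. SQ n) + (\<Sum>n\<in>{Suc N..m}. SE n) + 2 * (\<Sum>n\<in>{N..<m}. SE n)) / (l * B)
      + (3/2 * l * (1/2)^Suc m + (SQ (Suc m) + SE (Suc m) + 2 * SE m) / (l * B))"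
      using step.IH inc[of m] by linarith
    also have "\<dots> = 3/2 * l * ((1/2)^N - (1/2)^Suc m) +
      (((\<Sum>n\<in>{Suc N..m}. SQ n) + SQ (Suc m)) + ((\<Sum>n\<in>{Suc N..m}. SE n) + SE (Suc m)) + 2 * ((\<Sum>n\<in>{N..<m}. SE n) + SE m)) / (l * B)"
      by (simp add: algebra_simps add_divide_distrib)
    finally show ?case using step.hyps by (simp add: sum.atLeastLessThan_Suc)
  qed simp
  have nn: "0 \<le> SQ n" "0 \<le> SE n" for n
    unfolding SQ_def SE_def using nonneg by (auto intro: sum_nonneg)
  have "(\<Sum>n\<in>{Suc N..m}. SQ n) \<le> (\<Sum>n\<in>{1..m}. SQ n)"
    by (rule sum_mono2) (auto simp: nn)
  then have "(\<Sum>n\<in>{Suc N..m}. SQ n) \<le> A" using totQ[of m] by (simp add: SQ_def)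
  moreover have "(\<Sum>n\<in>{Suc N..m}. SE n) \<le> (\<Sum>n\<le>m. SE n)" "(\<Sum>n\<in>{N..<m}. SE n) \<le> (\<Sum>n\<le>m. SE n)"
    by (rule sum_mono2; auto simp: nn)+
  then have "(\<Sum>n\<in>{Suc N..m}. SE n) \<le> A" "(\<Sum>n\<in>{N..<m}. SE n) \<le> A"
    using totE[of m] by (simp_all add: SE_def)
  ultimately have "((\<Sum>n\<in>{Suc N..m}. SQ n) + (\<Sum>n\<in>{Suc N..m}. SE n) + 2 * (\<Sum>n\<in>{N..<m}. SE n)) / (l * B) \<le> (4 * A) / (l * B)"
    using B l by (intro divide_right_mono) auto
  then have "H m - H N \<le> 3/2 * l * ((1/2)^N - (1/2)^m) + 4 * A / (l * B)" using tele by linarith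
  moreover have "H N \<le> 0" unfolding H_def using N0
    by (intro mult_nonneg_nonpos sum_nonpos) auto
  moreover have "3/2 * l * ((1/2)^N - (1/2)^m) \<le> 3/2 * l * (1/2)^N"
    using l by (intro mult_left_mono) auto
  ultimately show ?thesis unfolding H_def by linarith
qed

text \<open>Weighting the inequality between oscillation and area: \<open>2 v D \<le> l v\<^sup>2 + D\<^sup>2 / l\<close>.\<close>

lemma tent_value_step:
  fixes l s v D a :: real
  assumes l: "l > 0" and s: "s > 0" and o: "pi * (D * s)\<^sup>2 / 4 \<le> a"
  shows "v * D \<le> l * v\<^sup>2 / 2 + a / (l * s\<^sup>2)"
proof -
  have "0 \<le> (l * v - D)\<^sup>2" by simp
  then have 1: "2 * l * (v * D) \<le> l\<^sup>2 * v\<^sup>2 + D\<^sup>2" by (simp add: power2_diff power_mult_distrib algebra_simps)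
  have "2 * (D * s)\<^sup>2 \<le> pi * (D * s)\<^sup>2" using pi_ge_two by (intro mult_right_mono) auto
  then have "D\<^sup>2 * s\<^sup>2 \<le> 2 * a" using o by (simp add: power_mult_distrib)
  then have "D\<^sup>2 \<le> 2 * a / s\<^sup>2" using s by (simp add: field_simps)
  with 1 have "v * D \<le> (l\<^sup>2 * v\<^sup>2 + 2 * a / s\<^sup>2) / (2 * l)" using l by (simp add: field_simps)
  also have "\<dots> = l * v\<^sup>2 / 2 + a / (l * s\<^sup>2)" using l s by (simp add: field_simps power2_eq_square)
  finally show ?thesis .
qed

text \<open>The sets \<open>E n k\<close> are the images of the plates; that the boundary values of \<open>G\<close> at a plate lie in the
  corresponding disk is the assumption \<open>bdry\<close>. The disks of level \<open>N\<close> are kept away from \<open>0\<close> at some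
  scale \<open>s\<close> that is not under control, but the energy bound is invariant under scaling.\<close>

lemma no_tree_collapse:
  fixes G :: "complex \<Rightarrow> complex" and X :: "nat \<Rightarrow> real" and E :: "nat \<Rightarrow> nat \<Rightarrow> complex set"
  assumes X: "\<And>n. X n \<le> X (Suc n) - (1/2)^Suc n"
    and hol: "G holomorphic_on W" and inj: "inj_on G W"
    and br: "\<And>n j. j < 2^Suc n \<Longrightarrow> bridge X (Suc n) j \<subseteq> W"
    and E: "\<And>n k. k < 2^n \<Longrightarrow> \<exists>c r. 0 \<le> r \<and> E n k = cball c r"
    and dis: "\<And>n k m j. k < 2^n \<Longrightarrow> j < 2^m \<Longrightarrow> (n,k) \<noteq> (m,j) \<Longrightarrow> E n k \<inter> E m j = {}"
    and zero: "\<And>n k. k < 2^n \<Longrightarrow> 0 \<notin> E n k"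
    and lim: "\<And>s. s > 0 \<Longrightarrow> \<exists>m0. \<forall>n\<ge>m0. \<forall>k<2^n. E n k \<subseteq> ball 0 s"
    and bdry: "\<And>n k z e. k < 2^n \<Longrightarrow> z \<in> plate X n k \<Longrightarrow> e > 0 \<Longrightarrow>
       \<exists>d>0. \<forall>w\<in>W. dist w z < d \<longrightarrow> (\<exists>p\<in>E n k. dist (G w) p < e)"
  shows False
proof -
  have "\<forall>n k. \<exists>c r. k < 2^n \<longrightarrow> 0 \<le> r \<and> E n k = cball c r" using E by blast
  then obtain c r where cr: "\<And>n k. k < 2^n \<Longrightarrow> 0 \<le> r n k" "\<And>n k. k < 2^n \<Longrightarrow> E n k = cball (c n k) (r n k)"
    by metis
  \<comment> \<open>With \<open>l = 256\<close> below, the final bound \<open>3/2 * l * 2^-N + 4 * 16 / l\<close> is less than \<open>3/4\<close>.\<close>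
  define N :: nat where "N = 12"
  \<comment> \<open>The scale: finitely many disks, none of which contains \<open>0\<close>.\<close>
  have "\<exists>s>0. \<forall>k<2^N. E N k \<inter> ball 0 s = {}"
  proof -
    have "open (- (\<Union>k<2^N. E N k))"
      by (intro open_Compl closed_UN) (auto simp: cr(2))
    moreover have "0 \<in> - (\<Union>k<2^N. E N k)" using zero by auto
    ultimately obtain s where "s > 0" "ball 0 s \<subseteq> - (\<Union>k<2^N. E N k)"
      by (meson open_contains_ball)
    then show ?thesis by (intro exI[of _ s]) fastforce
  qed
  then obtain s where s: "s > 0" and sN: "\<And>k. k < 2^N \<Longrightarrow> E N k \<inter> ball 0 s = {}" by blast
  obtain m0 where m0: "\<And>n k. n \<ge> m0 \<Longrightarrow> k < 2^n \<Longrightarrow> E n k \<subseteq> ball 0 (s/4)"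
    using lim[of "s/4"] s by auto
  define aE where "aE n k = (if k < 2^n then measure lborel (E n k \<inter> ball 0 (2 * s)) else 0)" for n k
  define aQ where "aQ n j = (if n \<ge> 1 \<and> j < 2^n then measure lborel (G ` bridge X n j \<inter> ball 0 s) else 0)" for n j
  define h where "h n k = tent s (c n k)" for n k
  \<comment> \<open>An upper bound for the area of the disk of radius \<open>2 s\<close>.\<close>
  define A where "A = s\<^sup>2 * 16"
  have s2: "s\<^sup>2 > 0" using s by simp
  have ballA: "measure lborel (ball (0::complex) (2 * s)) \<le> A" "measure lborel (ball (0::complex) s) \<le> A"
  proof -
    have "measure lborel (ball (0::complex) t) \<le> 4 * t\<^sup>2" if "t > 0" for t
    proof -
      have "measure lborel (ball (0::complex) t) \<le> measure lborel (cball (0::complex) t)"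
        by (intro measure_mono_fmeasurable ball_subset_cball fmeasurable_lborel_bounded) auto
      also have "\<dots> = pi * t\<^sup>2" using that by (simp add: measure_cball_complex)
      also have "\<dots> \<le> 4 * t\<^sup>2" using pi_less_4 by (intro mult_right_mono) auto
      finally show ?thesis .
    qed
    note b = this
    show "measure lborel (ball (0::complex) s) \<le> A"
      using b[OF s] s2 unfolding A_def by linarith
    have "0 < 2 * s" using s by simp
    from b[OF this] show "measure lborel (ball (0::complex) (2 * s)) \<le> A"
      by (simp add: A_def power_mult_distrib)
  qed
  have sum_le: "(\<Sum>n\<in>I. \<Sum>k<2^n. measure lborel (S n k)) \<le> A"
    if fin: "finite I" and S: "\<And>n k. n \<in> I \<Longrightarrow> k < 2^n \<Longrightarrow> S n k \<in> sets lborel"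
      "\<And>n k. n \<in> I \<Longrightarrow> k < 2^n \<Longrightarrow> S n k \<subseteq> ball 0 t"
      "\<And>n k m j. n \<in> I \<Longrightarrow> k < 2^n \<Longrightarrow> m \<in> I \<Longrightarrow> j < 2^m \<Longrightarrow> (n,k) \<noteq> (m,j) \<Longrightarrow> S n k \<inter> S m j = {}"
      and t: "measure lborel (ball (0::complex) t) \<le> A"
    for I :: "nat set" and S :: "nat \<Rightarrow> nat \<Rightarrow> complex set" and t
  proof -
    let ?J = "SIGMA n:I. {..<(2::nat)^n}"
    have finJ: "finite ?J" using fin by auto
    have fm: "S n k \<in> fmeasurable lborel" if "n \<in> I" "k < 2^n" for n k
      using S(1,2)[OF that] by (intro fmeasurable_lborel_bounded) (auto intro: bounded_subset[OF bounded_ball])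
    have "(\<Sum>n\<in>I. \<Sum>k<2^n. measure lborel (S n k)) = (\<Sum>p\<in>?J. measure lborel (case p of (n,k) \<Rightarrow> S n k))"
      using fin by (subst sum.Sigma) (auto intro!: sum.cong)
    also have "\<dots> = measure lborel (\<Union>p\<in>?J. case p of (n,k) \<Rightarrow> S n k)"
    proof (rule measure_finite_Union[symmetric, OF finJ])
      show "(\<lambda>p. case p of (n,k) \<Rightarrow> S n k) ` ?J \<subseteq> sets lborel" using S(1) by auto
      show "disjoint_family_on (\<lambda>p. case p of (n,k) \<Rightarrow> S n k) ?J"
        unfolding disjoint_family_on_def using S(3) by auto
      show "emeasure lborel (case p of (n,k) \<Rightarrow> S n k) \<noteq> \<infinity>" if "p \<in> ?J" for p
        using that fm by (auto simp: fmeasurable_def less_top)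
    qed
    also have "\<dots> \<le> measure lborel (ball (0::complex) t)"
    proof (rule measure_mono_fmeasurable)
      show "(\<Union>p\<in>?J. case p of (n,k) \<Rightarrow> S n k) \<subseteq> ball 0 t" using S(2) by fast
      show "(\<Union>p\<in>?J. case p of (n,k) \<Rightarrow> S n k) \<in> sets lborel"
        using finJ S(1) by (intro sets.finite_UN) auto
      show "ball (0::complex) t \<in> fmeasurable lborel" by (intro fmeasurable_lborel_bounded) auto
    qed
    finally show ?thesis using t by linarith
  qed
  have bropen: "open (bridge X n j)" for n j
    unfolding bridge_def by (intro open_Collect_conj open_Collect_less continuous_intros)
  have br': "bridge X n j \<subseteq> W" if "n \<ge> 1" "j < 2^n" for n j
  proof -
    obtain n' where "n = Suc n'" using \<open>n \<ge> 1\<close> by (cases n) auto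
    then show ?thesis using br[of j n'] that by simp
  qed
  have Gopen: "open (G ` bridge X n j)" if "n \<ge> 1" "j < 2^n" for n j
  proof -
    have "bridge X n j \<subseteq> W" using br' that by simp
    then show ?thesis
      using open_mapping_thm3[OF holomorphic_on_subset[OF hol] bropen inj_on_subset[OF inj]] by blast
  qed
  have totE: "(\<Sum>n\<le>m. \<Sum>k<2^n. aE n k) \<le> A" for m
  proof -
    have "(\<Sum>n\<le>m. \<Sum>k<2^n. measure lborel (E n k \<inter> ball 0 (2 * s))) \<le> A"
    proof (rule sum_le[OF _ _ _ _ ballA(1)])
      fix n k n' k' :: nat assume "n \<in> {..m}" "k < 2^n" "n' \<in> {..m}" "k' < 2^n'" "(n,k) \<noteq> (n',k')"
      then have "E n k \<inter> E n' k' = {}" by (intro dis)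
      then show "(E n k \<inter> ball 0 (2 * s)) \<inter> (E n' k' \<inter> ball 0 (2 * s)) = {}" by blast
    qed (auto simp: cr(2))
    then show ?thesis by (simp add: aE_def)
  qed
  have totQ: "(\<Sum>n\<in>{1..m}. \<Sum>k<2^n. aQ n k) \<le> A" for m
  proof -
    have "(\<Sum>n\<in>{1..m}. \<Sum>k<2^n. measure lborel (G ` bridge X n k \<inter> ball 0 s)) \<le> A"
    proof (rule sum_le[OF _ _ _ _ ballA(2)])
      fix n k n' k' :: nat assume n: "n \<in> {1..m}" "k < 2^n" and n': "n' \<in> {1..m}" "k' < 2^n'" and ne: "(n,k) \<noteq> (n',k')"
      have "bridge X n k \<subseteq> W" using br' n by simp
      moreover have "bridge X n' k' \<subseteq> W" using br' n' by simp
      moreover have "bridge X n k \<inter> bridge X n' k' = {}" using bridges_disjoint[OF X] ne by blast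
      ultimately have "G ` bridge X n k \<inter> G ` bridge X n' k' = {}"
        using inj by (metis (no_types, opaque_lifting) image_empty inj_on_image_Int)
      then show "(G ` bridge X n k \<inter> ball 0 s) \<inter> (G ` bridge X n' k' \<inter> ball 0 s) = {}" by blast
    qed (use Gopen in auto)
    also have "(\<Sum>n\<in>{1..m}. \<Sum>k<2^n. measure lborel (G ` bridge X n k \<inter> ball 0 s)) = (\<Sum>n\<in>{1..m}. \<Sum>k<2^n. aQ n k)"
      by (intro sum.cong refl) (auto simp: aQ_def)
    finally show ?thesis .
  qed
  define l :: real where "l = 256"
  have step: "(1/2)^Suc n * (h (Suc n) j - h n (j div 2)) \<le> 3/2 * l * ((1/2)^Suc n)\<^sup>2 +
         (aQ (Suc n) j + aE (Suc n) j + aE n (j div 2)) / (l * s\<^sup>2)" if j: "j < 2^Suc n" for n j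
  proof -
    define v :: real where "v = (1/2)^Suc n"
    have v: "v > 0" by (simp add: v_def)
    define k where "k = j div 2"
    have k: "k < 2^n" using j by (simp add: k_def)
    \<comment> \<open>Bounds for the oscillation of \<open>u\<close> on the parent disk and on the child disk.\<close>
    define o1 where "o1 = sqrt (4 * aE n k / pi) / s"
    define o2 where "o2 = sqrt (4 * aE (Suc n) j / pi) / s"
    have aEnn: "0 \<le> aE n k" for n k by (simp add: aE_def)
    have sq: "pi * (sqrt (4 * a / pi) / s * s)\<^sup>2 / 4 = a" if "0 \<le> a" for a
      using s that by simp
    have osc: "\<bar>tent s p - h n k\<bar> \<le> sqrt (4 * aE n k / pi) / s" if "k < 2^n" "p \<in> E n k" for n k p
    proof -
      have "pi * ((tent s p - h n k) * s)\<^sup>2 / 4 \<le> aE n k"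
        using tent_osc_cball[OF s, of p "c n k" "r n k" "c n k"] cr that by (simp add: h_def aE_def)
      then have "((tent s p - h n k) * s)\<^sup>2 \<le> 4 * aE n k / pi" by (simp add: field_simps)
      then have "\<bar>(tent s p - h n k) * s\<bar> \<le> sqrt (4 * aE n k / pi)" by (simp add: real_le_rsqrt)
      then have "\<bar>tent s p - h n k\<bar> * s \<le> sqrt (4 * aE n k / pi)"
        unfolding abs_mult using s by simp
      then show ?thesis using s by (simp only: pos_le_divide_eq)
    qed
    \<comment> \<open>The part of the increment that has to be gained while crossing the bridge.\<close>
    define \<delta> where "\<delta> = h (Suc n) j - h n k - o1 - o2"
    have R: "bridge X (Suc n) j = {z. X (Suc n) - v < Re z \<and> Re z < X (Suc n) \<and> (real j + 1/4) * v < Im z \<and> Im z < (real j + 3/4) * v}"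
      by (simp add: bridge_def v_def)
    have "((real j + 3/4) * v - (real j + 1/4) * v) * \<delta> \<le>
       ((l * s) * ((X (Suc n) - (X (Suc n) - v)) * ((real j + 3/4) * v - (real j + 1/4) * v)) +
         measure lborel (G ` bridge X (Suc n) j \<inter> ball 0 s) / (l * s)) / (2 * s)"
      unfolding R
    proof (rule length_area_rectangle[OF s])
      show "0 < l * s" using s by (simp add: l_def)
      show "X (Suc n) - v < X (Suc n)" "(real j + 1/4) * v < (real j + 3/4) * v" using v by auto
      show "G holomorphic_on {z. X (Suc n) - v < Re z \<and> Re z < X (Suc n) \<and> (real j + 1/4) * v < Im z \<and> Im z < (real j + 3/4) * v}"
        "inj_on G {z. X (Suc n) - v < Re z \<and> Re z < X (Suc n) \<and> (real j + 1/4) * v < Im z \<and> Im z < (real j + 3/4) * v}"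
        using br[OF j] hol inj unfolding R by (auto intro: holomorphic_on_subset inj_on_subset)
      fix y e :: real assume y: "(real j + 1/4) * v < y" "y < (real j + 3/4) * v" and e: "e > 0"
      have inW: "Complex x y \<in> W" if "X (Suc n) - v < x" "x < X (Suc n)" for x
        using br[OF j] y that unfolding R by auto
      have se: "s * e / 2 > 0" using s e by simp
      have pl: "Complex (X (Suc n) - v) y \<in> plate X n k" "Complex (X (Suc n)) y \<in> plate X (Suc n) j"
        using bridge_left_end[OF X] bridge_right_end[OF X] y unfolding v_def k_def by blast+
      obtain d1 where d1: "d1 > 0" "\<And>w. w \<in> W \<Longrightarrow> dist w (Complex (X (Suc n) - v) y) < d1 \<Longrightarrow> \<exists>p\<in>E n k. dist (G w) p < s * e / 2"
        using bdry[OF k pl(1) se] by blast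
      obtain d2 where d2: "d2 > 0" "\<And>w. w \<in> W \<Longrightarrow> dist w (Complex (X (Suc n)) y) < d2 \<Longrightarrow> \<exists>p\<in>E (Suc n) j. dist (G w) p < s * e / 2"
        using bdry[OF j pl(2) se] by blast
      define a where "a = X (Suc n) - v + min v d1 / 2"
      define b where "b = X (Suc n) - min v d2 / 2"
      have ab: "X (Suc n) - v < a" "a \<le> b" "b < X (Suc n)" "a < X (Suc n)" "X (Suc n) - v < b"
        using v d1(1) d2(1) by (auto simp: a_def b_def)
      have dc: "dist (Complex x y) (Complex x' y) = \<bar>x - x'\<bar>" for x x'
        by (simp add: dist_norm complex_diff cmod_def)
      obtain p where p: "p \<in> E n k" "dist (G (Complex a y)) p < s * e / 2"
        using d1(2)[OF inW[of a]] ab v d1(1) unfolding dc a_def by (auto simp: min_def split: if_splits)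
      obtain q where q: "q \<in> E (Suc n) j" "dist (G (Complex b y)) q < s * e / 2"
        using d2(2)[OF inW[of b]] ab v d2(1) unfolding dc b_def by (auto simp: min_def split: if_splits)
      have "dist (G (Complex a y)) p / s \<le> e / 2" "dist q (G (Complex b y)) / s \<le> e / 2"
        using p(2) q(2) s by (simp_all add: field_simps dist_commute)
      then have "tent s (G (Complex a y)) \<le> tent s p + e / 2" "tent s q - e / 2 \<le> tent s (G (Complex b y))"
        using tent_diff_le[OF s, of "G (Complex a y)" p] tent_diff_le[OF s, of q "G (Complex b y)"] by linarith+
      moreover have "tent s p \<le> h n k + o1" using osc[OF k p(1)] unfolding o1_def by linarith
      moreover have "h (Suc n) j - o2 \<le> tent s q" using osc[OF j q(1)] unfolding o2_def by linarith
      ultimately have "\<delta> - e \<le> tent s (G (Complex b y)) - tent s (G (Complex a y))"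
        unfolding \<delta>_def by linarith
      then show "\<exists>a b. X (Suc n) - v < a \<and> a \<le> b \<and> b < X (Suc n) \<and> \<delta> - e \<le> tent s (G (Complex b y)) - tent s (G (Complex a y))"
        using ab by blast
    qed
    also have "measure lborel (G ` bridge X (Suc n) j \<inter> ball 0 s) = aQ (Suc n) j" using j by (simp add: aQ_def)
    finally have "v * \<delta> \<le> l * v\<^sup>2 / 2 + aQ (Suc n) j / (l * s\<^sup>2)"
      using s by (simp add: l_def field_simps power2_eq_square)
    moreover have "v * o1 \<le> l * v\<^sup>2 / 2 + aE n k / (l * s\<^sup>2)" unfolding o1_def
      by (rule tent_value_step[OF _ s]) (use sq[OF aEnn] in \<open>auto simp: l_def\<close>)
    moreover have "v * o2 \<le> l * v\<^sup>2 / 2 + aE (Suc n) j / (l * s\<^sup>2)" unfolding o2_def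
      by (rule tent_value_step[OF _ s]) (use sq[OF aEnn] in \<open>auto simp: l_def\<close>)
    moreover have "v * (h (Suc n) j - h n k) = v * \<delta> + v * o1 + v * o2" by (simp add: \<delta>_def algebra_simps)
    ultimately show ?thesis unfolding v_def[symmetric] k_def[symmetric] by (simp add: add_divide_distrib)
  qed
  define m where "m = max N m0"
  have "(1/2)^m * (\<Sum>k<2^m. h m k) \<le> 3/2 * l * (1/2)^N + 4 * A / (l * s\<^sup>2)"
  proof (rule tree_energy_bound[OF s2 _ _ totE totQ step])
    show "h N k \<le> 0" if "k < 2^N" for k
    proof -
      have "c N k \<in> E N k" using cr that by simp
      then have "s \<le> cmod (c N k)" using sN[OF that] by (auto simp: not_less)
      then show ?thesis using tent_eq_0[OF s] by (simp add: h_def)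
    qed
  qed (auto simp: aE_def aQ_def l_def m_def)
  moreover have "(1/2)^m * (\<Sum>k<2^m. h m k) \<ge> (1/2)^m * (\<Sum>k::nat<2^m. 3/4)"
  proof (intro mult_left_mono sum_mono)
    fix k :: nat assume "k \<in> {..<2^m}"
    then have k: "k < 2^m" by simp
    then have "c m k \<in> E m k" using cr by simp
    then have "c m k \<in> ball 0 (s/4)" using m0[of m k] k by (auto simp: m_def)
    then have "cmod (c m k) / s \<le> 1/4" using s by (simp add: field_simps)
    then show "3/4 \<le> h m k" unfolding h_def tent_def by linarith
  qed simp
  moreover have "(1/2)^m * (\<Sum>k::nat<2^m. 3/4) = (3/4::real)" by (simp add: power_one_over)
  moreover have "3/2 * l * (1/2)^N + 4 * A / (l * s\<^sup>2) < 3/4"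
    using s by (simp add: l_def N_def A_def power_one_over)
  ultimately show False by linarith
qed

section \<open>Moebius charts of the sphere\<close>

lemma chord_stereo: "(norm (stereo p - stereo q))\<^sup>2 = 2 - 2 * cos (dist p q)"
proof -
  have "cos (dist p q) = stereo p \<bullet> stereo q"
    unfolding dist_riemann_sphere_def by (rule cos_arccos_abs[OF abs_inner_stereo])
  then show ?thesis unfolding power2_norm_eq_inner
    by (simp add: inner_diff_left inner_diff_right inner_commute)
qed

lemma norm_stereo_diff_le: "norm (stereo p - stereo q) \<le> dist p q"
proof -
  have "1 - (dist p q)\<^sup>2 / 2 \<le> cos (dist p q)"
  proof -
    have "cos (dist p q) = 1 - 2 * (sin (dist p q / 2))\<^sup>2" using cos_double_sin[of "dist p q / 2"] by simp
    moreover have "(sin (dist p q / 2))\<^sup>2 \<le> (dist p q / 2)\<^sup>2"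
      using abs_sin_x_le_abs_x[of "dist p q / 2"] by (simp only: abs_le_square_iff)
    ultimately show ?thesis by (simp add: power_divide)
  qed
  then have "(norm (stereo p - stereo q))\<^sup>2 \<le> (dist p q)\<^sup>2" unfolding chord_stereo by linarith
  then show ?thesis by (rule power2_le_imp_le) simp
qed

lemma continuous_on_stereo [continuous_intros]:
  assumes "continuous_on A f" shows "continuous_on A (\<lambda>x. stereo (f x))"
proof -
  have "continuous_on UNIV stereo"
  proof (rule continuous_onI)
    fix p e assume "0 < (e::real)"
    then show "\<exists>d>0. \<forall>x'\<in>UNIV. dist x' p < d \<longrightarrow> dist (stereo x') (stereo p) \<le> e"
      using order_trans[OF norm_stereo_diff_le less_imp_le] by (intro exI[of _ e]) (simp add: dist_norm)
  qed
  then show ?thesis using assms by (rule continuous_on_compose2) auto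
qed

text \<open>The spherical distance is a continuous function of the chord, so the sphere carries the topology
  induced from its embedding by \<open>stereo\<close>.\<close>

lemma continuous_on_into_sphere:
  fixes f :: "'a::topological_space \<Rightarrow> riemann_sphere"
  assumes "continuous_on A (\<lambda>x. stereo (f x))" shows "continuous_on A f"
  unfolding continuous_on_def
proof
  fix a assume a: "a \<in> A"
  have "continuous_on A (\<lambda>x. arccos (stereo (f x) \<bullet> stereo (f a)))"
    using abs_inner_stereo by (intro continuous_on_arccos continuous_intros assms) (auto simp: abs_le_iff minus_le_iff)
  then have "continuous_on A (\<lambda>x. dist (f x) (f a))" by (simp add: dist_riemann_sphere_def)
  then have "((\<lambda>x. dist (f x) (f a)) \<longlongrightarrow> dist (f a) (f a)) (at a within A)"
    using a unfolding continuous_on_def by blast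
  then show "(f \<longlongrightarrow> f a) (at a within A)" by (simp add: tendsto_dist_iff[of f])
qed

text \<open>The point with homogeneous coordinates \<open>[a : b]\<close>.\<close>

definition proj :: "complex \<Rightarrow> complex \<Rightarrow> riemann_sphere" where
  "proj a b = (if b = 0 then Infty else Fin (a / b))"

lemma stereo_proj:
  assumes "a \<noteq> 0 \<or> b \<noteq> 0"
  shows "stereo (proj a b) = ((2 / ((cmod a)\<^sup>2 + (cmod b)\<^sup>2)) *\<^sub>R (a * cnj b), ((cmod a)\<^sup>2 - (cmod b)\<^sup>2) / ((cmod a)\<^sup>2 + (cmod b)\<^sup>2))"
proof (cases "b = 0")
  case False
  define x y where "x = (cmod a)\<^sup>2" and "y = (cmod b)\<^sup>2"
  have xy: "x \<ge> 0" "y > 0" using False by (auto simp: x_def y_def)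
  have q: "(cmod (a / b))\<^sup>2 = x / y" by (simp add: norm_divide power_divide x_def y_def)
  have "a / b = (1 / y) *\<^sub>R (a * cnj b)"
    by (subst complex_div_cnj) (simp add: y_def scaleR_conv_of_real)
  then have "(2 / (1 + x / y)) *\<^sub>R (a / b) = (2 / (1 + x / y) * (1 / y)) *\<^sub>R (a * cnj b)" by simp
  also have "2 / (1 + x / y) * (1 / y) = 2 / (x + y)" using xy by (simp add: field_simps)
  finally have 1: "(2 / (1 + x / y)) *\<^sub>R (a / b) = (2 / (x + y)) *\<^sub>R (a * cnj b)" .
  have 2: "(x / y - 1) / (1 + x / y) = (x - y) / (x + y)" 
  proof -
    have "(x / y - 1) = (x - y) / y" "1 + x / y = (x + y) / y" using xy by (auto simp: field_simps)
    then show ?thesis using xy by simp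
  qed
  show ?thesis using False by (simp add: proj_def q 1 2 flip: x_def y_def)
qed (use assms in \<open>auto simp: proj_def\<close>)

lemma at_infty_eq_proj: "at_infty z = proj 1 z"
  by (simp add: at_infty_def proj_def inverse_eq_divide)

lemma Fin_eq_proj: "Fin z = proj z 1"
  by (simp add: proj_def)

lemma inv_Fin [simp]: "inv Fin (Fin w) = w"
  by (rule inv_f_f) (auto intro: injI)

lemma inj_at_infty: "inj at_infty"
  by (auto simp: inj_def at_infty_def split: if_splits)

lemma inv_at_infty [simp]: "inv at_infty (at_infty w) = w"
  by (rule inv_f_f[OF inj_at_infty])

lemma range_Fin: "range Fin = - {Infty}"
  using riemann_sphere.exhaust by auto

lemma range_at_infty: "range at_infty = - {Fin 0}"
proof -
  have "p \<in> range at_infty" if "p \<noteq> Fin 0" for p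
  proof (cases p)
    case (Fin w)
    then have "p = at_infty (inverse w)" using that by (auto simp: at_infty_def)
    then show ?thesis by blast
  next
    case Infty
    then have "p = at_infty 0" by (simp add: at_infty_def)
    then show ?thesis by blast
  qed
  then show ?thesis by (auto simp: at_infty_def split: if_splits)
qed

text \<open>Moebius transformations as charts: the origin is sent to \<open>[\<beta> : \<delta>]\<close>, and \<open>[\<alpha> : \<gamma>]\<close> is the only point
  that is missed. Both can be prescribed, which allows for planar arguments near any given points.\<close>

locale moebius_chart =
  fixes \<alpha> \<beta> \<gamma> \<delta> :: complex
  assumes det: "\<alpha> * \<delta> - \<beta> * \<gamma> \<noteq> 0"
begin

definition chart :: "complex \<Rightarrow> riemann_sphere" where
  "chart z = proj (\<alpha> * z + \<beta>) (\<gamma> * z + \<delta>)"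

text \<open>The inverse transformation. If \<open>\<gamma> = 0\<close> then \<open>Infty\<close> is the pole, and its value \<open>0\<close> is the
  default of the division by zero.\<close>

definition coord :: "riemann_sphere \<Rightarrow> complex" where
  "coord p = (case p of Fin w \<Rightarrow> (\<delta> * w - \<beta>) / (\<alpha> - \<gamma> * w) | Infty \<Rightarrow> - (\<delta> / \<gamma>))"

abbreviation pole :: riemann_sphere where "pole \<equiv> proj \<alpha> \<gamma>"

lemma num_denom: "\<alpha> * z + \<beta> \<noteq> 0 \<or> \<gamma> * z + \<delta> \<noteq> 0"
proof (rule ccontr)
  assume "\<not> ?thesis"
  then have "\<alpha> * z + \<beta> = 0" "\<gamma> * z + \<delta> = 0" by auto
  then have "\<beta> = - (\<alpha> * z)" "\<delta> = - (\<gamma> * z)" by (simp_all add: add_eq_0_iff)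
  then show False using det by simp
qed

lemma Fin_eq_pole_iff: "Fin w = pole \<longleftrightarrow> \<alpha> - \<gamma> * w = 0"
  using det by (auto simp: proj_def field_simps)

lemma Infty_eq_pole_iff: "Infty = pole \<longleftrightarrow> \<gamma> = 0"
  by (simp add: proj_def)

lemma coord_at_infty: "at_infty t \<noteq> pole \<Longrightarrow> coord (at_infty t) = (\<delta> - \<beta> * t) / (\<alpha> * t - \<gamma>)"
proof (cases "t = 0")
  case False
  assume "at_infty t \<noteq> pole"
  then have "\<alpha> - \<gamma> * inverse t \<noteq> 0" using False Fin_eq_pole_iff[of "inverse t"] by (simp add: at_infty_def)
  then show ?thesis using False by (simp add: at_infty_def coord_def field_simps)
qed (simp add: at_infty_def coord_def)

lemma at_infty_eq_pole_iff: "at_infty t = pole \<longleftrightarrow> \<alpha> * t - \<gamma> = 0"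
proof (cases "t = 0")
  case True then show ?thesis using Infty_eq_pole_iff by (simp add: at_infty_def)
next
  case False
  have "at_infty t = pole \<longleftrightarrow> \<alpha> - \<gamma> * inverse t = 0" using False Fin_eq_pole_iff by (simp add: at_infty_def)
  also have "\<dots> \<longleftrightarrow> \<alpha> * t - \<gamma> = 0" using False by (simp add: field_simps)
  finally show ?thesis .
qed

lemma chart_not_pole: "chart z \<noteq> pole"
proof (cases "\<gamma> * z + \<delta> = 0")
  case True
  then have "chart z = Infty" by (simp add: chart_def proj_def)
  moreover have "\<gamma> \<noteq> 0" using True det by (auto simp: add_eq_0_iff)
  ultimately show ?thesis using Infty_eq_pole_iff by metis
next
  case False
  have "\<alpha> * (\<gamma> * z + \<delta>) - \<gamma> * (\<alpha> * z + \<beta>) \<noteq> 0" using det by (simp add: algebra_simps)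
  then have "\<alpha> - \<gamma> * ((\<alpha> * z + \<beta>) / (\<gamma> * z + \<delta>)) \<noteq> 0" using False by (simp add: field_simps)
  then show ?thesis using False Fin_eq_pole_iff by (simp add: chart_def proj_def)
qed

lemma coord_chart [simp]: "coord (chart z) = z"
proof (cases "\<gamma> * z + \<delta> = 0")
  case True
  then have c: "chart z = Infty" by (simp add: chart_def proj_def)
  have g: "\<gamma> \<noteq> 0" using True det by (auto simp: add_eq_0_iff)
  have d: "- \<delta> = \<gamma> * z" using True by (simp add: add_eq_0_iff)
  have "coord (chart z) = (- \<delta>) / \<gamma>" unfolding c by (simp add: coord_def)
  then show ?thesis unfolding d using g by simp
next
  case False
  define w where "w = (\<alpha> * z + \<beta>) / (\<gamma> * z + \<delta>)"
  have c: "chart z = Fin w" using False by (simp add: chart_def proj_def w_def)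
  have nz: "\<alpha> - \<gamma> * w \<noteq> 0" using chart_not_pole[of z] unfolding c Fin_eq_pole_iff by simp
  have "w * (\<gamma> * z + \<delta>) = \<alpha> * z + \<beta>" using False by (simp add: w_def)
  then have "\<delta> * w - \<beta> = z * (\<alpha> - \<gamma> * w)" by (simp add: algebra_simps)
  then show ?thesis using nz by (simp add: c coord_def)
qed

lemma chart_coord [simp]:
  assumes "p \<noteq> pole" shows "chart (coord p) = p"
proof (cases p)
  case Infty
  then have g: "\<gamma> \<noteq> 0" using assms Infty_eq_pole_iff by auto
  then show ?thesis by (simp add: Infty coord_def chart_def proj_def)
next
  case (Fin w)
  then have nz: "\<alpha> - \<gamma> * w \<noteq> 0" using assms Fin_eq_pole_iff by auto
  have 1: "\<gamma> * coord p + \<delta> = (\<alpha> * \<delta> - \<beta> * \<gamma>) / (\<alpha> - \<gamma> * w)"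
    using nz by (simp add: Fin coord_def field_simps)
  have 2: "\<alpha> * coord p + \<beta> = w * ((\<alpha> * \<delta> - \<beta> * \<gamma>) / (\<alpha> - \<gamma> * w))"
    using nz by (simp add: Fin coord_def field_simps)
  show ?thesis unfolding chart_def proj_def 1 2 using nz det by (simp add: Fin)
qed

lemma continuous_chart: "continuous_on A chart"
proof (rule continuous_on_into_sphere)
  have p: "(cmod (\<alpha> * z + \<beta>))\<^sup>2 + (cmod (\<gamma> * z + \<delta>))\<^sup>2 \<noteq> 0" for z
    using num_denom[of z] by (metis add_nonneg_eq_0_iff norm_eq_zero power2_eq_iff_nonneg zero_eq_power2 zero_le_power2)
  have "(\<lambda>z. stereo (chart z)) = (\<lambda>z. ((2 / ((cmod (\<alpha> * z + \<beta>))\<^sup>2 + (cmod (\<gamma> * z + \<delta>))\<^sup>2)) *\<^sub>R ((\<alpha> * z + \<beta>) * cnj (\<gamma> * z + \<delta>)),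
     ((cmod (\<alpha> * z + \<beta>))\<^sup>2 - (cmod (\<gamma> * z + \<delta>))\<^sup>2) / ((cmod (\<alpha> * z + \<beta>))\<^sup>2 + (cmod (\<gamma> * z + \<delta>))\<^sup>2)))"
    unfolding chart_def using stereo_proj[OF num_denom] by auto
  then show "continuous_on A (\<lambda>z. stereo (chart z))"
    using p by (simp only:) (intro continuous_intros; simp)
qed

text \<open>In the ambient coordinates \<open>(X, T)\<close> of the embedded sphere, a point other than \<open>Infty\<close> has homogeneous
  coordinates \<open>[X : 1 - T]\<close> and a point other than \<open>Fin 0\<close> has \<open>[1 + T : cnj X]\<close>. Each description makes
  \<open>coord\<close> a continuous quotient on an open set.\<close>

lemma continuous_coord: "continuous_on (- {pole}) coord"
proof -
  define X T where "X p = fst (stereo p)" and "T p = complex_of_real (snd (stereo p))" for p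
  have cXT: "continuous_on A X" "continuous_on A T" for A
    unfolding X_def T_def by (intro continuous_intros)+
  have d: "1 + (cmod w)\<^sup>2 > 0" "complex_of_real (1 + (cmod w)\<^sup>2) \<noteq> 0" for w
  proof -
    show "1 + (cmod w)\<^sup>2 > 0" by (simp add: add_pos_nonneg)
    then have "1 + (cmod w)\<^sup>2 \<noteq> 0" by linarith
    then show "complex_of_real (1 + (cmod w)\<^sup>2) \<noteq> 0" unfolding of_real_eq_0_iff .
  qed
  have Fin1: "1 - T (Fin w) = 2 / of_real (1 + (cmod w)\<^sup>2)" "X (Fin w) = w * (2 / of_real (1 + (cmod w)\<^sup>2))" for w
  proof -
    have "1 - ((cmod w)\<^sup>2 - 1) / (1 + (cmod w)\<^sup>2) = 2 / (1 + (cmod w)\<^sup>2)" using d(1)[of w] by (simp add: field_simps)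
    then have "complex_of_real (1 - ((cmod w)\<^sup>2 - 1) / (1 + (cmod w)\<^sup>2)) = complex_of_real (2 / (1 + (cmod w)\<^sup>2))" by (rule arg_cong)
    then show "1 - T (Fin w) = 2 / of_real (1 + (cmod w)\<^sup>2)" by (simp add: T_def)
    show "X (Fin w) = w * (2 / of_real (1 + (cmod w)\<^sup>2))" by (simp add: X_def scaleR_conv_of_real)
  qed
  have e1: "coord p = (\<delta> * X p - \<beta> * (1 - T p)) / (\<alpha> * (1 - T p) - \<gamma> * X p) \<and> \<alpha> * (1 - T p) - \<gamma> * X p \<noteq> 0"
    if p: "p \<noteq> pole" "p \<noteq> Infty" for p
  proof -
    obtain w where w: "p = Fin w" using p by (cases p) auto
    define k where "k = 2 / complex_of_real (1 + (cmod w)\<^sup>2)"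
    have k: "k \<noteq> 0" using d(2)[of w] by (simp add: k_def)
    have nz: "\<alpha> - \<gamma> * w \<noteq> 0" using p w Fin_eq_pole_iff by auto
    have a: "\<delta> * X p - \<beta> * (1 - T p) = (\<delta> * w - \<beta>) * k" "\<alpha> * (1 - T p) - \<gamma> * X p = (\<alpha> - \<gamma> * w) * k"
      unfolding w Fin1 k_def[symmetric] by (simp_all add: algebra_simps)
    show ?thesis unfolding a using k nz by (simp add: w coord_def)
  qed
  have e2: "coord p = (\<delta> * (1 + T p) - \<beta> * cnj (X p)) / (\<alpha> * cnj (X p) - \<gamma> * (1 + T p)) \<and> \<alpha> * cnj (X p) - \<gamma> * (1 + T p) \<noteq> 0"
    if p: "p \<noteq> pole" "p \<noteq> Fin 0" for p
  proof (cases p)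
    case Infty
    then have "\<gamma> \<noteq> 0" using p Infty_eq_pole_iff by auto
    then show ?thesis using Infty by (simp add: coord_def X_def T_def)
  next
    case (Fin w)
    define t where "t = inverse w"
    have w0: "w \<noteq> 0" using p Fin by auto
    define k where "k = cnj w * w * (2 / complex_of_real (1 + (cmod w)\<^sup>2))"
    have k: "k \<noteq> 0" using d(2)[of w] w0 by (simp add: k_def)
    have "1 + T p = 2 - (1 - T p)" by simp
    also have "\<dots> = (2 * of_real (1 + (cmod w)\<^sup>2) - 2) / of_real (1 + (cmod w)\<^sup>2)"
      unfolding Fin Fin1 using d(2)[of w] by (simp add: diff_divide_eq_iff)
    also have "2 * of_real (1 + (cmod w)\<^sup>2) - 2 = 2 * (w * cnj w)"
      by (simp add: complex_norm_square algebra_simps del: of_real_power)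
    finally have T: "1 + T p = k" by (simp add: k_def mult.commute)
    have "cnj (X p) = cnj w * (2 / complex_of_real (1 + (cmod w)\<^sup>2))" unfolding Fin Fin1 by simp
    also have "\<dots> = t * k" using w0 by (simp add: k_def t_def)
    finally have X: "cnj (X p) = t * k" .
    have p': "p = at_infty t" using w0 by (simp add: Fin at_infty_def t_def)
    have nz: "\<alpha> * t - \<gamma> \<noteq> 0" using at_infty_eq_pole_iff p p' by metis
    have a: "\<delta> * (1 + T p) - \<beta> * cnj (X p) = (\<delta> - \<beta> * t) * k" "\<alpha> * cnj (X p) - \<gamma> * (1 + T p) = (\<alpha> * t - \<gamma>) * k"
      unfolding T X by (simp_all add: algebra_simps)
    show ?thesis unfolding a using k nz coord_at_infty p p' by simp
  qed
  have "continuous_on (- {pole, Infty} \<union> - {pole, Fin 0}) coord"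
  proof (rule continuous_on_open_Un)
    have "continuous_on (- {pole, Infty}) (\<lambda>p. (\<delta> * X p - \<beta> * (1 - T p)) / (\<alpha> * (1 - T p) - \<gamma> * X p))"
      using e1 by (intro continuous_intros cXT) auto
    then show "continuous_on (- {pole, Infty}) coord"
      by (rule continuous_on_eq) (use e1 in auto)
    have "continuous_on (- {pole, Fin 0}) (\<lambda>p. (\<delta> * (1 + T p) - \<beta> * cnj (X p)) / (\<alpha> * cnj (X p) - \<gamma> * (1 + T p)))"
      using e2 by (intro continuous_intros cXT) auto
    then show "continuous_on (- {pole, Fin 0}) coord"
      by (rule continuous_on_eq) (use e2 in auto)
  qed (auto intro!: open_Compl)
  moreover have "- {pole, Infty} \<union> - {pole, Fin 0} = - {pole}" by auto
  ultimately show ?thesis by simp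
qed

lemma range_chart: "range chart = - {pole}"
proof
  show "range chart \<subseteq> - {pole}" using chart_not_pole chart_not_pole[symmetric] by auto
  show "- {pole} \<subseteq> range chart"
  proof
    fix p assume "p \<in> - {pole}"
    then have "p = chart (coord p)" by simp
    then show "p \<in> range chart" by (rule range_eqI)
  qed
qed

lemma open_chart_image: "open U \<Longrightarrow> open (chart ` U)"
proof -
  assume "open U"
  then have "open (coord -` U \<inter> - {pole})"
    using continuous_coord continuous_on_open_vimage[OF open_Compl[OF closed_singleton[of pole]], of coord] by blast
  moreover have "coord -` U \<inter> - {pole} = chart ` U"
  proof
    show "chart ` U \<subseteq> coord -` U \<inter> - {pole}" using chart_not_pole chart_not_pole[symmetric] by auto
    show "coord -` U \<inter> - {pole} \<subseteq> chart ` U"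
    proof
      fix p assume "p \<in> coord -` U \<inter> - {pole}"
      then have "chart (coord p) = p" "coord p \<in> U" by auto
      then show "p \<in> chart ` U" by force
    qed
  qed
  ultimately show ?thesis by simp
qed

lemma open_chart_vimage: "open U \<Longrightarrow> open (chart -` U)"
  using continuous_chart by (rule open_vimage[rotated])

lemma inj_chart: "inj chart"
  by (metis coord_chart injI)

end

lemma chart_with_pole_exists: "\<exists>\<alpha> \<beta> \<gamma> \<delta>. moebius_chart \<alpha> \<beta> \<gamma> \<delta> \<and> p = proj \<alpha> \<gamma>"
proof (cases p)
  case (Fin a)
  then show ?thesis by (intro exI[of _ a] exI[of _ 1] exI[of _ 1] exI[of _ 0]) (auto simp: moebius_chart_def proj_def)
next
  case Infty
  then show ?thesis by (intro exI[of _ 1] exI[of _ 0] exI[of _ 0] exI[of _ 1]) (auto simp: moebius_chart_def proj_def)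
qed

lemma chart_with_pole_and_origin_exists:
  assumes "p \<noteq> q" shows "\<exists>\<alpha> \<beta> \<gamma> \<delta>. moebius_chart \<alpha> \<beta> \<gamma> \<delta> \<and> p = proj \<alpha> \<gamma> \<and> q = proj \<beta> \<delta>"
proof (cases p; cases q)
  fix a b assume "p = Fin a" "q = Fin b"
  then show ?thesis using assms
    by (intro exI[of _ a] exI[of _ b] exI[of _ 1] exI[of _ 1]) (auto simp: moebius_chart_def proj_def)
next
  fix a assume "p = Fin a" "q = Infty"
  then show ?thesis
    by (intro exI[of _ a] exI[of _ 1] exI[of _ 1] exI[of _ 0]) (auto simp: moebius_chart_def proj_def)
next
  fix b assume "p = Infty" "q = Fin b"
  then show ?thesis
    by (intro exI[of _ 1] exI[of _ b] exI[of _ 0] exI[of _ 1]) (auto simp: moebius_chart_def proj_def)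
qed (use assms in auto)

interpretation inf_chart: moebius_chart 0 1 1 0 rewrites "moebius_chart.chart 0 1 1 0 = at_infty" 
proof -
  show "moebius_chart 0 1 1 0" by (simp add: moebius_chart_def)
  then show "moebius_chart.chart 0 1 1 0 = at_infty"
    by (auto simp: moebius_chart.chart_def at_infty_eq_proj)
qed

interpretation fin_chart: moebius_chart 1 0 0 1 rewrites "moebius_chart.chart 1 0 0 1 = Fin" 
proof -
  show "moebius_chart 1 0 0 1" by (simp add: moebius_chart_def)
  then show "moebius_chart.chart 1 0 0 1 = Fin"
    by (auto simp: moebius_chart.chart_def Fin_eq_proj)
qed

lemma compact_sphere: "compact (UNIV :: riemann_sphere set)"
proof -
  have "p \<in> Fin ` cball 0 1 \<union> at_infty ` cball 0 1" for p
  proof (cases p)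
    case (Fin w)
    show ?thesis
    proof (cases "cmod w \<le> 1")
      case False
      then have "p = at_infty (inverse w)" "cmod (inverse w) \<le> 1"
        by (auto simp: Fin at_infty_def norm_inverse intro!: inverse_le_1_iff[THEN iffD2])
      then show ?thesis by (auto intro!: image_eqI[of _ at_infty "inverse w"])
    qed (simp add: Fin)
  next
    case Infty
    then show ?thesis by (intro UnI2 image_eqI[of _ at_infty 0]) (auto simp: at_infty_def)
  qed
  then have "UNIV = Fin ` cball 0 1 \<union> at_infty ` cball 0 1" by blast
  moreover have "compact (Fin ` cball 0 1)" "compact (at_infty ` cball 0 1)"
    by (intro compact_continuous_image inf_chart.continuous_chart fin_chart.continuous_chart compact_cball)+
  ultimately show ?thesis by (metis compact_Un)
qed

lemma closed_imp_compact_sphere: "closed (K :: riemann_sphere set) \<Longrightarrow> compact K"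
  using closed_Int_compact[OF _ compact_sphere] by simp

lemma connected_domain_delete_point:
  assumes op: "open \<Omega>" and con: "connected \<Omega>" shows "connected (\<Omega> - {p :: riemann_sphere})"
proof (cases "p \<in> \<Omega>")
  case True
  obtain p' where "p' \<noteq> p" by (metis riemann_sphere.distinct(1))
  then obtain \<alpha> \<beta> \<gamma> \<delta> where "moebius_chart \<alpha> \<beta> \<gamma> \<delta>" and q: "p' = proj \<alpha> \<gamma>" "p = proj \<beta> \<delta>"
    using chart_with_pole_and_origin_exists by blast
  then interpret moebius_chart \<alpha> \<beta> \<gamma> \<delta> by simp
  have p: "p = chart 0" by (simp add: chart_def q)
  have "open (chart -` \<Omega>)" by (rule open_chart_vimage[OF op])
  moreover have "0 \<in> chart -` \<Omega>" using True p by simp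
  ultimately obtain e where e: "e > 0" "ball 0 e \<subseteq> chart -` \<Omega>" by (meson open_contains_ball)
  define B where "B = chart ` ball 0 e"
  have B: "open B" "p \<in> B" "B \<subseteq> \<Omega>" using e open_chart_image p by (auto simp: B_def)
  have "B - {p} = chart ` (ball 0 e - {0})" using inj_chart by (auto simp: B_def p inj_eq)
  moreover have "connected (ball (0::complex) e - {0})"
    by (rule connected_punctured_ball) simp
  ultimately have cB: "connected (B - {p})"
    using connected_continuous_image[OF continuous_chart] by metis
  show ?thesis
  proof (rule connectedI)
    fix U V assume UV: "open U" "open V" "U \<inter> (\<Omega> - {p}) \<noteq> {}" "V \<inter> (\<Omega> - {p}) \<noteq> {}" "U \<inter> V \<inter> (\<Omega> - {p}) = {}" "\<Omega> - {p} \<subseteq> U \<union> V"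
    have *: False if UV: "open U" "open V" "U \<inter> (\<Omega> - {p}) \<noteq> {}" "V \<inter> (\<Omega> - {p}) \<noteq> {}" "U \<inter> V \<inter> (\<Omega> - {p}) = {}" "\<Omega> - {p} \<subseteq> U \<union> V"
      and BU: "B - {p} \<subseteq> U" for U V
    proof -
      have "open (V - {p})" using UV(2) by (simp add: open_Diff)
      moreover have "open (U \<union> B)" using UV(1) B(1) by (rule open_Un)
      moreover have "(U \<union> B) \<inter> (V - {p}) \<inter> \<Omega> = {}" using BU UV(5) by blast
      moreover have "\<Omega> \<subseteq> (U \<union> B) \<union> (V - {p})" using UV(6) B(2) by blast
      ultimately show False
        using connectedD[OF con, of "U \<union> B" "V - {p}"] UV(3,4) by blast
    qed
    have "U \<inter> (B - {p}) = {} \<or> V \<inter> (B - {p}) = {}"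
      using connectedD[OF cB UV(1,2)] UV(5,6) B(3) by blast
    then have "B - {p} \<subseteq> V \<or> B - {p} \<subseteq> U" using UV(6) B(3) by blast
    then show False using *[OF UV] *[OF UV(2,1,4,3)] UV(5,6) by blast
  qed
qed (use con in simp)

text \<open>By the theorem of Sura-Bura, \<open>C\<close> has a relatively clopen neighbourhood \<open>K\<close> in \<open>X\<close> inside \<open>W\<close>, and an
  open set separates \<open>K\<close> from the rest of \<open>X\<close>. Take \<open>U\<close> to be its component that contains \<open>C\<close>, and let
  \<open>K'\<close> be the compact set \<open>U \<inter> X\<close>. The complement of \<open>K'\<close> is connected, because a clopen part of \<open>X\<close>
  may be added to the connected set \<open>- X\<close>, and \<open>U\<close> is connected; Janiszewski's theorem, applied to \<open>K'\<close>
  and \<open>- U\<close>, makes \<open>U - X\<close> connected.\<close>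

lemma planar_component_neighbourhood:
  fixes X :: "complex set"
  assumes X: "compact X" "connected (- X)" and C: "C \<in> components X" and W: "open W" "C \<subseteq> W"
  obtains U where "open U" "C \<subseteq> U" "U \<subseteq> W" "frontier U \<inter> X = {}" "connected (U - X)" "U - X \<noteq> {}"
proof -
  have clX: "closed X" using X compact_imp_closed by blast
  have "closed C" using closed_components[OF clX C] .
  moreover have "X \<inter> C = C" using in_components_subset[OF C] by blast
  ultimately have cC: "compact C" using compact_Int_closed[OF X(1)] by metis
  obtain K where K: "openin (top_of_set X) K" "compact K" "C \<subseteq> K" "K \<subseteq> W"
    using Sura_Bura_clopen_subset[OF closed_imp_locally_compact[OF clX] C cC W] by blast
  have KX: "K \<subseteq> X" using K(1) openin_imp_subset by blast
  have clK: "closedin (top_of_set X) K" using K(2) KX by (simp add: closed_subset compact_imp_closed)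
  have clXK: "closed (X - K)" 
  proof -
    have "closedin (top_of_set X) (X - K)" using closedin_diff[OF _ K(1), of X] by simp
    then show ?thesis using clX by (rule closedin_closed_trans)
  qed
  obtain V V' where V: "open V" "open V'" "K \<subseteq> V" "(X - K) \<union> - W \<subseteq> V'" "V \<inter> V' = {}"
  proof (rule separation_normal[of K "(X - K) \<union> - W"])
    show "closed K" using K(2) compact_imp_closed by blast
    show "closed (X - K \<union> - W)" using clXK W(1) by (intro closed_Un) auto
    show "K \<inter> (X - K \<union> - W) = {}" using K(4) by blast
  qed blast
  obtain x where x: "x \<in> C" using C in_components_nonempty by blast
  define U where "U = connected_component_set V x"
  have xV: "x \<in> V" using x K(3) V(3) by blast
  have opU: "open U" unfolding U_def using V(1) by (rule open_connected_component)
  have conU: "connected U" unfolding U_def by (rule connected_connected_component)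
  have CU: "C \<subseteq> U" unfolding U_def
    using C K(3) V(3) x by (intro connected_component_maximal) (auto simp: in_components_connected)
  have UV: "U \<subseteq> V" unfolding U_def by (rule connected_component_subset)
  have VX: "V \<inter> X = K" using V K KX by blast
  have frU: "frontier U \<inter> X = {}"
  proof -
    have "frontier U \<inter> V = {}" 
    proof -
      have "closedin (top_of_set V) U" unfolding U_def by (rule closedin_connected_component)
      then obtain T where T: "closed T" "U = V \<inter> T" unfolding closedin_closed by blast
      then have "closure U \<subseteq> T" by (simp add: closure_minimal)
      then have "closure U \<inter> V \<subseteq> U" using T(2) by blast
      then show ?thesis using opU by (auto simp: frontier_def interior_open)
    qed
    moreover have "closure U \<inter> V' = {}" 
      using UV V(5) open_Int_closure_eq_empty[OF V(2), of U] by blast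
    ultimately show ?thesis using VX V(4) by (auto simp: frontier_def)
  qed
  define K' where "K' = K \<inter> U"
  have K'eq: "K' = U \<inter> X" using VX UV by (auto simp: K'_def)
  have K'c: "K' = closure U \<inter> X" 
    using frU opU closure_subset[of U] unfolding K'eq frontier_def by (auto simp: interior_open)
  have compK': "compact K'" unfolding K'c by (rule closed_Int_compact[OF closed_closure X(1)])
  have opK': "openin (top_of_set X) K'" unfolding K'eq using opU openin_open_Int[of U X] by (simp add: Int_commute)
  have clK': "closedin (top_of_set X) K'" unfolding K'c using closedin_closed_Int[of "closure U" X] by (simp add: Int_commute)
  have conK': "connected (- K')"
  proof -
    have "connected (- X \<union> (X - K'))"
    proof (rule connected_Un_clopen_in_complement[of _ UNIV])
      show "openin (top_of_set (UNIV - (- X))) (X - K')" using clK' by (simp add: openin_diff Diff_Compl)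
      show "closedin (top_of_set (UNIV - (- X))) (X - K')" using opK' by (simp add: closedin_diff Diff_Compl)
    qed (use X in auto)
    moreover have "- X \<union> (X - K') = - K'" using K'eq by blast
    ultimately show ?thesis by simp
  qed
  have "connected (- (K' \<union> - U))"
    using compK' opU conK' conU by (intro Janiszewski_connected) (auto simp: K'_def)
  moreover have "- (K' \<union> - U) = U - X" using K'eq by blast
  ultimately have con: "connected (U - X)" by simp
  have ne: "U - X \<noteq> {}"
  proof
    assume "U - X = {}"
    then have "U \<subseteq> C" 
      using components_maximal[OF C conU] CU x by blast
    then have "U = C" using CU by blast
    then have "open C" "closed C" using opU cC compact_imp_closed by blast+
    then have "C = UNIV" using x clopen by blast
    then show False using cC not_compact_UNIV by simp
  qed
  show thesis
    using that opU CU UV V(4,5) frU con ne by blast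
qed

section \<open>Extension of homeomorphisms to the collapsed spheres\<close>

lemma comps_closed: "open \<Omega> \<Longrightarrow> p \<in> comps \<Omega> \<Longrightarrow> closed p"
  unfolding comps_def by (rule closed_components) (auto simp: closed_Compl)

lemma comps_subset: "p \<in> comps \<Omega> \<Longrightarrow> p \<subseteq> - \<Omega>"
  unfolding comps_def by (rule in_components_subset)

lemma comps_nonempty: "p \<in> comps \<Omega> \<Longrightarrow> p \<noteq> {}"
  unfolding comps_def by (rule in_components_nonempty)

lemma comps_eq: "p \<in> comps \<Omega> \<Longrightarrow> q \<in> comps \<Omega> \<Longrightarrow> x \<in> p \<Longrightarrow> x \<in> q \<Longrightarrow> p = q"
  unfolding comps_def by (meson components_nonoverlap disjoint_iff)

text \<open>The planar statement, read in a chart whose pole lies in the domain.\<close>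

lemma comps_component_neighbourhood:
  assumes dom: "sphere_domain \<Omega>" and p: "p \<in> comps \<Omega>" and W: "open W" "p \<subseteq> W"
  obtains U where "open U" "p \<subseteq> U" "U \<subseteq> W" "frontier U \<subseteq> \<Omega>" "connected (U \<inter> \<Omega>)" "U \<inter> \<Omega> \<noteq> {}"
proof -
  have op: "open \<Omega>" and con: "connected \<Omega>" using dom by (auto simp: sphere_domain_def)
  obtain p0 where p0: "p0 \<in> \<Omega>" using dom by (auto simp: sphere_domain_def)
  obtain \<alpha> \<beta> \<gamma> \<delta> where "moebius_chart \<alpha> \<beta> \<gamma> \<delta>" and q: "p0 = proj \<alpha> \<gamma>"
    using chart_with_pole_exists by blast
  then interpret moebius_chart \<alpha> \<beta> \<gamma> \<delta> by simp
  define X where "X = chart -` (- \<Omega>)"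
  have away: "- \<Omega> \<subseteq> - {pole}" using p0 q by auto
  have img: "coord ` A = chart -` A" if "A \<subseteq> - {pole}" for A
  proof
    show "coord ` A \<subseteq> chart -` A"
    proof (rule image_subsetI)
      fix x assume "x \<in> A"
      then have "x \<noteq> pole" using that by blast
      then show "coord x \<in> chart -` A" using \<open>x \<in> A\<close> by simp
    qed
    show "chart -` A \<subseteq> coord ` A"
    proof
      fix z assume "z \<in> chart -` A"
      then show "z \<in> coord ` A" by (intro image_eqI[of _ coord "chart z"]) auto
    qed
  qed
  have "compact (- \<Omega>)" using op by (intro closed_imp_compact_sphere) (simp add: closed_Compl)
  then have X1: "compact X"
    unfolding X_def img[OF away, symmetric]
    by (intro compact_continuous_image continuous_on_subset[OF continuous_coord away])
  have "- X = coord ` (\<Omega> - {pole})" using img[of "\<Omega> - {pole}"] chart_not_pole by (auto simp: X_def)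
  then have X2: "connected (- X)"
    using connected_domain_delete_point[OF op con, of pole]
    by (metis connected_continuous_image continuous_coord continuous_on_subset Diff_subset_conv Un_upper2 Compl_eq_Diff_UNIV Diff_mono subset_UNIV order_refl)
  have pO: "p \<subseteq> - \<Omega>" by (rule comps_subset[OF p])
  define C where "C = chart -` p"
  have Cimg: "C = coord ` p" using img[of p] pO away by (auto simp: C_def)
  have "C \<in> components X"
    unfolding in_components_maximal
  proof (intro conjI allI impI)
    show "C \<noteq> {}" using comps_nonempty[OF p] by (simp add: Cimg)
    show "C \<subseteq> X" using pO by (auto simp: C_def X_def)
    show "connected C" unfolding Cimg
      using p pO away by (intro connected_continuous_image continuous_on_subset[OF continuous_coord])
        (auto simp: comps_def in_components_connected)
    fix D assume D: "D \<noteq> {} \<and> C \<subseteq> D \<and> D \<subseteq> X \<and> connected D"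
    have "chart ` D \<subseteq> p"
    proof (rule components_maximal)
      show "p \<in> components (- \<Omega>)" using p by (simp add: comps_def)
      show "connected (chart ` D)" using D by (intro connected_continuous_image continuous_chart) auto
      show "chart ` D \<subseteq> - \<Omega>" using D by (auto simp: X_def)
      obtain z where "z \<in> C" using \<open>C \<noteq> {}\<close> by blast
      then show "p \<inter> chart ` D \<noteq> {}" using D by (auto simp: C_def)
    qed
    then show "D = C" using D by (auto simp: C_def)
  qed
  moreover have "C \<subseteq> chart -` W" using W(2) by (auto simp: C_def)
  ultimately obtain U where U: "open U" "C \<subseteq> U" "U \<subseteq> chart -` W" "frontier U \<inter> X = {}" "connected (U - X)" "U - X \<noteq> {}"
    using planar_component_neighbourhood[OF X1 X2 _ open_chart_vimage[OF W(1)]] by metis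
  have "p \<subseteq> chart ` U"
  proof
    fix x assume "x \<in> p"
    then have "x \<noteq> pole" using pO away by blast
    then have "x = chart (coord x)" by simp
    moreover have "coord x \<in> C" using \<open>x \<in> p\<close> Cimg by simp
    ultimately show "x \<in> chart ` U" using U(2) by blast
  qed
  moreover have "chart ` U \<inter> \<Omega> = chart ` (U - X)" by (auto simp: X_def)
  moreover have "connected (chart ` (U - X))"
    by (rule connected_continuous_image[OF continuous_chart U(5)])
  moreover have "frontier (chart ` U) \<subseteq> \<Omega>"
  proof
    fix y assume y: "y \<in> frontier (chart ` U)"
    show "y \<in> \<Omega>"
    proof (cases "y = pole")
      case False
      define z where "z = coord y"
      have yz: "y = chart z" using False by (simp add: z_def)
      have opU: "open (chart ` U)" by (rule open_chart_image[OF U(1)])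
      have "z \<in> closure U"
      proof (rule ccontr)
        assume "z \<notin> closure U"
        then have "y \<in> chart ` (- closure U)" by (simp add: yz)
        moreover have "open (chart ` (- closure U))" by (intro open_chart_image) auto
        moreover have "chart ` (- closure U) \<inter> chart ` U = {}"
          using closure_subset[of U] by (auto dest!: injD[OF inj_chart])
        ultimately show False using y open_Int_closure_eq_empty[of "chart ` (- closure U)" "chart ` U"]
          by (auto simp: frontier_def)
      qed
      moreover have "z \<notin> U" using y opU by (auto simp: frontier_def interior_open yz)
      ultimately have "z \<in> frontier U" using U(1) by (simp add: frontier_def interior_open)
      then show ?thesis using U(4) by (auto simp: X_def yz)
    qed (use p0 q in simp)
  qed
  ultimately show thesis
    using that[of "chart ` U"] open_chart_image[OF U(1)] U(3,6) by auto
qed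

text \<open>An open set whose frontier lies in the domain is a union of fibres of \<open>collapse\<close>.\<close>

lemma saturated_of_frontier:
  assumes "p \<in> comps \<Omega>" "frontier U \<subseteq> \<Omega>" "p \<inter> U \<noteq> {}" shows "p \<subseteq> U"
proof (rule ccontr)
  assume "\<not> p \<subseteq> U"
  then have "p \<inter> frontier U \<noteq> {}"
    using assms by (intro connected_Int_frontier) (auto simp: comps_def in_components_connected)
  then show False using comps_subset[OF assms(1)] assms(2) by blast
qed

lemma collapse_comps: "p \<in> comps \<Omega> \<Longrightarrow> x \<in> p \<Longrightarrow> collapse \<Omega> x = p"
  using comps_subset[of p \<Omega>] connected_component_eq[of x] 
  by (auto simp: collapse_def comps_def components_def subset_iff dest: connected_component_eq)

lemma collapse_in_comps: "x \<notin> \<Omega> \<Longrightarrow> collapse \<Omega> x \<in> comps \<Omega>"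
  by (auto simp: collapse_def comps_def intro: componentsI)

lemma collapse_self: "x \<in> collapse \<Omega> x"
  by (simp add: collapse_def)

lemma comps_separate:
  assumes "open \<Omega>" "p \<in> comps \<Omega>" "q \<in> comps \<Omega>" "p \<noteq> q"
  obtains U V where "open U" "open V" "p \<subseteq> U" "q \<subseteq> V" "U \<inter> V = {}"
proof -
  have dis: "p \<inter> q = {}" using assms comps_eq by blast
  have cl: "closed p" "closed q" "p \<noteq> {}" "q \<noteq> {}"
    using assms comps_closed comps_nonempty by blast+
  define U V where "U = {x. infdist x p < infdist x q}" and "V = {x. infdist x q < infdist x p}"
  have "open U" "open V" unfolding U_def V_def by (auto intro!: open_Collect_less continuous_intros)
  moreover have "U \<inter> V = {}" by (auto simp: U_def V_def)
  moreover have "x \<in> U" if "x \<in> p" for x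
  proof -
    have "x \<notin> q" using dis that by blast
    then have "infdist x q > 0" using cl by (simp add: infdist_pos_not_in_closed)
    then show ?thesis using that by (simp add: U_def)
  qed
  moreover have "x \<in> V" if "x \<in> q" for x
  proof -
    have "x \<notin> p" using dis that by blast
    then have "infdist x p > 0" using cl by (simp add: infdist_pos_not_in_closed)
    then show ?thesis using that by (simp add: V_def)
  qed
  ultimately show thesis using that by blast
qed

text \<open>The component \<open>q\<close> contains all cluster values of \<open>f\<close> at \<open>p\<close>.\<close>

definition cluster_to ::
  "riemann_sphere set \<Rightarrow> (riemann_sphere \<Rightarrow> riemann_sphere) \<Rightarrow> riemann_sphere set \<Rightarrow> riemann_sphere set \<Rightarrow> bool" where
  "cluster_to \<Omega> f p q \<longleftrightarrow> (\<forall>W. open W \<longrightarrow> q \<subseteq> W \<longrightarrow> (\<exists>U. open U \<and> p \<subseteq> U \<and> f ` (U \<inter> \<Omega>) \<subseteq> W))"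

lemma cluster_toE:
  assumes "cluster_to \<Omega> f p q" "open W" "q \<subseteq> W"
  obtains U where "open U" "p \<subseteq> U" "f ` (U \<inter> \<Omega>) \<subseteq> W"
  using assms unfolding cluster_to_def by metis

lemma shrinking_neighbourhoods_limit:
  fixes p :: "riemann_sphere set"
  assumes "closed p" "p \<noteq> {}" and "\<And>n. infdist (x n) p < inverse (real (Suc n))" and "(x \<circ> r) \<longlonglongrightarrow> l" "strict_mono (r :: nat \<Rightarrow> nat)"
  shows "l \<in> p"
proof -
  have "(\<lambda>n. infdist (x n) p) \<longlonglongrightarrow> 0"
    by (rule tendsto_sandwich[OF _ _ tendsto_const LIMSEQ_inverse_real_of_nat])
       (auto simp: infdist_nonneg intro!: always_eventually less_imp_le assms(3) simp del: of_nat_Suc)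
  then have "((\<lambda>n. infdist (x n) p) \<circ> r) \<longlonglongrightarrow> 0" using assms(5) LIMSEQ_subseq_LIMSEQ by blast
  moreover have "(\<lambda>n. infdist ((x \<circ> r) n) p) \<longlonglongrightarrow> infdist l p" by (intro tendsto_infdist assms(4))
  ultimately have "infdist l p = 0" using LIMSEQ_unique by (auto simp: o_def)
  then show ?thesis using assms(1,2) in_closed_iff_infdist_zero by blast
qed

text \<open>Choose neighbourhoods \<open>U n\<close> of \<open>p\<close> that shrink to \<open>p\<close> and meet the domain in connected sets, and let
  \<open>q\<close> be the component that contains one cluster value. If the images of the \<open>U n\<close> did not eventually
  enter a given neighbourhood of \<open>q\<close>, they would, being connected, cross the frontier of a smaller
  neighbourhood with frontier in the target domain. Points of crossing accumulate at a point of the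
  target domain, hence their preimages accumulate at a point of the domain; but they tend to \<open>p\<close>.\<close>

lemma cluster_to_exists:
  assumes O: "sphere_domain \<Omega>" and D: "sphere_domain D" and hom: "homeomorphism \<Omega> D f g"
    and p: "p \<in> comps \<Omega>"
  shows "\<exists>q\<in>comps D. cluster_to \<Omega> f p q"
proof -
  have opO: "open \<Omega>" and opD: "open D" using O D by (auto simp: sphere_domain_def)
  have clp: "closed p" "p \<noteq> {}" using comps_closed[OF opO p] comps_nonempty[OF p] by auto
  have pO: "p \<inter> \<Omega> = {}" using comps_subset[OF p] by blast
  have compsph: "\<exists>l r. strict_mono (r :: nat \<Rightarrow> nat) \<and> (y \<circ> r) \<longlonglongrightarrow> l" for y :: "nat \<Rightarrow> riemann_sphere"
    using compact_sphere unfolding compact_def by blast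
  define N where "N n = {x. infdist x p < inverse (real (Suc n))}" for n
  have N: "open (N n)" "p \<subseteq> N n" for n
    unfolding N_def by (auto intro!: open_Collect_less continuous_intros)
  have "\<exists>U. open U \<and> p \<subseteq> U \<and> U \<subseteq> N n \<and> connected (U \<inter> \<Omega>) \<and> U \<inter> \<Omega> \<noteq> {}" for n
    using comps_component_neighbourhood[OF O p N(1)[of n] N(2)] by metis
  then obtain U where U: "\<And>n. open (U n)" "\<And>n. p \<subseteq> U n" "\<And>n. U n \<subseteq> N n" "\<And>n. connected (U n \<inter> \<Omega>)" "\<And>n. U n \<inter> \<Omega> \<noteq> {}"
    by metis
  have fD: "f x \<in> D" if "x \<in> \<Omega>" for x using hom that by (auto simp: homeomorphism_def)
  have nolim: "w \<notin> D" if z: "\<And>n. z n \<in> U n \<inter> \<Omega>" and r: "strict_mono (r :: nat \<Rightarrow> nat)" "((f \<circ> z) \<circ> r) \<longlonglongrightarrow> w" for z r w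
  proof
    assume w: "w \<in> D"
    have "continuous_on D g" using hom by (simp add: homeomorphism_def)
    moreover have fz: "f (z n) \<in> D" for n using z[of n] fD by blast
    ultimately have "((\<lambda>n. g (((f \<circ> z) \<circ> r) n)) \<longlongrightarrow> g w) sequentially"
      by (intro continuous_on_tendsto_compose[OF _ r(2) w] always_eventually allI) simp_all
    moreover have "g (f (z n)) = z n" for n using z[of n] homeomorphism_apply1[OF hom] by blast
    ultimately have "(z \<circ> r) \<longlonglongrightarrow> g w" by (simp add: o_def)
    moreover have "infdist (z n) p < inverse (real (Suc n))" for n using z[of n] U(3)[of n] by (auto simp: N_def)
    ultimately have "g w \<in> p" using shrinking_neighbourhoods_limit[OF clp] r(1) by blast
    moreover have "g w \<in> \<Omega>" using w homeomorphism_image2[OF hom] by blast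
    ultimately show False using pO by blast
  qed
  have "\<forall>n. \<exists>x. x \<in> U n \<inter> \<Omega>" using U(5) by blast
  then obtain x where x: "\<And>n. x n \<in> U n \<inter> \<Omega>" by metis
  obtain y r where r: "strict_mono (r :: nat \<Rightarrow> nat)" and y: "((f \<circ> x) \<circ> r) \<longlonglongrightarrow> y" using compsph by blast
  have yD: "y \<notin> D" using nolim[OF x r y] .
  define q where "q = collapse D y"
  have q: "q \<in> comps D" "y \<in> q" using yD by (auto simp: q_def collapse_in_comps collapse_self)
  have "cluster_to \<Omega> f p q"
    unfolding cluster_to_def
  proof (intro allI impI, rule ccontr)
    fix W assume W: "open W" "q \<subseteq> W" and neg: "\<nexists>U. open U \<and> p \<subseteq> U \<and> f ` (U \<inter> \<Omega>) \<subseteq> W"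
    obtain U' where U': "open U'" "q \<subseteq> U'" "U' \<subseteq> W" "frontier U' \<subseteq> D"
      using comps_component_neighbourhood[OF D q(1) W] by metis
    have "\<exists>z\<in>U n \<inter> \<Omega>. f z \<in> frontier U'" for n
    proof -
      have "\<forall>\<^sub>F m in sequentially. ((f \<circ> x) \<circ> r) m \<in> U'"
        using y U' q(2) by (auto simp: tendsto_def)
      moreover have "\<forall>\<^sub>F m in sequentially. (x \<circ> r) m \<in> U n"
      proof (rule ccontr)
        assume "\<not> (\<forall>\<^sub>F m in sequentially. (x \<circ> r) m \<in> U n)"
        then have "\<exists>\<^sub>F m in sequentially. (x \<circ> r) m \<notin> U n" by (simp add: not_eventually)
        then have "infinite {m. (x \<circ> r) m \<notin> U n}" by (simp add: frequently_sequentially infinite_nat_iff_unbounded_le)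
        then obtain k where k: "strict_mono (k :: nat \<Rightarrow> nat)" "\<And>m. (x \<circ> r) (k m) \<notin> U n"
          using infinite_enumerate by blast
        obtain l k' where k': "strict_mono (k' :: nat \<Rightarrow> nat)" "((x \<circ> r \<circ> k) \<circ> k') \<longlonglongrightarrow> l" using compsph by blast
        have "infdist (x n) p < inverse (real (Suc n))" for n using x[of n] U(3)[of n] by (auto simp: N_def)
        moreover have "strict_mono (r \<circ> (k \<circ> k'))" using r k(1) k'(1) by (simp add: strict_mono_o)
        moreover have "(x \<circ> (r \<circ> (k \<circ> k'))) \<longlonglongrightarrow> l" using k'(2) by (simp add: o_assoc)
        ultimately have "l \<in> p" using shrinking_neighbourhoods_limit[OF clp] by blast
        then have "l \<in> U n" using U(2) by blast
        moreover have "l \<in> - U n"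
          by (rule closed_sequentially[OF _ _ k'(2)]) (use U(1) k(2) in \<open>auto simp: closed_Compl\<close>)
        ultimately show False by blast
      qed
      ultimately have "\<forall>\<^sub>F m in sequentially. ((f \<circ> x) \<circ> r) m \<in> U' \<and> (x \<circ> r) m \<in> U n" by (rule eventually_conj)
      then obtain m where m: "f (x (r m)) \<in> U'" "x (r m) \<in> U n" by (auto simp: eventually_sequentially)
      have "f ` (U n \<inter> \<Omega>) \<inter> U' \<noteq> {}" using m x[of "r m"] by blast
      moreover have "\<not> f ` (U n \<inter> \<Omega>) \<subseteq> W" using neg U(1,2) by blast
      moreover have "connected (f ` (U n \<inter> \<Omega>))"
        using hom U(4) by (intro connected_continuous_image) (auto simp: homeomorphism_def intro: continuous_on_subset)
      ultimately have "f ` (U n \<inter> \<Omega>) \<inter> frontier U' \<noteq> {}" using U'(3) by (intro connected_Int_frontier) auto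
      then show ?thesis by blast
    qed
    then obtain z where z: "\<And>n. z n \<in> U n \<inter> \<Omega>" "\<And>n. f (z n) \<in> frontier U'" by metis
    obtain w k where k: "strict_mono (k :: nat \<Rightarrow> nat)" and w: "((f \<circ> z) \<circ> k) \<longlonglongrightarrow> w" using compsph by blast
    have "w \<in> frontier U'" by (rule closed_sequentially[OF frontier_closed _ w]) (use z in auto)
    then show False using nolim[OF z(1) k w] U'(4) by blast
  qed
  then show ?thesis using q(1) by blast
qed

lemma neighbourhood_meets_domain:
  assumes "sphere_domain \<Omega>" "p \<in> comps \<Omega>" "open U" "p \<subseteq> U" shows "U \<inter> \<Omega> \<noteq> {}"
  by (rule comps_component_neighbourhood[OF assms]) blast

lemma cluster_to_unique:
  assumes O: "sphere_domain \<Omega>" and D: "open D" and p: "p \<in> comps \<Omega>"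
    and q: "q \<in> comps D" "q' \<in> comps D" "cluster_to \<Omega> f p q" "cluster_to \<Omega> f p q'"
  shows "q = q'"
proof (rule ccontr)
  assume "q \<noteq> q'"
  then obtain W W' where W: "open W" "open W'" "q \<subseteq> W" "q' \<subseteq> W'" "W \<inter> W' = {}"
    by (rule comps_separate[OF D q(1,2)])
  obtain U where U: "open U" "p \<subseteq> U" "f ` (U \<inter> \<Omega>) \<subseteq> W" by (rule cluster_toE[OF q(3) W(1,3)])
  obtain U' where U': "open U'" "p \<subseteq> U'" "f ` (U' \<inter> \<Omega>) \<subseteq> W'" by (rule cluster_toE[OF q(4) W(2,4)])
  have "(U \<inter> U') \<inter> \<Omega> \<noteq> {}" by (rule neighbourhood_meets_domain[OF O p]) (use U U' in auto)
  then show False using U(3) U'(3) W(5) by blast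
qed

text \<open>Otherwise the inverse would lead from \<open>q\<close> to another component, and neighbourhoods of the two
  components would share points of the domain.\<close>

lemma cluster_to_inverse:
  assumes O: "sphere_domain \<Omega>" and D: "sphere_domain D" and hom: "homeomorphism \<Omega> D f g"
    and p: "p \<in> comps \<Omega>" and q: "q \<in> comps D" and pq: "cluster_to \<Omega> f p q"
  shows "cluster_to D g q p"
proof -
  have opO: "open \<Omega>" using O by (simp add: sphere_domain_def)
  obtain p' where p': "p' \<in> comps \<Omega>" "cluster_to D g q p'"
    using cluster_to_exists[OF D O _ q] hom homeomorphism_symD by blast
  have "p' = p"
  proof (rule ccontr)
    assume "p' \<noteq> p"
    then obtain A B where A: "open A" "open B" "p' \<subseteq> A" "p \<subseteq> B" "A \<inter> B = {}"
      by (rule comps_separate[OF opO p'(1) p])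
    obtain V where V: "open V" "q \<subseteq> V" "g ` (V \<inter> D) \<subseteq> A" by (rule cluster_toE[OF p'(2) A(1,3)])
    obtain U where U: "open U" "p \<subseteq> U" "f ` (U \<inter> \<Omega>) \<subseteq> V" by (rule cluster_toE[OF pq V(1,2)])
    have "(U \<inter> B) \<inter> \<Omega> \<noteq> {}" by (rule neighbourhood_meets_domain[OF O p]) (use U A in auto)
    then obtain x where x: "x \<in> U" "x \<in> B" "x \<in> \<Omega>" by blast
    then have "f x \<in> V \<inter> D" "g (f x) = x" using U(3) hom by (auto simp: homeomorphism_def)
    then have "x \<in> A" using V(3) by (metis image_subset_iff)
    then show False using x A(5) by blast
  qed
  then show ?thesis using p'(2) by simp
qed

text \<open>The extension of a homeomorphism; off the complementary components its arguments are the singletons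
  of points of the domain.\<close>

definition end_map ::
  "riemann_sphere set \<Rightarrow> riemann_sphere set \<Rightarrow> (riemann_sphere \<Rightarrow> riemann_sphere) \<Rightarrow> riemann_sphere set \<Rightarrow> riemann_sphere set" where
  "end_map \<Omega> D f P = (if P \<in> comps \<Omega> then THE q. q \<in> comps D \<and> cluster_to \<Omega> f P q else f ` P)"

lemma singleton_not_comps: "x \<in> \<Omega> \<Longrightarrow> {x} \<notin> comps \<Omega>"
  using comps_subset[of "{x}" \<Omega>] by auto

lemma end_map_singleton: "x \<in> \<Omega> \<Longrightarrow> end_map \<Omega> D f {x} = {f x}"
  by (simp add: end_map_def singleton_not_comps)

lemma end_map_comps:
  assumes O: "sphere_domain \<Omega>" and D: "sphere_domain D" and hom: "homeomorphism \<Omega> D f g"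
    and p: "p \<in> comps \<Omega>"
  shows "end_map \<Omega> D f p \<in> comps D" "cluster_to \<Omega> f p (end_map \<Omega> D f p)"
proof -
  have opD: "open D" using D by (simp add: sphere_domain_def)
  have "\<exists>!q. q \<in> comps D \<and> cluster_to \<Omega> f p q"
    using cluster_to_exists[OF O D hom p] cluster_to_unique[OF O opD p] by blast
  from theI'[OF this] show "end_map \<Omega> D f p \<in> comps D" "cluster_to \<Omega> f p (end_map \<Omega> D f p)"
    using p by (auto simp: end_map_def)
qed

lemma end_map_eqI:
  assumes O: "sphere_domain \<Omega>" and D: "sphere_domain D" and hom: "homeomorphism \<Omega> D f g"
    and p: "p \<in> comps \<Omega>" and "q \<in> comps D" "cluster_to \<Omega> f p q"
  shows "end_map \<Omega> D f p = q"
  using cluster_to_unique[OF O _ p end_map_comps(1)[OF O D hom p] assms(5) end_map_comps(2)[OF O D hom p] assms(6)] D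
  by (simp add: sphere_domain_def)

text \<open>Continuity at a component \<open>p\<close> needs control of the components \<open>p'\<close> near \<open>p\<close>. A saturated neighbourhood
  of \<open>p\<close> contains \<open>p'\<close> entirely, so the image of \<open>p'\<close> meets a saturated neighbourhood of the image of
  \<open>p\<close>, and therefore lies in it.\<close>

lemma continuous_end_map:
  assumes O: "sphere_domain \<Omega>" and D: "sphere_domain D" and hom: "homeomorphism \<Omega> D f g"
  shows "continuous_map (hat_space \<Omega>) (hat_space D) (end_map \<Omega> D f)"
proof -
  let ?F = "end_map \<Omega> D f"
  have opO: "open \<Omega>" and opD: "open D" using O D by (auto simp: sphere_domain_def)
  have "continuous_map euclidean (hat_space D) (?F \<circ> collapse \<Omega>)"
    unfolding continuous_map
  proof (intro conjI allI impI)
    show "(?F \<circ> collapse \<Omega>) ` topspace euclidean \<subseteq> topspace (hat_space D)"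
    proof (clarsimp simp: topspace_hat_space)
      fix x assume "?F (collapse \<Omega> x) \<notin> comps D"
      then have "x \<in> \<Omega>" using collapse_in_comps end_map_comps(1)[OF O D hom] by blast
      then show "?F (collapse \<Omega> x) \<in> (\<lambda>x. {x}) ` D"
        using hom by (auto simp: collapse_def end_map_singleton homeomorphism_def)
    qed
    fix U' assume "openin (hat_space D) U'"
    define W where "W = collapse D -` U'"
    have W: "open W" "U' \<subseteq> range (collapse D)" using \<open>openin (hat_space D) U'\<close> by (auto simp: openin_hat_space W_def)
    have Wq: "q \<in> U' \<longleftrightarrow> q \<subseteq> W" if "q \<in> comps D" for q
      using that comps_nonempty[OF that] collapse_comps[OF that] by (auto simp: W_def)
    have "\<exists>T. open T \<and> x \<in> T \<and> T \<subseteq> {x. ?F (collapse \<Omega> x) \<in> U'}" if x: "?F (collapse \<Omega> x) \<in> U'" for x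
    proof (cases "x \<in> \<Omega>")
      case True
      have "open (f -` W \<inter> \<Omega>)"
        using hom W(1) opO by (metis continuous_on_open_vimage homeomorphism_def)
      moreover have inD: "f y \<in> D" if "y \<in> \<Omega>" for y using hom that by (auto simp: homeomorphism_def)
      moreover have "f -` W \<inter> \<Omega> = {x \<in> \<Omega>. ?F (collapse \<Omega> x) \<in> U'}"
        using inD by (auto simp: collapse_def end_map_singleton W_def)
      ultimately show ?thesis using True x by (intro exI[of _ "f -` W \<inter> \<Omega>"]) auto
    next
      case False
      define p where "p = collapse \<Omega> x"
      have p: "p \<in> comps \<Omega>" "x \<in> p" using False by (auto simp: p_def collapse_in_comps collapse_self)
      define q where "q = ?F p"
      have q: "q \<in> comps D" "cluster_to \<Omega> f p q" using end_map_comps[OF O D hom p(1)] by (auto simp: q_def)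
      have qW: "q \<subseteq> W" using x Wq[OF q(1)] by (simp add: q_def p_def)
      obtain V where V: "open V" "q \<subseteq> V" "V \<subseteq> W" "frontier V \<subseteq> D"
        using comps_component_neighbourhood[OF D q(1) W(1) qW] by metis
      obtain T where T: "open T" "p \<subseteq> T" "f ` (T \<inter> \<Omega>) \<subseteq> V" by (rule cluster_toE[OF q(2) V(1,2)])
      obtain T' where T': "open T'" "p \<subseteq> T'" "T' \<subseteq> T" "frontier T' \<subseteq> \<Omega>"
        using comps_component_neighbourhood[OF O p(1) T(1,2)] by metis
      have "?F (collapse \<Omega> y) \<in> U'" if y: "y \<in> T'" for y
      proof (cases "y \<in> \<Omega>")
        case True
        then have "f y \<in> W" using T(3) T'(3) V(3) y by blast
        then show ?thesis using True hom by (auto simp: collapse_def end_map_singleton W_def homeomorphism_def)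
      next
        case False
        define p' where "p' = collapse \<Omega> y"
        have p': "p' \<in> comps \<Omega>" "y \<in> p'" using False by (auto simp: p'_def collapse_in_comps collapse_self)
        have p'T: "p' \<subseteq> T'" using saturated_of_frontier[OF p'(1) T'(4)] p'(2) y by blast
        define q' where "q' = ?F p'"
        have q': "q' \<in> comps D" "cluster_to \<Omega> f p' q'" using end_map_comps[OF O D hom p'(1)] by (auto simp: q'_def)
        have "q' \<inter> V \<noteq> {}"
        proof
          assume "q' \<inter> V = {}"
          moreover have "q' \<inter> frontier V = {}" using comps_subset[OF q'(1)] V(4) by blast
          ultimately have "q' \<subseteq> - closure V" using V(1) by (auto simp: frontier_def interior_open)
          then obtain S where S: "open S" "p' \<subseteq> S" "f ` (S \<inter> \<Omega>) \<subseteq> - closure V"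
            using cluster_toE[OF q'(2) open_Compl[OF closed_closure]] by metis
          have "(S \<inter> T') \<inter> \<Omega> \<noteq> {}" by (rule neighbourhood_meets_domain[OF O p'(1)]) (use S T' p'T in auto)
          then show False using S(3) T(3) T'(3) closure_subset[of V] by blast
        qed
        then have "q' \<subseteq> W" using saturated_of_frontier[OF q'(1) V(4)] V(3) by blast
        then show ?thesis using Wq[OF q'(1)] by (simp add: q'_def p'_def)
      qed
      then show ?thesis using T'(1,2) p(2) by (intro exI[of _ T']) auto
    qed
    then have "open {x. ?F (collapse \<Omega> x) \<in> U'}"
      by (subst open_subopen) blast
    then show "openin euclidean {x \<in> topspace euclidean. (?F \<circ> collapse \<Omega>) x \<in> U'}" by simp
  qed
  then show ?thesis using continuous_compose_quotient_map[OF quotient_map_collapse] by blast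
qed

lemma hat_extension_exists:
  assumes O: "sphere_domain \<Omega>" and D: "sphere_domain D" and hom: "homeomorphism \<Omega> D f g"
  shows "\<exists>F. hat_extension \<Omega> D f F"
proof -
  have hom': "homeomorphism D \<Omega> g f" using hom by (rule homeomorphism_symD)
  have inv: "end_map D' \<Omega>' g' (end_map \<Omega>' D' f' P) = P"
    if O': "sphere_domain \<Omega>'" and D': "sphere_domain D'" and h: "homeomorphism \<Omega>' D' f' g'" and P: "P \<in> topspace (hat_space \<Omega>')"
    for \<Omega>' D' f' g' P
  proof (cases "P \<in> comps \<Omega>'")
    case True
    note E = end_map_comps[OF O' D' h True]
    show ?thesis
      by (rule end_map_eqI[OF D' O' homeomorphism_symD[OF h] E(1) True cluster_to_inverse[OF O' D' h True E]])
  next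
    case False
    then obtain x where "P = {x}" "x \<in> \<Omega>'" using P by (auto simp: topspace_hat_space)
    then show ?thesis using h by (auto simp: end_map_singleton homeomorphism_def)
  qed
  have "homeomorphic_maps (hat_space \<Omega>) (hat_space D) (end_map \<Omega> D f) (end_map D \<Omega> g)"
    unfolding homeomorphic_maps_def
    using continuous_end_map[OF O D hom] continuous_end_map[OF D O hom'] inv[OF O D hom] inv[OF D O hom'] by blast
  then have "homeomorphic_map (hat_space \<Omega>) (hat_space D) (end_map \<Omega> D f)"
    using homeomorphic_map_maps by blast
  moreover have "\<forall>x\<in>\<Omega>. end_map \<Omega> D f {x} = {f x}" by (intro ballI end_map_singleton)
  ultimately show ?thesis unfolding hat_extension_def by (intro exI conjI)
qed

lemma hat_extension_bij:
  assumes "hat_extension \<Omega> D f F"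
  shows "bij_betw F (topspace (hat_space \<Omega>)) (topspace (hat_space D))"
proof -
  have h: "homeomorphic_map (hat_space \<Omega>) (hat_space D) F" using assms by (simp add: hat_extension_def)
  show ?thesis unfolding bij_betw_def
    using homeomorphic_imp_injective_map[OF h] homeomorphic_imp_surjective_map[OF h] by blast
qed

lemma hat_extension_comps:
  assumes O: "open \<Omega>" and hom: "homeomorphism \<Omega> D f g" and F: "hat_extension \<Omega> D f F" and p: "p \<in> comps \<Omega>"
  shows "F p \<in> comps D"
proof -
  have ptop: "p \<in> topspace (hat_space \<Omega>)" using p by (simp add: topspace_hat_space)
  have bij: "bij_betw F (topspace (hat_space \<Omega>)) (topspace (hat_space D))" by (rule hat_extension_bij[OF F])
  then have "F p \<in> topspace (hat_space D)" using ptop by (auto simp: bij_betw_def)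
  then consider "F p \<in> comps D" | y where "y \<in> D" "F p = {y}" by (auto simp: topspace_hat_space)
  then show ?thesis
  proof cases
    case 2
    then obtain x where x: "x \<in> \<Omega>" "y = f x" using hom by (auto simp: homeomorphism_def)
    then have "F {x} = F p" using F 2 by (simp add: hat_extension_def)
    moreover have "{x} \<in> topspace (hat_space \<Omega>)" using x by (simp add: topspace_hat_space)
    ultimately have "{x} = p" using bij ptop by (auto simp: bij_betw_def dest: inj_onD)
    then show ?thesis using p x singleton_not_comps by blast
  qed simp
qed

lemma hat_extension_inj:
  assumes F: "hat_extension \<Omega> D f F" and p: "p \<in> comps \<Omega>" "q \<in> comps \<Omega>" "F p = F q"
  shows "p = q"
proof -
  have "inj_on F (topspace (hat_space \<Omega>))"
    using hat_extension_bij[OF F] by (simp add: bij_betw_def)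
  then show ?thesis using p by (auto simp: topspace_hat_space dest: inj_onD)
qed

text \<open>Any extension, not just \<open>end_map\<close>, is continuous as a map of sets: the saturated neighbourhoods form
  a neighbourhood base at every complementary component of the target.\<close>

lemma hat_extension_continuous:
  assumes D: "sphere_domain D" and F: "hat_extension \<Omega> D f F"
    and p: "x \<in> p" "p \<in> comps \<Omega>" "F p \<in> comps D" and W: "open W" "F p \<subseteq> W"
  obtains T where "open T" "x \<in> T" "\<And>y. y \<in> T \<Longrightarrow> F (collapse \<Omega> y) \<subseteq> W"
proof -
  obtain V where V: "open V" "F p \<subseteq> V" "V \<subseteq> W" "frontier V \<subseteq> D"
    using comps_component_neighbourhood[OF D p(3) W] by metis
  have sat: "collapse D y \<subseteq> V" if "y \<in> V" for y
  proof (cases "y \<in> D")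
    case False
    then show ?thesis
      using saturated_of_frontier[OF collapse_in_comps[OF False] V(4)] that collapse_self by blast
  qed (use that in \<open>simp add: collapse_def\<close>)
  have "collapse D -` (collapse D ` V) = V"
    using sat collapse_self by fastforce
  then have op: "openin (hat_space D) (collapse D ` V)" using V(1) by (auto simp: openin_hat_space)
  have "continuous_map (hat_space \<Omega>) (hat_space D) F"
    using F homeomorphic_imp_continuous_map unfolding hat_extension_def by blast
  then have "continuous_map euclidean (hat_space D) (F \<circ> collapse \<Omega>)"
    by (rule continuous_map_compose[OF quotient_imp_continuous_map[OF quotient_map_collapse]])
  then have "openin euclidean {y \<in> topspace euclidean. (F \<circ> collapse \<Omega>) y \<in> collapse D ` V}"
    using op by (rule openin_continuous_map_preimage)
  then have op2: "open {y. F (collapse \<Omega> y) \<in> collapse D ` V}" by simp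
  show thesis
  proof (rule that[OF op2])
    obtain z where "z \<in> F p" using comps_nonempty[OF p(3)] by blast
    then have "F p = collapse D z" "z \<in> V" using collapse_comps[OF p(3)] V(2) by auto
    then show "x \<in> {y. F (collapse \<Omega> y) \<in> collapse D ` V}" using collapse_comps[OF p(2,1)] by auto
    show "F (collapse \<Omega> y) \<subseteq> W" if "y \<in> {y. F (collapse \<Omega> y) \<in> collapse D ` V}" for y
      using that sat V(3) by blast
  qed
qed

section \<open>Complementary disks in a chart\<close>

text \<open>Complete the square.\<close>

lemma hermitian_disk:
  fixes L :: complex and A C :: real
  assumes A: "A > 0" and ne: "{z. A * (cmod z)\<^sup>2 \<le> 2 * Re (L * z) + C} \<noteq> {}"
  shows "\<exists>c r. 0 \<le> r \<and> {z. A * (cmod z)\<^sup>2 \<le> 2 * Re (L * z) + C} = cball c r"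
proof -
  define c where "c = cnj L / of_real A"
  define R where "R = (cmod c)\<^sup>2 + C / A"
  have iff: "A * (cmod z)\<^sup>2 \<le> 2 * Re (L * z) + C \<longleftrightarrow> (cmod (c - z))\<^sup>2 \<le> R" for z
  proof -
    have "L = of_real A * cnj c" using A by (simp add: c_def)
    then have "Re (L * z) = A * (Re c * Re z + Im c * Im z)" by (simp add: algebra_simps)
    moreover have "(cmod (c - z))\<^sup>2 = (cmod c)\<^sup>2 + (cmod z)\<^sup>2 - 2 * (Re c * Re z + Im c * Im z)"
      unfolding cmod_power2 by (simp add: power2_eq_square algebra_simps)
    moreover have "A * (cmod z)\<^sup>2 \<le> 2 * (A * (Re c * Re z + Im c * Im z)) + C \<longleftrightarrow>
        (cmod z)\<^sup>2 \<le> 2 * (Re c * Re z + Im c * Im z) + C / A"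
      using A by (simp add: field_simps)
    ultimately show ?thesis unfolding R_def by auto
  qed
  obtain z0 where "(cmod (c - z0))\<^sup>2 \<le> R" using ne iff by auto
  then have R: "R \<ge> 0" using zero_le_power2 order_trans by blast
  have m: "(cmod (c - z))\<^sup>2 \<le> R \<longleftrightarrow> z \<in> cball c (sqrt R)" for z
    using R real_le_rsqrt[of "cmod (c - z)" R] by (auto simp: dist_norm real_le_rsqrt sqrt_ge_absD)
  then have "{z. A * (cmod z)\<^sup>2 \<le> 2 * Re (L * z) + C} = cball c (sqrt R)"
    by (simp only: iff m Collect_mem_eq)
  then show ?thesis using R by (intro exI[of _ c] exI[of _ "sqrt R"]) auto
qed

lemma mem_cball_sphere_iff:
  assumes r: "0 \<le> r" "r \<le> pi"
  shows "p \<in> cball c r \<longleftrightarrow> cos r \<le> stereo c \<bullet> stereo p"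
proof -
  have "dist c p \<le> r \<longleftrightarrow> cos r \<le> cos (dist c p)"
    unfolding dist_riemann_sphere_def using r abs_inner_stereo[of c p]
    by (intro cos_mono_le_eq[symmetric]) (auto intro: arccos_lbound arccos_ubound simp: abs_le_iff)
  then show ?thesis
    using cos_arccos_abs[OF abs_inner_stereo[of c p]] by (simp add: dist_riemann_sphere_def)
qed

lemma comps_P_singleton:
  assumes "open \<Omega>" "p \<in> comps \<Omega>" "\<not> diameter p > 0" shows "\<exists>x. p = {x}"
proof -
  have "compact p" using comps_closed[OF assms(1,2)] by (rule closed_imp_compact_sphere)
  then have bd: "bounded p" by (rule compact_imp_bounded)
  obtain x where x: "x \<in> p" using comps_nonempty[OF assms(2)] by blast
  have "y = x" if "y \<in> p" for y
  proof -
    have "dist y x \<le> 0" using diameter_bounded_bound[OF bd that x] assms(3) by linarith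
    then show ?thesis by simp
  qed
  then show ?thesis using x by blast
qed

context moebius_chart
begin

text \<open>In homogeneous coordinates a spherical cap is given by a Hermitian form being nonnegative, and a
  linear change of variables turns Hermitian forms into Hermitian forms. The leading coefficient is
  minus the value of the form at the pole, hence positive if the cap omits the pole.\<close>

lemma chart_vimage_cap:
  assumes k: "\<not> k \<le> stereo c \<bullet> stereo pole" and ne: "chart -` {p. k \<le> stereo c \<bullet> stereo p} \<noteq> {}"
  shows "\<exists>c' r. 0 \<le> r \<and> chart -` {p. k \<le> stereo c \<bullet> stereo p} = cball c' r"
proof -
  obtain \<xi> t where ct: "stereo c = (\<xi>, t)" by (cases "stereo c")
  define H where "H a b = 2 * Re (a * cnj b * cnj \<xi>) + (t - k) * (cmod a)\<^sup>2 - (t + k) * (cmod b)\<^sup>2" for a b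
  have H: "k \<le> stereo c \<bullet> stereo (proj a b) \<longleftrightarrow> 0 \<le> H a b" if "a \<noteq> 0 \<or> b \<noteq> 0" for a b
  proof -
    define n where "n = (cmod a)\<^sup>2 + (cmod b)\<^sup>2"
    have n: "n > 0" using that unfolding n_def by (auto intro: add_pos_nonneg add_nonneg_pos)
    have "stereo c \<bullet> stereo (proj a b) = (2 * Re (a * cnj b * cnj \<xi>) + t * ((cmod a)\<^sup>2 - (cmod b)\<^sup>2)) / n"
      unfolding ct stereo_proj[OF that] n_def[symmetric] inner_Pair
    proof -
      have "\<xi> \<bullet> (a * cnj b) = Re (a * cnj b * cnj \<xi>)" by (simp add: inner_complex_def algebra_simps)
      then have "\<xi> \<bullet> ((2 / n) *\<^sub>R (a * cnj b)) = 2 * Re (a * cnj b * cnj \<xi>) / n" by (simp only: inner_scaleR_right times_divide_eq_left)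
      then show "\<xi> \<bullet> ((2 / n) *\<^sub>R (a * cnj b)) + t \<bullet> (((cmod a)\<^sup>2 - (cmod b)\<^sup>2) / n) =
        (2 * Re (a * cnj b * cnj \<xi>) + t * ((cmod a)\<^sup>2 - (cmod b)\<^sup>2)) / n"
        by (simp only: add_divide_distrib inner_real_def times_divide_eq_right)
    qed
    then have "k \<le> stereo c \<bullet> stereo (proj a b) \<longleftrightarrow> k * n \<le> 2 * Re (a * cnj b * cnj \<xi>) + t * ((cmod a)\<^sup>2 - (cmod b)\<^sup>2)"
      using n by (simp add: pos_le_divide_eq)
    also have "\<dots> \<longleftrightarrow> 0 \<le> H a b" unfolding H_def n_def by (simp add: algebra_simps)
    finally show ?thesis .
  qed
  have "\<alpha> \<noteq> 0 \<or> \<gamma> \<noteq> 0" using det by auto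
  then have A: "- H \<alpha> \<gamma> > 0" using H k by force
  define L where "L = \<alpha> * cnj \<delta> * cnj \<xi> + \<gamma> * cnj \<beta> * \<xi> + of_real (t - k) * \<alpha> * cnj \<beta> - of_real (t + k) * \<gamma> * cnj \<delta>"
  have expand: "H (\<alpha> * z + \<beta>) (\<gamma> * z + \<delta>) = H \<alpha> \<gamma> * (cmod z)\<^sup>2 + 2 * Re (L * z) + H \<beta> \<delta>" for z
    unfolding H_def L_def cmod_power2 by (simp add: power2_eq_square algebra_simps)
  have eq: "chart -` {p. k \<le> stereo c \<bullet> stereo p} = {z. - H \<alpha> \<gamma> * (cmod z)\<^sup>2 \<le> 2 * Re (L * z) + H \<beta> \<delta>}"
    unfolding chart_def using H[OF num_denom] expand by auto
  show ?thesis using hermitian_disk[OF A] ne unfolding eq by blast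
qed

lemma chart_vimage_comps_circle_domain:
  assumes D: "circle_domain D" and pole: "pole \<in> D" and p: "p \<in> comps D"
  shows "\<exists>c r. 0 \<le> r \<and> chart -` p = cball c r"
proof -
  have opD: "open D" using D by (simp add: circle_domain_def sphere_domain_def)
  have pp: "pole \<notin> p" using comps_subset[OF p] pole by blast
  obtain x where x: "x \<in> p" using comps_nonempty[OF p] by blast
  have "x \<noteq> pole" using x pp by blast
  then have cx: "coord x \<in> chart -` p" using x by simp
  show ?thesis
  proof (cases "diameter p > 0")
    case True
    then have "closed_disk p" using D p by (simp add: circle_domain_def comps_N_def)
    then obtain c r where cr: "0 < r" "r < pi" "p = cball c r" by (auto simp: closed_disk_def)
    have peq: "p = {x. cos r \<le> stereo c \<bullet> stereo x}"
    proof (rule set_eqI)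
      show "x \<in> p \<longleftrightarrow> x \<in> {x. cos r \<le> stereo c \<bullet> stereo x}" for x
        unfolding cr(3) mem_Collect_eq using cr(1,2) by (intro mem_cball_sphere_iff) auto
    qed
    have "\<not> cos r \<le> stereo c \<bullet> stereo pole" using pp unfolding peq by simp
    moreover have "chart -` {x. cos r \<le> stereo c \<bullet> stereo x} \<noteq> {}" using cx unfolding peq by blast
    ultimately show ?thesis unfolding peq by (rule chart_vimage_cap)
  next
    case False
    then obtain y where "p = {y}" using comps_P_singleton[OF opD p] by blast
    then have "p = {x}" using x by blast
    then have "chart -` p = {coord x}" using cx by (auto simp: inj_chart[THEN inj_eq])
    then show ?thesis by (intro exI[of _ "coord x"] exI[of _ 0]) auto
  qed
qed

lemma holomorphic_coord_compose:
  assumes op: "open \<Omega>" and f: "sphere_holomorphic_on f \<Omega>"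
  shows "(\<lambda>z. coord (f (at_infty z))) holomorphic_on {z. at_infty z \<in> \<Omega> \<and> f (at_infty z) \<noteq> pole}"
proof -
  have cf: "continuous_on \<Omega> f" using f by (simp add: sphere_holomorphic_on_def)
  have ca: "continuous_on A at_infty" for A by (rule inf_chart.continuous_chart)
  have cfa: "continuous_on (at_infty -` \<Omega>) (\<lambda>z. f (at_infty z))"
    by (rule continuous_on_compose2[OF cf ca]) auto
  have opA: "open (at_infty -` \<Omega>)" by (rule inf_chart.open_chart_vimage[OF op])
  have opS: "open {z. at_infty z \<in> \<Omega> \<and> f (at_infty z) \<in> V}" if "open V" for V
  proof -
    have "open ((\<lambda>z. f (at_infty z)) -` V \<inter> at_infty -` \<Omega>)"
      using cfa continuous_on_open_vimage[OF opA, of "\<lambda>z. f (at_infty z)"] that by blast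
    moreover have "(\<lambda>z. f (at_infty z)) -` V \<inter> at_infty -` \<Omega> = {z. at_infty z \<in> \<Omega> \<and> f (at_infty z) \<in> V}" by auto
    ultimately show ?thesis by simp
  qed
  define S1 where "S1 = {z. at_infty z \<in> \<Omega> \<and> f (at_infty z) \<in> - {pole, Infty}}"
  define S2 where "S2 = {z. at_infty z \<in> \<Omega> \<and> f (at_infty z) \<in> - {pole, Fin 0}}"
  have op12: "open S1" "open S2" unfolding S1_def S2_def by (rule opS; auto intro!: open_Compl)+
  have h1: "(inv Fin \<circ> f \<circ> at_infty) holomorphic_on S1"
    using f unfolding sphere_holomorphic_on_def S1_def
    by (auto simp: range_Fin elim!: holomorphic_on_subset)
  have h2: "(inv at_infty \<circ> f \<circ> at_infty) holomorphic_on S2"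
    using f unfolding sphere_holomorphic_on_def S2_def
    by (auto simp: range_at_infty elim!: holomorphic_on_subset)
  have e1: "coord (f (at_infty z)) = (\<delta> * (inv Fin \<circ> f \<circ> at_infty) z - \<beta>) / (\<alpha> - \<gamma> * (inv Fin \<circ> f \<circ> at_infty) z)
      \<and> \<alpha> - \<gamma> * (inv Fin \<circ> f \<circ> at_infty) z \<noteq> 0" if "z \<in> S1" for z
  proof -
    have "f (at_infty z) \<noteq> Infty" using that unfolding S1_def by blast
    then obtain w where "f (at_infty z) = Fin w" by (cases "f (at_infty z)") auto
    then show ?thesis using that Fin_eq_pole_iff[of w] by (auto simp: S1_def coord_def)
  qed
  have e2: "coord (f (at_infty z)) = (\<delta> - \<beta> * (inv at_infty \<circ> f \<circ> at_infty) z) / (\<alpha> * (inv at_infty \<circ> f \<circ> at_infty) z - \<gamma>)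
      \<and> \<alpha> * (inv at_infty \<circ> f \<circ> at_infty) z - \<gamma> \<noteq> 0" if "z \<in> S2" for z
  proof -
    have "f (at_infty z) \<in> range at_infty" using that by (auto simp: S2_def range_at_infty)
    then obtain t where t: "f (at_infty z) = at_infty t" by blast
    have "at_infty t \<noteq> pole" using that by (auto simp: S2_def t)
    then show ?thesis using coord_at_infty[of t] at_infty_eq_pole_iff[of t] by (simp add: t)
  qed
  have H1: "(\<lambda>z. coord (f (at_infty z))) holomorphic_on S1"
  proof (rule holomorphic_transform)
    show "(\<lambda>z. (\<delta> * (inv Fin \<circ> f \<circ> at_infty) z - \<beta>) / (\<alpha> - \<gamma> * (inv Fin \<circ> f \<circ> at_infty) z)) holomorphic_on S1"
      using e1 by (intro holomorphic_intros h1) auto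
  qed (use e1 in auto)
  have H2: "(\<lambda>z. coord (f (at_infty z))) holomorphic_on S2"
  proof (rule holomorphic_transform)
    show "(\<lambda>z. (\<delta> - \<beta> * (inv at_infty \<circ> f \<circ> at_infty) z) / (\<alpha> * (inv at_infty \<circ> f \<circ> at_infty) z - \<gamma>)) holomorphic_on S2"
      using e2 by (intro holomorphic_intros h2) auto
  qed (use e2 in auto)
  have "(\<lambda>z. coord (f (at_infty z))) holomorphic_on S1 \<union> S2"
    by (rule holomorphic_on_Un[OF H1 H2 op12])
  moreover have "S1 \<union> S2 = {z. at_infty z \<in> \<Omega> \<and> f (at_infty z) \<noteq> pole}" by (auto simp: S1_def S2_def)
  ultimately show ?thesis by simp
qed

end

section \<open>The tree domain\<close>

text \<open>The angle between \<open>0\<close> and \<open>1/\<zeta>\<close> is \<open>2 * arctan (1 / |\<zeta>|)\<close>.\<close>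

lemma dist_at_infty_zero: "\<zeta> \<noteq> 0 \<Longrightarrow> dist (at_infty \<zeta>) (Fin 0) \<le> 2 / cmod \<zeta>"
proof -
  assume z: "\<zeta> \<noteq> 0"
  define x where "x = 1 / cmod \<zeta>"
  have x: "x > 0" using z by (simp add: x_def)
  define a where "a = arctan x"
  have a: "0 \<le> a" "a < pi / 2" using x arctan_ubound[of x] by (simp_all add: a_def)
  have zz: "1 + (cmod \<zeta>)\<^sup>2 > 0" by (simp add: add_pos_nonneg)
  have "stereo (at_infty \<zeta>) \<bullet> stereo (Fin 0) = ((cmod \<zeta>)\<^sup>2 - 1) / (1 + (cmod \<zeta>)\<^sup>2)"
    unfolding at_infty_eq_proj by (subst stereo_proj) (auto simp: diff_divide_distrib)
  also have "\<dots> = (1 - x\<^sup>2) / (1 + x\<^sup>2)" 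
  proof -
    define R where "R = (cmod \<zeta>)\<^sup>2"
    have "R > 0" using z by (simp add: R_def)
    moreover have "x\<^sup>2 = 1 / R" by (simp add: x_def R_def power_divide)
    moreover have "1 - 1 / R = (R - 1) / R" "1 + 1 / R = (1 + R) / R" using \<open>R > 0\<close> by (simp_all add: field_simps)
    ultimately show ?thesis unfolding R_def[symmetric] by simp
  qed
  also have "\<dots> = cos (2 * a)"
  proof -
    have p: "1 + x\<^sup>2 > 0" by (simp add: add_pos_nonneg)
    have "cos (2 * a) = 2 * (cos a)\<^sup>2 - 1" by (rule cos_double_cos)
    also have "(cos a)\<^sup>2 = 1 / (1 + x\<^sup>2)" using p by (simp add: a_def cos_arctan power_divide)
    finally show ?thesis using p by (simp add: field_simps)
  qed
  finally have "dist (at_infty \<zeta>) (Fin 0) = arccos (cos (2 * a))" by (simp add: dist_riemann_sphere_def)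
  also have "\<dots> = 2 * a" using a by (intro arccos_cos) auto
  also have "\<dots> \<le> 2 * x" using arctan_le_self[of x] x by (simp add: a_def)
  finally show ?thesis by (simp add: x_def)
qed

definition levels :: "(nat \<times> nat) set" where "levels = (SIGMA n:UNIV. {..<2^n})"

definition tree_plates :: "(nat \<Rightarrow> real) \<Rightarrow> complex set" where
  "tree_plates X = (\<Union>(n,k)\<in>levels. plate X n k)"

lemma in_tree_plates: "z \<in> tree_plates X \<longleftrightarrow> (\<exists>n k. (n,k) \<in> levels \<and> z \<in> plate X n k)"
  by (auto simp: tree_plates_def)

definition tree_domain :: "(nat \<Rightarrow> real) \<Rightarrow> riemann_sphere set" where
  "tree_domain X = at_infty ` (- tree_plates X)"

text \<open>Increments of at least \<open>1\<close> leave room for the gaps, and force the plates to move off to infinity.\<close>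

locale tree_levels =
  fixes X :: "nat \<Rightarrow> real"
  assumes pos: "X 0 > 0" and step: "\<And>n. X n + 1 \<le> X (Suc n)"
begin

abbreviation plates :: "complex set" where "plates \<equiv> tree_plates X"

lemma pow_half_le: "(1/2::real)^n \<le> 1" "(0::real) < (1/2)^n"
  by (auto simp: power_le_one)

lemma gap: "X n \<le> X (Suc n) - (1/2)^Suc n"
  using step[of n] pow_half_le(1)[of "Suc n"] by linarith

lemma X_mono: "m \<le> n \<Longrightarrow> X m \<le> X n"
  by (rule lift_Suc_mono_le[of X]) (use step in \<open>auto intro: order_trans[OF _ step]\<close>)

lemma X_ge: "real n \<le> X n"
proof (induction n)
  case (Suc n) then show ?case using step[of n] by simp
qed (use pos in simp)

lemma X_pos: "X n > 0" using X_mono[of 0 n] pos by simp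

lemma closed_plate: "closed (plate X n k)"
  unfolding plate_def by (intro closed_Collect_conj closed_Collect_le continuous_intros)

lemma plate_eq_cbox: "plate X n k = cbox (Complex (X n) ((real k + 1/8) * (1/2)^n)) (Complex (X (Suc n) - (1/2)^Suc n) ((real k + 7/8) * (1/2)^n))"
  by (auto simp: plate_def in_cbox_complex_iff)

text \<open>The family is locally finite: a half-plane \<open>Re z < X m\<close> meets only the plates of level below \<open>m\<close>.\<close>

lemma closed_plates_subset: 
  assumes J: "J \<subseteq> levels" shows "closed (\<Union>(n,k)\<in>J. plate X n k)"
proof -
  have "- (\<Union>(n,k)\<in>J. plate X n k) = (\<Union>m. {z. Re z < X m} \<inter> - (\<Union>(n,k)\<in>J \<inter> {(n,k). n < m}. plate X n k))"
  proof (intro equalityI subsetI)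
    fix z assume z: "z \<in> - (\<Union>(n,k)\<in>J. plate X n k)"
    obtain m :: nat where "Re z < real m" using reals_Archimedean2 by blast
    then have "Re z < X m" using X_ge[of m] by linarith
    then show "z \<in> (\<Union>m. {z. Re z < X m} \<inter> - (\<Union>(n,k)\<in>J \<inter> {(n,k). n < m}. plate X n k))" using z by auto
  next
    fix z assume "z \<in> (\<Union>m. {z. Re z < X m} \<inter> - (\<Union>(n,k)\<in>J \<inter> {(n,k). n < m}. plate X n k))"
    then obtain m where m: "Re z < X m" "z \<notin> (\<Union>(n,k)\<in>J \<inter> {(n,k). n < m}. plate X n k)" by auto
    have "z \<notin> plate X n k" if "(n,k) \<in> J" for n k
    proof (cases "n < m")
      case False
      then have "X m \<le> X n" using X_mono by simp
      then show ?thesis using m(1) by (auto simp: plate_def)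
    qed (use m that in auto)
    then show "z \<in> - (\<Union>(n,k)\<in>J. plate X n k)" by auto
  qed
  moreover have "open ({z. Re z < X m} \<inter> - (\<Union>(n,k)\<in>J \<inter> {(n,k). n < m}. plate X n k))" for m
  proof (intro open_Int open_Compl)
    show "open {z. Re z < X m}" by (intro open_Collect_less continuous_intros)
    have "J \<inter> {(n,k). n < m} \<subseteq> (SIGMA n:{..<m}. {..<2^n})" using J by (auto simp: levels_def)
    then have "finite (J \<inter> {(n,k). n < m})" by (rule finite_subset) auto
    then show "closed (\<Union>(n,k)\<in>J \<inter> {(n,k). n < m}. plate X n k)"
      by (intro closed_UN) (auto intro: closed_plate)
  qed
  ultimately show ?thesis unfolding closed_def by (metis (no_types, lifting) open_UN UNIV_I)
qed

lemma plate_im_bounds: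
  assumes "k < 2^n" "z \<in> plate X n k" shows "0 < Im z" "Im z < 1"
proof -
  have v: "(0::real) < (1/2)^n" by simp
  have "0 < (real k + 1/8) * (1/2)^n" using v by (intro mult_pos_pos) auto
  then show "0 < Im z" using assms(2) unfolding plate_def mem_Collect_eq by linarith
  have "real k + 1 \<le> 2^n" using assms(1) by (metis Suc_eq_plus1 Suc_leI of_nat_1 of_nat_add of_nat_le_iff of_nat_numeral of_nat_power)
  then have "(real k + 7/8) * (1/2)^n < 2^n * (1/2)^n" using v by (intro mult_strict_right_mono) auto
  also have "\<dots> = (1::real)" by (simp add: power_one_over)
  finally show "Im z < 1" using assms(2) unfolding plate_def mem_Collect_eq by linarith
qed

lemma plate_re:
  assumes "z \<in> plate X n k" shows "X n \<le> Re z" "Re z < X (Suc n)"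
  using assms pow_half_le(2)[of "Suc n"] unfolding plate_def mem_Collect_eq by linarith+

lemma plates_disjoint:
  assumes "z \<in> plate X n k" "z \<in> plate X m j"
  shows "n = m \<and> k = j"
proof -
  have "n = m"
  proof (rule ccontr)
    assume "n \<noteq> m"
    then consider "Suc n \<le> m" | "Suc m \<le> n" by linarith
    then show False
    proof cases
      case 1 then show False using X_mono[OF 1] plate_re[OF assms(1)] plate_re[OF assms(2)] by linarith
    next
      case 2 then show False using X_mono[OF 2] plate_re[OF assms(1)] plate_re[OF assms(2)] by linarith
    qed
  qed
  moreover have "k = j"
  proof (rule band_index_unique[of "(1/2)^n" _ "Im z"])
    have p: "(0::real) < (1/2)^n" by simp
    show "0 < (1/2::real)^n" by (rule p)
    show "real k * (1/2)^n \<le> Im z" "Im z < (real k + 1) * (1/2)^n"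
      using assms(1) p unfolding plate_def mem_Collect_eq distrib_right by linarith+
    show "real j * (1/2)^n \<le> Im z" "Im z < (real j + 1) * (1/2)^n"
      using assms(2) p unfolding plate_def mem_Collect_eq distrib_right \<open>n = m\<close> by linarith+
  qed
  ultimately show ?thesis by simp
qed

lemma gap_free:
  assumes x: "X (Suc n) - (1/2)^Suc n < Re z" "Re z < X (Suc n)" shows "z \<notin> plate X m k"
proof (cases "m \<le> n")
  case True
  have "X (Suc m) - (1/2)^Suc m \<le> X (Suc n) - (1/2)^Suc n"
  proof (cases "m = n")
    case False
    then have "X (Suc m) \<le> X (Suc n) - (1/2)^Suc n" using levels_ordered[OF gap, of "Suc m" "Suc n"] True by simp
    then show ?thesis using pow_half_le(2)[of "Suc m"] by linarith
  qed simp
  then show ?thesis using x by (auto simp: plate_def)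
next
  case False
  then have "X (Suc n) \<le> X m" by (intro X_mono) simp
  then show ?thesis using x by (auto simp: plate_def)
qed

text \<open>Moving to the right at constant height from a point outside the plates reaches the next gap without
  hitting a plate, since the plates of one level share their horizontal extent; the vertical line
  through a gap is free.\<close>

lemma escape_route:
  assumes z: "z \<notin> plates"
  shows "\<exists>x'\<ge>Re z. (\<forall>t. Re z \<le> t \<and> t \<le> x' \<longrightarrow> Complex t (Im z) \<notin> plates) \<and> (\<forall>y. Complex x' y \<notin> plates)"
proof (cases "Re z < X 0")
  case True
  have "w \<notin> plates" if "Re w < X 0" for w
  proof -
    have "w \<notin> plate X n k" for n k using X_mono[of 0 n] that unfolding plate_def by simp
    then show ?thesis by (simp add: in_tree_plates)
  qed
  then show ?thesis using True by (intro exI[of _ "Re z"]) auto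
next
  case False
  obtain m :: nat where "Re z < real m" using reals_Archimedean2 by blast
  then have "Re z < X m" using X_ge[of m] by linarith
  define M where "M = (LEAST m. Re z < X m)"
  have M: "Re z < X M" unfolding M_def by (rule LeastI[of _ m]) fact
  have "M \<noteq> 0" using M False by (cases M) auto
  then obtain n where n: "M = Suc n" by (cases M) auto
  have Xn: "X n \<le> Re z" using not_less_Least[of n "\<lambda>m. Re z < X m"] n unfolding M_def[symmetric] by simp
  define v where "v = (1/2::real)^Suc n"
  have v: "v > 0" by (simp add: v_def)
  define x' where "x' = max (Re z) (X (Suc n) - v / 2)"
  have x': "X (Suc n) - v < x'" "x' < X (Suc n)" "Re z \<le> x'" using M n v by (auto simp: x'_def)
  have gf: "w \<notin> plates" if "X (Suc n) - v < Re w" "Re w < X (Suc n)" for w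
    using gap_free[of n w] that unfolding v_def in_tree_plates by blast
  have "Complex t (Im z) \<notin> plates" if t: "Re z \<le> t" "t \<le> x'" for t
  proof (cases "X (Suc n) - v < t")
    case True
    then show ?thesis using gf[of "Complex t (Im z)"] t x' by simp
  next
    case False
    show ?thesis
    proof
      assume "Complex t (Im z) \<in> plates"
      then obtain m k where mk: "(m,k) \<in> levels" "Complex t (Im z) \<in> plate X m k"
        by (auto simp: in_tree_plates)
      have "m = n"
      proof (rule ccontr)
        assume "m \<noteq> n"
        then consider "Suc m \<le> n" | "Suc n \<le> m" by linarith
        then show False
        proof cases
          case 1 then show False using X_mono[OF 1] plate_re[OF mk(2)] t Xn by simp
        next
          case 2 then show False using X_mono[OF 2] plate_re[OF mk(2)] False v by simp
        qed
      qed
      then have "z \<in> plate X m k" using mk(2) t Xn False by (auto simp: plate_def v_def)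
      then show False using z mk(1) by (auto simp: in_tree_plates)
    qed
  qed
  moreover have "Complex x' y \<notin> plates" for y using gf[of "Complex x' y"] x' by simp
  ultimately show ?thesis using x'(3) by (intro exI[of _ x']) auto
qed

text \<open>Every point is joined by an L-shaped path to the half-plane above all plates.\<close>

lemma connected_Compl_plates: "connected (- plates)"
proof -
  define H where "H = {z. Im z > 1}"
  have H: "H \<subseteq> - plates" 
  proof (intro subsetI ComplI)
    fix z assume "z \<in> H" "z \<in> plates"
    then obtain n k where "1 < Im z" "k < 2^n" "z \<in> plate X n k" by (auto simp: H_def in_tree_plates levels_def)
    then show False using plate_im_bounds(2) by fastforce
  qed
  have cH: "connected H" unfolding H_def by (intro convex_connected convex_halfspace_Im_gt)
  have "\<exists>S. connected S \<and> z \<in> S \<and> H \<subseteq> S \<and> S \<subseteq> - plates" if z: "z \<in> - plates" for z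
  proof -
    have "z \<notin> plates" using z by (rule ComplD)
    from escape_route[OF this] obtain x' where x': "Re z \<le> x'"
      "\<forall>t. Re z \<le> t \<and> t \<le> x' \<longrightarrow> Complex t (Im z) \<notin> plates" "\<forall>y. Complex x' y \<notin> plates"
      by (elim exE conjE)
    define A where "A = (\<lambda>t. Complex t (Im z)) ` {Re z..x'}"
    define B where "B = range (Complex x')"
    have "connected A" unfolding A_def by (intro connected_continuous_image continuous_intros connected_Icc)
    moreover have "connected B" unfolding B_def by (intro connected_continuous_image continuous_intros connected_UNIV)
    moreover have "Complex x' (Im z) \<in> A \<inter> B" using x'(1) by (auto simp: A_def B_def)
    ultimately have AB: "connected (A \<union> B)" by (intro connected_Un) blast+
    have "Complex x' 2 \<in> (A \<union> B) \<inter> H" by (auto simp: B_def H_def)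
    then have "connected ((A \<union> B) \<union> H)" using AB cH by (intro connected_Un[of "A \<union> B" H]) blast+
    moreover have "z \<in> A" using x'(1) by (auto simp: A_def intro!: image_eqI[of _ _ "Re z"])
    moreover have "A \<subseteq> - plates"
    proof
      fix w assume "w \<in> A"
      then obtain t where "w = Complex t (Im z)" "Re z \<le> t" "t \<le> x'" by (auto simp: A_def)
      then show "w \<in> - plates" using x'(2) by (intro ComplI) blast
    qed
    moreover have "B \<subseteq> - plates"
    proof
      fix w assume "w \<in> B"
      then obtain y where "w = Complex x' y" by (auto simp: B_def)
      then show "w \<in> - plates" using x'(3) by (intro ComplI) blast
    qed
    ultimately show ?thesis using H by (intro exI[of _ "(A \<union> B) \<union> H"] conjI) (blast intro: Un_least)+
  qed
  then obtain S where S: "\<And>z. z \<in> - plates \<Longrightarrow> connected (S z) \<and> z \<in> S z \<and> H \<subseteq> S z \<and> S z \<subseteq> - plates" by metis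
  have "Complex 0 2 \<in> H" by (simp add: H_def)
  then have "connected (\<Union>(S ` (- plates)))" using S by (intro connected_Union) blast+
  moreover have "\<Union>(S ` (- plates)) = - plates" using S by blast
  ultimately show ?thesis by simp
qed

lemma Compl_tree_domain: "- tree_domain X = insert (Fin 0) (at_infty ` plates)"
proof -
  have "p \<in> - at_infty ` (- plates) \<longleftrightarrow> p \<in> insert (Fin 0) (at_infty ` plates)" for p
  proof (cases "p = Fin 0")
    case True
    then show ?thesis using range_at_infty by blast
  next
    case False
    then obtain z where z: "p = at_infty z" using range_at_infty by blast
    have "at_infty z \<in> at_infty ` S \<longleftrightarrow> z \<in> S" for S using inj_at_infty by (rule inj_image_mem_iff)
    then show ?thesis using False by (simp add: z)
  qed
  then show ?thesis unfolding tree_domain_def by blast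
qed

lemma domain_tree_domain: "sphere_domain (tree_domain X)"
proof -
  have cl: "closed plates" using closed_plates_subset[of levels] by (simp add: tree_plates_def)
  have "open (tree_domain X)" unfolding tree_domain_def
    by (rule inf_chart.open_chart_image) (use cl in \<open>simp only: open_Compl\<close>)
  moreover have "connected (tree_domain X)" unfolding tree_domain_def
    by (rule connected_continuous_image[OF inf_chart.continuous_chart connected_Compl_plates])
  moreover have "Complex 0 2 \<notin> plates" 
    using plate_im_bounds(2) unfolding in_tree_plates levels_def by fastforce
  ultimately show ?thesis unfolding sphere_domain_def tree_domain_def by blast
qed

lemma at_infty_in_tree_domain: "at_infty z \<in> tree_domain X \<longleftrightarrow> z \<notin> plates"
  unfolding tree_domain_def by (simp add: inj_image_mem_iff[OF inj_at_infty])

lemma plate_nonempty: "plate X n k \<noteq> {}"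
proof -
  have "Complex (X n) ((real k + 1/8) * (1/2)^n) \<in> plate X n k"
    using gap[of n] pow_half_le(2)[of n] by (auto simp: plate_def)
  then show ?thesis by blast
qed

text \<open>A plate is connected, and by local finiteness it is relatively clopen in the complement.\<close>

lemma plate_component:
  assumes nk: "(n,k) \<in> levels" shows "at_infty ` plate X n k \<in> comps (tree_domain X)"
proof -
  define P where "P = at_infty ` plate X n k"
  define V where "V = at_infty ` (- (\<Union>(m,j)\<in>levels - {(n,k)}. plate X m j))"
  have opV: "open V" unfolding V_def
    by (intro inf_chart.open_chart_image open_Compl closed_plates_subset) blast
  have "V \<inter> - tree_domain X = P"
  proof -
    have "Fin 0 \<notin> V" unfolding V_def using range_at_infty by auto
    then have "V \<inter> - tree_domain X = V \<inter> at_infty ` plates"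
      unfolding Compl_tree_domain by (rule Int_insert_right_if0)
    also have "\<dots> = at_infty ` ((- (\<Union>(m,j)\<in>levels - {(n,k)}. plate X m j)) \<inter> plates)"
      unfolding V_def by (rule image_Int[OF inj_at_infty, symmetric])
    also have "(- (\<Union>(m,j)\<in>levels - {(n,k)}. plate X m j)) \<inter> plates = plate X n k"
      
    proof (rule set_eqI)
      fix z
      show "z \<in> - (\<Union>(m,j)\<in>levels - {(n,k)}. plate X m j) \<inter> plates \<longleftrightarrow> z \<in> plate X n k"
      proof
        assume z: "z \<in> plate X n k"
        have "z \<notin> plate X m j" if "(m,j) \<in> levels - {(n,k)}" for m j
          using plates_disjoint[OF z, of m j] that by blast
        then have "z \<notin> (\<Union>(m,j)\<in>levels - {(n,k)}. plate X m j)" by blast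
        moreover have "z \<in> plates" using nk z unfolding in_tree_plates by blast
        ultimately show "z \<in> - (\<Union>(m,j)\<in>levels - {(n,k)}. plate X m j) \<inter> plates" by blast
      next
        assume z: "z \<in> - (\<Union>(m,j)\<in>levels - {(n,k)}. plate X m j) \<inter> plates"
        have "z \<in> plates" using z by (rule IntD2)
        then obtain m j where mj: "(m,j) \<in> levels" "z \<in> plate X m j" unfolding in_tree_plates by (elim exE conjE)
        have "z \<notin> (\<Union>(m,j)\<in>levels - {(n,k)}. plate X m j)" by (rule ComplD[OF IntD1[OF z]])
        moreover have "(m,j) \<in> levels - {(n,k)} \<Longrightarrow> z \<in> (\<Union>(m,j)\<in>levels - {(n,k)}. plate X m j)"
          by (rule UN_I[of "(m,j)"]) (simp_all add: mj(2))
        ultimately have "(m,j) \<notin> levels - {(n,k)}" by blast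
        then show "z \<in> plate X n k" using mj by simp
      qed
    qed
    finally show ?thesis by (simp add: P_def)
  qed
  then have ope: "openin (top_of_set (- tree_domain X)) P" using opV by (metis inf_commute openin_open_Int)
  have "compact P" unfolding P_def plate_eq_cbox
    by (intro compact_continuous_image inf_chart.continuous_chart compact_cbox)
  moreover have PS: "P \<subseteq> - tree_domain X" 
  proof -
    have "plate X n k \<subseteq> plates" using nk unfolding subset_iff in_tree_plates by blast
    then show ?thesis unfolding Compl_tree_domain P_def by (intro subset_insertI2 image_mono)
  qed
  ultimately have clo: "closedin (top_of_set (- tree_domain X)) P" by (simp add: closed_subset compact_imp_closed)
  have con: "connected P" unfolding P_def plate_eq_cbox
    by (intro connected_continuous_image inf_chart.continuous_chart convex_connected convex_box)
  have ne: "P \<noteq> {}" using plate_nonempty by (simp add: P_def)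
  show ?thesis unfolding comps_def P_def[symmetric] in_components_maximal
  proof (intro conjI allI impI ne PS con)
    fix D assume D: "D \<noteq> {} \<and> P \<subseteq> D \<and> D \<subseteq> - tree_domain X \<and> connected D"
    have "openin (top_of_set D) P" "closedin (top_of_set D) P"
      using ope clo D by (meson openin_subset_trans closedin_subset_trans)+
    then show "D = P" using D ne connected_clopen by metis
  qed
qed

lemma comps_tree_domain:
  "comps (tree_domain X) = insert {Fin 0} ((\<lambda>(n,k). at_infty ` plate X n k) ` levels)"
proof -
  let ?\<Omega> = "tree_domain X"
  have F0: "Fin 0 \<notin> at_infty ` A" for A using range_at_infty by auto
  have outside: "x = Fin 0 \<or> (\<exists>n k. (n,k) \<in> levels \<and> x \<in> at_infty ` plate X n k)" if "x \<in> - ?\<Omega>" for x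
  proof -
    have "x = Fin 0 \<or> x \<in> at_infty ` plates" using that unfolding Compl_tree_domain by (rule insertE) blast+
    then show ?thesis unfolding image_iff Bex_def in_tree_plates by blast
  qed
  define p where "p = collapse ?\<Omega> (Fin 0)"
  have p: "p \<in> comps ?\<Omega>" "Fin 0 \<in> p"
    using Compl_tree_domain by (auto simp: p_def collapse_self intro!: collapse_in_comps)
  have "p = {Fin 0}"
  proof -
    have "x = Fin 0" if x: "x \<in> p" for x
    proof (rule ccontr)
      assume "x \<noteq> Fin 0"
      then obtain n k where nk: "(n,k) \<in> levels" "x \<in> at_infty ` plate X n k"
        using outside[of x] x comps_subset[OF p(1)] by blast
      then have "p = at_infty ` plate X n k" using comps_eq[OF p(1) plate_component x] by blast
      then show False using p(2) F0 by metis
    qed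
    then show ?thesis using p(2) by blast
  qed
  then have z: "{Fin 0} \<in> comps ?\<Omega>" using p(1) by simp
  show ?thesis
  proof (intro equalityI subsetI)
    fix q assume q: "q \<in> comps ?\<Omega>"
    obtain x where x: "x \<in> q" using comps_nonempty[OF q] by blast
    then consider "x = Fin 0" | n k where "(n,k) \<in> levels" "x \<in> at_infty ` plate X n k"
      using outside[of x] comps_subset[OF q] by blast
    then show "q \<in> insert {Fin 0} ((\<lambda>(n,k). at_infty ` plate X n k) ` levels)"
    proof cases
      case 1 then show ?thesis using comps_eq[OF q z x] by simp
    next
      case 2 then show ?thesis using comps_eq[OF q plate_component x] by force
    qed
  qed (use z plate_component in auto)
qed

lemma diameter_plate_le: "diameter (at_infty ` plate X n k) \<le> 4 / X n"
proof -
  have d: "dist p (Fin 0) \<le> 2 / X n" if "p \<in> at_infty ` plate X n k" for p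
  proof -
    obtain z where z: "p = at_infty z" "z \<in> plate X n k" using \<open>p \<in> _\<close> by blast
    have "X n \<le> cmod z" using z(2) complex_Re_le_cmod[of z] by (auto simp: plate_def)
    moreover have "z \<noteq> 0" using calculation X_pos[of n] by auto
    ultimately have "dist p (Fin 0) \<le> 2 / cmod z" "2 / cmod z \<le> 2 / X n"
      using dist_at_infty_zero X_pos[of n] by (auto simp: z(1) intro!: divide_left_mono)
    then show ?thesis by linarith
  qed
  have "dist p q \<le> 4 / X n" if "p \<in> at_infty ` plate X n k" "q \<in> at_infty ` plate X n k" for p q
    using d[OF that(1)] d[OF that(2)] dist_triangle2[of p q "Fin 0"] by simp
  then show ?thesis unfolding diameter_def using plate_nonempty by (auto intro!: cSUP_least)
qed

end

section \<open>The conformal image of the point component\<close>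

context tree_levels
begin

text \<open>The origin is excluded as well because the pole of the chart of the target is placed at the image of
  \<open>Infty = at_infty 0\<close>.\<close>

lemma bridge_avoids_plates: "bridge X (Suc n) j \<subseteq> - plates - {0}"
proof
  fix z assume z: "z \<in> bridge X (Suc n) j"
  then have "z \<notin> plate X m k" for m k
    by (intro gap_free[of n]) (auto simp: bridge_def)
  moreover have "Re z > 0"
  proof -
    have "X n < Re z" using z gap[of n] by (auto simp: bridge_def)
    then show ?thesis using X_pos[of n] by linarith
  qed
  then have "z \<noteq> 0" by auto
  ultimately show "z \<in> - plates - {0}" by (simp add: in_tree_plates)
qed

lemma zero_not_in_plates: "0 \<notin> plates"
proof -
  have "0 \<notin> plate X n k" for n k using X_pos[of n] by (simp add: plate_def)
  then show ?thesis by (simp add: in_tree_plates)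
qed

lemma Infty_in_tree_domain: "Infty \<in> tree_domain X"
  using zero_not_in_plates at_infty_in_tree_domain[of 0] by (simp add: at_infty_def)

lemma zero_component: "{Fin 0} \<in> comps_P (tree_domain X)"
  by (simp add: comps_P_def comps_tree_domain)

lemma collapse_plate:
  "(n,k) \<in> levels \<Longrightarrow> z \<in> plate X n k \<Longrightarrow> collapse (tree_domain X) (at_infty z) = at_infty ` plate X n k"
  by (rule collapse_comps[OF plate_component]) auto

text \<open>If the image were a point \<open>q\<close>, a chart with origin \<open>q\<close> and pole \<open>f Infty\<close> would make all images of
  plates bounded planar disks shrinking to \<open>0\<close>, and \<open>no_tree_collapse\<close> applies to \<open>f\<close> read in the
  charts \<open>1/z\<close> and \<open>coord\<close>.\<close>

lemma conformal_image_of_zero: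
  assumes D: "circle_domain D" and conf: "conformal_homeomorphism (tree_domain X) D f"
    and F: "hat_extension (tree_domain X) D f F"
  shows "F {Fin 0} \<in> comps_N D"
proof (rule ccontr)
  let ?\<Omega> = "tree_domain X"
  assume neg: "F {Fin 0} \<notin> comps_N D"
  obtain g where hom: "homeomorphism ?\<Omega> D f g" and hol: "sphere_holomorphic_on f ?\<Omega>"
    using conf by (auto simp: conformal_homeomorphism_def)
  have sO: "sphere_domain ?\<Omega>" by (rule domain_tree_domain)
  have sD: "sphere_domain D" using D by (simp add: circle_domain_def)
  have opO: "open ?\<Omega>" and opD: "open D" using sO sD by (auto simp: sphere_domain_def)
  have injf: "f x = f y \<Longrightarrow> x \<in> ?\<Omega> \<Longrightarrow> y \<in> ?\<Omega> \<Longrightarrow> x = y" for x y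
    using homeomorphism_apply1[OF hom] by metis
  have fD: "f x \<in> D" if "x \<in> ?\<Omega>" for x using homeomorphism_image1[OF hom] that by blast
  have z0: "{Fin 0} \<in> comps ?\<Omega>" using zero_component by (simp add: comps_P_def)
  have FD: "F p \<in> comps D" if "p \<in> comps ?\<Omega>" for p by (rule hat_extension_comps[OF opO hom F that])
  have "\<not> diameter (F {Fin 0}) > 0" using neg FD[OF z0] by (simp add: comps_N_def)
  then obtain q where q: "F {Fin 0} = {q}" using comps_P_singleton[OF opD FD[OF z0]] by blast
  have fI: "f Infty \<in> D" using fD Infty_in_tree_domain by blast
  have "q \<notin> D" using comps_subset[OF FD[OF z0]] q by blast
  then have "f Infty \<noteq> q" using fI by blast
  then obtain \<alpha> \<beta> \<gamma> \<delta> where "moebius_chart \<alpha> \<beta> \<gamma> \<delta>" and c: "f Infty = proj \<alpha> \<gamma>" "q = proj \<beta> \<delta>"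
    using chart_with_pole_and_origin_exists by blast
  then interpret T: moebius_chart \<alpha> \<beta> \<gamma> \<delta> by simp
  have q0: "q = T.chart 0" by (simp add: T.chart_def c)
  define W where "W = - plates - {0}"
  define G where "G z = T.coord (f (at_infty z))" for z
  define E where "E n k = T.chart -` F (at_infty ` plate X n k)" for n k
  have Weq: "W = {z. at_infty z \<in> ?\<Omega> \<and> f (at_infty z) \<noteq> proj \<alpha> \<gamma>}"
  proof -
    have "f (at_infty z) \<noteq> f Infty \<longleftrightarrow> z \<noteq> 0" if "z \<notin> plates" for z
      using injf[of "at_infty z" Infty] that at_infty_in_tree_domain Infty_in_tree_domain
      by (auto simp: at_infty_def)
    then show ?thesis by (auto simp: W_def at_infty_in_tree_domain c(1)[symmetric])
  qed
  have comp: "at_infty ` plate X n k \<in> comps ?\<Omega>" if "k < 2^n" for n k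
    by (rule plate_component) (use that in \<open>simp add: levels_def\<close>)
  have chartG: "T.chart (G z) = f (at_infty z)" if "z \<in> W" for z
    using that unfolding Weq G_def by simp
  \<comment> \<open>Components near \<open>p\<close>, and points of the domain near \<open>p\<close>, have images near \<open>F p\<close>.\<close>
  have track: "\<exists>U. open U \<and> x \<in> U \<and> (\<forall>y\<in>U. F (collapse ?\<Omega> y) \<subseteq> T.chart ` V)"
    if "x \<in> p" "p \<in> comps ?\<Omega>" "open V" "F p \<subseteq> T.chart ` V" for x p V
    using hat_extension_continuous[OF sD F that(1,2) FD[OF that(2)] T.open_chart_image[OF that(3)] that(4)] by metis
  have FE: "F (at_infty ` plate X n k) = T.chart ` E n k" if "k < 2^n" for n k
  proof -
    have "F (at_infty ` plate X n k) \<subseteq> - {proj \<alpha> \<gamma>}"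
      using comps_subset[OF FD[OF comp[OF that]]] fI c(1) by auto
    then show ?thesis unfolding E_def T.range_chart[symmetric] by (simp add: image_vimage_eq Int_absorb2)
  qed
  show False
  proof (rule no_tree_collapse[of X G W E])
    show "X n \<le> X (Suc n) - (1/2)^Suc n" for n by (rule gap)
    show "G holomorphic_on W"
      unfolding Weq G_def[abs_def] by (rule T.holomorphic_coord_compose[OF opO hol])
    show "inj_on G W"
    proof (rule inj_onI)
      fix x y assume xy: "x \<in> W" "y \<in> W" "G x = G y"
      then have "f (at_infty x) = f (at_infty y)" using chartG by metis
      then have "at_infty x = at_infty y" using injf xy(1,2) unfolding Weq by blast
      then show "x = y" using inj_at_infty by (auto dest: injD)
    qed
    show "bridge X (Suc n) j \<subseteq> W" if "j < 2^Suc n" for n j unfolding W_def by (rule bridge_avoids_plates)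
    show "\<exists>c r. 0 \<le> r \<and> E n k = cball c r" if "k < 2^n" for n k
      unfolding E_def by (rule T.chart_vimage_comps_circle_domain[OF D _ FD[OF comp[OF that]]]) (use fI c(1) in simp)
    show "E n k \<inter> E m j = {}" if kj: "k < 2^n" "j < 2^m" and ne: "(n,k) \<noteq> (m,j)" for n k m j
    proof (rule ccontr)
      assume "E n k \<inter> E m j \<noteq> {}"
      then obtain z where z: "T.chart z \<in> F (at_infty ` plate X n k)" "T.chart z \<in> F (at_infty ` plate X m j)"
        by (auto simp: E_def)
      then have "F (at_infty ` plate X n k) = F (at_infty ` plate X m j)"
        by (rule comps_eq[OF FD[OF comp[OF kj(1)]] FD[OF comp[OF kj(2)]]])
      then have "at_infty ` plate X n k = at_infty ` plate X m j"
        by (rule hat_extension_inj[OF F comp[OF kj(1)] comp[OF kj(2)]])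
      then have "plate X n k = plate X m j" using inj_at_infty by (simp add: inj_image_eq_iff)
      then show False using plate_nonempty[of n k] plates_disjoint[of _ n k m j] ne by blast
    qed
    show "0 \<notin> E n k" if k: "k < 2^n" for n k
    proof
      assume "0 \<in> E n k"
      then have "q \<in> F (at_infty ` plate X n k)" by (simp add: E_def q0)
      moreover have "q \<in> F {Fin 0}" by (simp add: q)
      ultimately have "F (at_infty ` plate X n k) = F {Fin 0}"
        by (rule comps_eq[OF FD[OF comp[OF k]] FD[OF z0]])
      then have "at_infty ` plate X n k = {Fin 0}" by (rule hat_extension_inj[OF F comp[OF k] z0])
      then show False using plate_nonempty[of n k] range_at_infty by blast
    qed
    show "\<exists>m0. \<forall>n\<ge>m0. \<forall>k<2^n. E n k \<subseteq> ball 0 s" if s: "s > 0" for s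
    proof -
      have "F {Fin 0} \<subseteq> T.chart ` ball 0 s" using s q0 by (auto simp: q)
      then obtain U where U: "open U" "Fin 0 \<in> U" "\<And>y. y \<in> U \<Longrightarrow> F (collapse ?\<Omega> y) \<subseteq> T.chart ` ball 0 s"
        using track[of "Fin 0" "{Fin 0}" "ball 0 s"] z0 by auto
      then obtain e where e: "e > 0" "ball (Fin 0) e \<subseteq> U" by (meson open_contains_ball)
      obtain m0 :: nat where m0: "2 / e < real m0" using reals_Archimedean2 by blast
      have "E n k \<subseteq> ball 0 s" if n: "n \<ge> m0" and k: "k < 2^n" for n k
      proof -
        obtain z where z: "z \<in> plate X n k" using plate_nonempty by blast
        have "real m0 \<le> cmod z"
          using n X_ge[of n] plate_re(1)[OF z] complex_Re_le_cmod[of z] by linarith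
        then have "2 / e < cmod z" using m0 by linarith
        moreover have "0 < 2 / e" using e(1) by simp
        ultimately have "0 < cmod z" by linarith
        then have zz: "z \<noteq> 0" "2 / cmod z < e" using \<open>2 / e < cmod z\<close> e(1) by (auto simp: field_simps)
        then have "at_infty z \<in> ball (Fin 0) e" using dist_at_infty_zero[OF zz(1)] by (simp add: dist_commute)
        then have "F (collapse ?\<Omega> (at_infty z)) \<subseteq> T.chart ` ball 0 s" using U(3) e(2) by blast
        then have "F (at_infty ` plate X n k) \<subseteq> T.chart ` ball 0 s"
          using collapse_plate[OF _ z] k by (simp add: levels_def)
        then show ?thesis unfolding FE[OF k] using T.inj_chart by (simp add: inj_image_subset_iff)
      qed
      then show ?thesis by blast
    qed
    show "\<exists>d>0. \<forall>w\<in>W. dist w z < d \<longrightarrow> (\<exists>p\<in>E n k. dist (G w) p < e)"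
      if k: "k < 2^n" and z: "z \<in> plate X n k" and e: "e > 0" for n k z e
    proof -
      define V where "V = (\<Union>p\<in>E n k. ball p e)"
      have "E n k \<subseteq> V" using e by (auto simp: V_def)
      then have "F (at_infty ` plate X n k) \<subseteq> T.chart ` V" unfolding FE[OF k] by blast
      moreover have "open V" by (auto simp: V_def)
      moreover have "at_infty z \<in> at_infty ` plate X n k" using z by blast
      ultimately obtain U where U: "open U" "at_infty z \<in> U" "\<And>y. y \<in> U \<Longrightarrow> F (collapse ?\<Omega> y) \<subseteq> T.chart ` V"
        using track[OF _ comp[OF k]] by metis
      have "open (at_infty -` U)" by (rule inf_chart.open_chart_vimage[OF U(1)])
      then obtain d where d: "d > 0" "ball z d \<subseteq> at_infty -` U" using U(2) by (meson open_contains_ball vimageI2)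
      have "\<exists>p\<in>E n k. dist (G w) p < e" if w: "w \<in> W" "dist w z < d" for w
      proof -
        have "at_infty w \<in> U" 
        proof -
          have "w \<in> ball z d" using w(2) by (simp add: dist_commute)
          then show ?thesis using d(2) by blast
        qed
        moreover have wO: "at_infty w \<in> ?\<Omega>" using w(1) by (simp add: Weq)
        ultimately have "F {at_infty w} \<subseteq> T.chart ` V" using U(3)[of "at_infty w"] by (simp add: collapse_def)
        moreover have "F {at_infty w} = {f (at_infty w)}" using F wO by (simp add: hat_extension_def)
        ultimately have "T.chart (G w) \<in> T.chart ` V" using chartG[OF w(1)] by simp
        then have "G w \<in> V" using T.inj_chart by (simp add: inj_image_mem_iff)
        then show ?thesis by (auto simp: V_def dist_commute)
      qed
      then show ?thesis using d(1) by blast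
    qed
  qed
qed

end

lemma tree_levels_geometric:
  fixes B :: real assumes "B \<ge> 2" shows "tree_levels (\<lambda>n. 4 * B ^ n)"
proof
  fix n
  have "1 \<le> B ^ n" using assms by (intro one_le_power) auto
  moreover have "2 * B ^ n \<le> B * B ^ n" using assms by (intro mult_right_mono) auto
  ultimately show "4 * B ^ n + 1 \<le> 4 * B ^ Suc n" unfolding power_Suc by linarith
qed simp

text \<open>The bound on \<open>B\<close> makes each term of level \<open>n\<close> at most \<open>4^-n\<close>, against \<open>2^n\<close> terms.\<close>

lemma summable_levels:
  assumes "\<alpha> > (0::real)" and B: "B \<ge> 2" "2 powr (2 / \<alpha>) \<le> B"
  shows "(\<lambda>(n,k). (4 / (4 * B ^ n)) powr \<alpha>) summable_on levels"
proof -
  have b: "(1 / B ^ n) powr \<alpha> \<le> (1/4) ^ n" for n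
  proof -
    have "4 = (2 powr (2 / \<alpha>)) powr \<alpha>" using assms(1) by (simp add: powr_powr)
    also have "\<dots> \<le> B powr \<alpha>" using assms(1) B by (intro powr_mono2) auto
    finally have "4 ^ n \<le> (B powr \<alpha>) ^ n" by (intro power_mono) auto
    also have "(B powr \<alpha>) ^ n = (B ^ n) powr \<alpha>"
      using B(1) by (simp add: powr_realpow[symmetric] powr_powr mult.commute)
    finally have 4: "4 ^ n \<le> (B ^ n) powr \<alpha>" .
    have "(4 / (4 * B ^ n)) powr \<alpha> = 1 / (B ^ n) powr \<alpha>"
      using B(1) by (simp add: powr_divide)
    also have "\<dots> \<le> 1 / 4 ^ n" using 4 B(1) by (intro divide_left_mono mult_pos_pos) auto
    finally have "(4 / (4 * B ^ n)) powr \<alpha> \<le> (1/4) ^ n" by (simp add: power_one_over)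
    then show ?thesis by simp
  qed
  have "(\<lambda>n. (1/2::real) ^ n) summable_on UNIV"
    by (intro norm_summable_imp_summable_on) (auto simp: summable_geometric)
  then have "(\<lambda>p. (1/4::real) ^ fst p) summable_on levels"
    unfolding levels_def
    by (intro summable_on_SigmaI[where g = "\<lambda>n. (1/2::real)^n"])
       (auto intro!: has_sum_finiteI simp: power_divide field_simps simp flip: power_mult_distrib)
  then show ?thesis
    by (rule summable_on_comparison_test) (use b in auto)
qed

theorem theorem1p4:
  fixes \<alpha> :: real
  assumes "\<alpha> > 0"
  shows "\<exists>\<Omega>. sphere_domain \<Omega> \<and> countably_connected \<Omega> \<and>
           (\<lambda>p. diameter p powr \<alpha>) summable_on comps \<Omega> \<and>
           {Fin 0} \<in> comps_P \<Omega> \<and>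
           (\<forall>D f. circle_domain D \<longrightarrow> conformal_homeomorphism \<Omega> D f \<longrightarrow>
              hat_map \<Omega> D f {Fin 0} \<in> comps_N D)"
proof -
  define B where "B = 2 powr (2 / \<alpha>) + 2"
  have B: "B \<ge> 2" "2 powr (2 / \<alpha>) \<le> B" by (auto simp: B_def)
  define X where "X n = 4 * B ^ n" for n
  interpret tree_levels X unfolding X_def[abs_def] by (rule tree_levels_geometric[OF B(1)])
  let ?\<Omega> = "tree_domain X"
  have "countable levels" unfolding levels_def by (rule countableI_type)
  then have "countably_connected ?\<Omega>"
    unfolding countably_connected_def comps_tree_domain by simp
  moreover have "(\<lambda>p. diameter p powr \<alpha>) summable_on comps ?\<Omega>"
  proof -
    have inj: "inj_on (\<lambda>(n,k). at_infty ` plate X n k) levels"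
    proof (rule inj_onI, clarify)
      fix n k m j assume "at_infty ` plate X n k = at_infty ` plate X m j"
      then have "plate X n k = plate X m j" using inj_at_infty by (simp add: inj_image_eq_iff)
      then show "n = m \<and> k = j" using plate_nonempty[of n k] plates_disjoint[of _ n k m j] by blast
    qed
    have "(\<lambda>(n,k). diameter (at_infty ` plate X n k) powr \<alpha>) summable_on levels"
    proof (rule summable_on_comparison_test[OF summable_levels[OF assms B]])
      fix p assume "p \<in> levels"
      obtain n k where p: "p = (n,k)" by (cases p)
      have nn: "0 \<le> diameter (at_infty ` plate X n k)"
        by (intro diameter_ge_0 compact_imp_bounded) (auto simp: plate_eq_cbox intro!: compact_continuous_image inf_chart.continuous_chart)
      then show "(case p of (n,k) \<Rightarrow> diameter (at_infty ` plate X n k) powr \<alpha>) \<le> (case p of (n,k) \<Rightarrow> (4 / (4 * B ^ n)) powr \<alpha>)"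
        using diameter_plate_le[of n k] assms by (auto simp: p X_def intro!: powr_mono2)
    qed (auto split: prod.splits)
    then have "((\<lambda>p. diameter p powr \<alpha>) \<circ> (\<lambda>(n,k). at_infty ` plate X n k)) summable_on levels"
      by (simp add: o_def case_prod_unfold)
    then have "(\<lambda>p. diameter p powr \<alpha>) summable_on (\<lambda>(n,k). at_infty ` plate X n k) ` levels"
      by (subst summable_on_reindex[OF inj])
    then show ?thesis unfolding comps_tree_domain by (subst summable_on_insert_iff)
  qed
  moreover have "hat_map ?\<Omega> D f {Fin 0} \<in> comps_N D"
    if D: "circle_domain D" and conf: "conformal_homeomorphism ?\<Omega> D f" for D f
  proof -
    obtain g where "homeomorphism ?\<Omega> D f g" using conf by (auto simp: conformal_homeomorphism_def)
    then have "\<exists>F. hat_extension ?\<Omega> D f F"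
      using D by (intro hat_extension_exists[OF domain_tree_domain]) (auto simp: circle_domain_def)
    then have "hat_extension ?\<Omega> D f (hat_map ?\<Omega> D f)" unfolding hat_map_def by (rule someI_ex)
    then show ?thesis by (rule conformal_image_of_zero[OF D conf])
  qed
  ultimately show ?thesis using domain_tree_domain zero_component by blast
qed

end
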